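(* Consider the block-fading link rate selection problem with horizon $T$, $M\ge 1$ channel change points, and channel coherence time $L$ (all defined in the context). Let $\delta_{\min}=\min_{h\neq h',\,i}|\theta_{h,i}-\theta_{h',i}|$. Suppose there exists $\alpha>0$ such that $$L\ \ge\ \frac{48}{\delta_{\min}^2}(MT)^{\alpha}\log (MT).$$ If the CD-TS algorithm is run with threshold $b=\delta_{\min}/2$, window size $w=\frac{12}{\delta_{\min}^2}\log (MT)$ and sampling period $F=(MT)^{\alpha}$, then its regret satisfies $$\mathcal{R}_T=\mathcal{O}\left((MT)^{\max(\alpha,\,1-\alpha)}\log (MT)\right),$$ where the implied constant depends only on $\alpha$, the rates $r_i$ and the success probabilities $\theta_{h,i}$.
   Context: Problem. Time is slotted, $t\in\{1,\dots,T\}$. The channel state $h(t)\in\{1,\dots,Q\}$ ($Q<\infty$) is deterministic but unknown to the transmitter. There are $M\ge1$ change points $\nu_1<\dots<\nu_M$ in the horizon; $h(t)$ is constant between successive change points (on $[\nu_m,\nu_{m+1}-1]$, as well as before $\nu_1$ and from $\nu_M$ to $T$), and $h(\nu_m-1)\ne h(\nu_m)$ for all $m$. Moreover $\nu_{m+1}-\nu_m\ge L$, where $L$ is the channel coherence time. The rates are $0<r_1<\dots<r_R$. In each slot the transmitter picks an index $i(t)\in\{1,\dots,R\}$, based only on past indices and outcomes (and internal randomness), and then observes $X(t)\in\{0,1\}$, which is Bernoulli with mean $\theta_{h(t),i(t)}$, independent of the outcomes in other slots. It is assumed that $1>\theta_{q,1}>\dots>\theta_{q,R}>0$ for each state $q$.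 Regret. With $i^*(h)=\arg\max_i r_i\theta_{h,i}$, $$\mathcal{R}_T=\mathbb{E}\Big[\sum_{t=1}^T\big(r_{i^*(h(t))}\theta_{h(t),i^*(h(t))}-r_{i(t)}\theta_{h(t),i(t)}\big)\Big].$$ CD-TS algorithm, with parameters $w$ (window size, positive integer), $b>0$ (threshold), $F\geq 2$ (sampling period, integer); non-integer values of $w$ and $F$ are rounded up. Let $c(t)$ denote the slot of the most recently declared change before slot $t$, with $c(1)=0$. Let $N_i(t),s_i(t),f_i(t)$ be the numbers of transmissions, successes and failures of rate $i$ in slots $c(t)+1,\dots,t-1$, all initially $0$. In slot $t$: (1) Rate selection. If $t=c(t)+kF$ for some integer $k\ge1$, use $i(t)=i_{\mathrm{cd}}=\arg\max_i \frac{s_i(c(t)+F)}{N_i(c(t)+F)}r_i$ (a rate with $N_i(c(t)+F)=0$ is given value $0$). Otherwise sample, independently over $i$, $\hat\lambda_i\sim\mathrm{Beta}(s_i(t)+1,f_i(t)+1)$ and use $i(t)=\arg\max_i\hat\lambda_i r_i$ (Thompson Sampling). (2) Transmit with rate $i(t)$, observe $X(t)$, and record it as the latest outcome of rate $i(t)$. (3) Change detection. If rate $i(t)$ has now been used more than $2w$ times since slot $c(t)$, let $\mathbb{M}_1$ be the mean of its latest $w$ outcomes and $\mathbb{M}_2$ the mean of its $w$ outcomes immediately before those. If $|\mathbb{M}_1-\mathbb{M}_2|>b$, declare a change: set $c(t+1)=t$ and erase the history of all rates ($N_i(t+1)=s_i(t+1)=f_i(t+1)=0$ for all $i$). In all other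 cases set $c(t+1)=c(t)$ and add the new outcome to the counts of rate $i(t)$.
   Formalization: The coherence condition is also required of the initial block (ν_1 − 1 ≥ L); without it L is unconstrained when M = 1, and an early change after about log T slots can cause nearly linear regret. δ_min > 0 is made explicit. *)

theory Defs
  imports "HOL-Probability.Probability"
begin

section \<open>Channel, transmission policies and regret\<close>

definition delta_min :: "nat \<Rightarrow> nat \<Rightarrow> (nat \<Rightarrow> nat \<Rightarrow> real) \<Rightarrow> real" where
  "delta_min Q R \<theta> =
     Min {\<bar>\<theta> q' i - \<theta> q i\<bar> | q q' i. q \<in> {1..Q} \<and> q' \<in> {1..Q} \<and> q \<noteq> q' \<and> i \<in> {1..R}}"

text \<open>
  The change points are \<open>\<nu> 1 < \<dots> < \<nu> M\<close>. The boundary values \<open>\<nu> 0 = 1\<close> and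
  \<open>\<nu> (M + 1) = T + 1\<close> are conventions, so that the blocks \<open>{\<nu> m..<\<nu> (m + 1)}\<close> with
  \<open>m \<le> M\<close> partition the horizon \<open>{1..T}\<close>. Every block that ends in a change point
  lasts at least the coherence time \<open>L\<close>, the initial one included; the last block is cut off
  by the horizon and may be shorter.
\<close>

definition block_fading ::
  "nat \<Rightarrow> nat \<Rightarrow> nat \<Rightarrow> nat \<Rightarrow> (nat \<Rightarrow> nat) \<Rightarrow> (nat \<Rightarrow> nat) \<Rightarrow> bool" where
  "block_fading Q T M L \<nu> h \<longleftrightarrow>
     1 \<le> M \<and>
     \<nu> 0 = 1 \<and> \<nu> (M + 1) = T + 1 \<and>
     (\<forall>m\<le>M. \<nu> m < \<nu> (m + 1)) \<and>
     (\<forall>t\<in>{1..T}. h t \<in> {1..Q}) \<and>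
     (\<forall>m\<le>M. \<forall>t\<in>{\<nu> m..<\<nu> (m + 1)}. h t = h (\<nu> m)) \<and>
     (\<forall>m\<in>{1..M}. h (\<nu> m - 1) \<noteq> h (\<nu> m)) \<and>
     (\<forall>m<M. L \<le> \<nu> (m + 1) - \<nu> m)"

text \<open>
  A history lists the pairs (rate index, outcome) with the latest slot first, so the history
  available in slot \<open>t\<close> has length \<open>t - 1\<close>.
\<close>

type_synonym history = "(nat \<times> bool) list"

text \<open>A policy maps the history to the distribution of the next rate index.\<close>

type_synonym policy = "history \<Rightarrow> nat pmf"

primrec history_pmf ::
  "(nat \<Rightarrow> nat \<Rightarrow> real) \<Rightarrow> (nat \<Rightarrow> nat) \<Rightarrow> policy \<Rightarrow> nat \<Rightarrow> history pmf" where
  "history_pmf \<theta> h \<pi> 0 = return_pmf []"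
| "history_pmf \<theta> h \<pi> (Suc n) =
     bind_pmf (history_pmf \<theta> h \<pi> n) (\<lambda>hs.
     bind_pmf (\<pi> hs) (\<lambda>i.
     map_pmf (\<lambda>x. (i, x) # hs) (bernoulli_pmf (\<theta> (h (Suc n)) i))))"

definition rate_at :: "history \<Rightarrow> nat \<Rightarrow> nat" where
  "rate_at hs t = fst (hs ! (length hs - t))"

definition best_rate :: "nat \<Rightarrow> (nat \<Rightarrow> real) \<Rightarrow> (nat \<Rightarrow> nat \<Rightarrow> real) \<Rightarrow> nat \<Rightarrow> nat" where
  "best_rate R r \<theta> q = arg_max_on (\<lambda>i. r i * \<theta> q i) {1..R}"

definition regret ::
  "nat \<Rightarrow> (nat \<Rightarrow> real) \<Rightarrow> (nat \<Rightarrow> nat \<Rightarrow> real) \<Rightarrow> (nat \<Rightarrow> nat) \<Rightarrow> policy \<Rightarrow> nat \<Rightarrow> real" where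
  "regret R r \<theta> h \<pi> T =
     measure_pmf.expectation (history_pmf \<theta> h \<pi> T) (\<lambda>hs.
       \<Sum>t = 1..T. r (best_rate R r \<theta> (h t)) * \<theta> (h t) (best_rate R r \<theta> (h t))
                 - r (rate_at hs t) * \<theta> (h t) (rate_at hs t))"


section \<open>The CD-TS algorithm\<close>

text \<open>The part of a history that belongs to the slots \<open>a + 1, \<dots>, n\<close>.\<close>

definition slots :: "nat \<Rightarrow> nat \<Rightarrow> history \<Rightarrow> history" where
  "slots a n hs = take (n - a) (drop (length hs - n) hs)"

definition outcomes :: "nat \<Rightarrow> history \<Rightarrow> bool list" where
  "outcomes i hs = map snd (filter (\<lambda>p. fst p = i) hs)"

definition transmissions :: "nat \<Rightarrow> history \<Rightarrow> nat" where
  "transmissions i hs = length (outcomes i hs)"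

definition successes :: "nat \<Rightarrow> history \<Rightarrow> nat" where
  "successes i hs = length (filter (\<lambda>x. x) (outcomes i hs))"

definition failures :: "nat \<Rightarrow> history \<Rightarrow> nat" where
  "failures i hs = length (filter (\<lambda>x. \<not> x) (outcomes i hs))"

definition mean_outcome :: "bool list \<Rightarrow> real" where
  "mean_outcome xs = (\<Sum>x\<leftarrow>xs. of_bool x) / real (length xs)"

text \<open>Here \<open>hs\<close> holds the slots since the last declared change, the current one included.\<close>

definition change_detected :: "nat \<Rightarrow> real \<Rightarrow> nat \<Rightarrow> history \<Rightarrow> bool" where
  "change_detected w b i hs \<longleftrightarrow>
     2 * w < transmissions i hs \<and>
     b < \<bar>mean_outcome (take w (outcomes i hs)) - mean_outcome (take w (drop w (outcomes i hs)))\<bar>"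

text \<open>For a history of the slots \<open>1, \<dots>, t - 1\<close> this is \<open>c(t)\<close>.\<close>

primrec last_change :: "nat \<Rightarrow> real \<Rightarrow> history \<Rightarrow> nat" where
  "last_change w b [] = 0"
| "last_change w b (p # hs) =
     (if change_detected w b (fst p) (slots (last_change w b hs) (length (p # hs)) (p # hs))
      then length (p # hs) else last_change w b hs)"

definition beta_distr :: "real \<Rightarrow> real \<Rightarrow> real measure" where
  "beta_distr a b = density lborel (\<lambda>x. ennreal
     (if x \<in> {0<..<1} then x powr (a - 1) * (1 - x) powr (b - 1) / Beta a b else 0))"

text \<open>
  The distribution of the index chosen by Thompson sampling; \<open>pmf_thompson_pmf\<close> below shows
  that the weights are indeed those of a probability mass function.
\<close>

definition thompson_samples :: "nat \<Rightarrow> history \<Rightarrow> (nat \<Rightarrow> real) measure" where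
  "thompson_samples R hs =
     (\<Pi>\<^sub>M i\<in>{1..R}. beta_distr (real (successes i hs) + 1) (real (failures i hs) + 1))"

definition thompson_pmf :: "nat \<Rightarrow> (nat \<Rightarrow> real) \<Rightarrow> history \<Rightarrow> nat pmf" where
  "thompson_pmf R r hs = embed_pmf (\<lambda>i. measure (thompson_samples R hs)
     {l \<in> space (thompson_samples R hs). arg_max_on (\<lambda>j. l j * r j) {1..R} = i})"

text \<open>A rate without transmissions gets the value \<open>0 / 0 * r i = 0\<close>.\<close>

definition empirical_best :: "nat \<Rightarrow> (nat \<Rightarrow> real) \<Rightarrow> history \<Rightarrow> nat" where
  "empirical_best R r hs =
     arg_max_on (\<lambda>i. real (successes i hs) / real (transmissions i hs) * r i) {1..R}"

definition cdts :: "nat \<Rightarrow> (nat \<Rightarrow> real) \<Rightarrow> nat \<Rightarrow> real \<Rightarrow> nat \<Rightarrow> policy" where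
  "cdts R r w b F hs =
     (let t = length hs + 1; c = last_change w b hs in
      if \<exists>k\<ge>1. t = c + k * F
      then return_pmf (empirical_best R r (slots c (c + F - 1) hs))
      else thompson_pmf R r (slots c (t - 1) hs))"


section \<open>Well-definedness of the Thompson sampling distribution\<close>

lemma prob_space_beta_distr:
  assumes "0 < a" "0 < b"
  shows "prob_space (beta_distr a b)"
proof
  let ?f = "\<lambda>x::real. x powr (a - 1) * (1 - x) powr (b - 1)"
  have I: "(?f has_integral Beta a b) {0<..<1}"
    using has_integral_Beta_real[OF assms] by (simp add: has_integral_Icc_iff_Ioo)
  have B: "0 < Beta a b"
    using assms by (simp add: Beta_def)
  have "((\<lambda>x. ?f x / Beta a b) has_integral 1) {0<..<1}"
    using has_integral_divide[OF I, of "Beta a b"] B by simp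
  then have "((\<lambda>x. if x \<in> {0<..<1} then ?f x / Beta a b else 0) has_integral 1) UNIV"
    by (simp only: has_integral_restrict_UNIV)
  then have "(\<integral>\<^sup>+x. ennreal (if x \<in> {0<..<1} then ?f x / Beta a b else 0) \<partial>lborel) = ennreal 1"
    using B by (intro nn_integral_has_integral_lborel) auto
  then show "emeasure (beta_distr a b) (space (beta_distr a b)) = 1"
    by (simp add: beta_distr_def emeasure_density)
qed

lemma sets_beta_distr [simp, measurable_cong]: "sets (beta_distr a b) = sets borel"
  by (simp add: beta_distr_def)

lemma prob_space_thompson_samples: "prob_space (thompson_samples R hs)"
  unfolding thompson_samples_def by (intro prob_space_PiM prob_space_beta_distr) auto

lemma arg_max_on_in:
  fixes f :: "'a \<Rightarrow> 'b :: linorder"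
  assumes "finite S" "S \<noteq> {}"
  shows "arg_max_on f S \<in> S"
proof -
  have "Max (f ` S) \<in> f ` S"
    using assms by (intro Max_in) auto
  then obtain x where "x \<in> S" "f x = Max (f ` S)"
    by force
  then have "is_arg_max f (\<lambda>x. x \<in> S) x"
    using assms by (auto simp: is_arg_max_linorder)
  then have "is_arg_max f (\<lambda>x. x \<in> S) (arg_max_on f S)"
    unfolding arg_max_on_def arg_max_def by (rule someI)
  then show ?thesis
    by (simp add: is_arg_max_def)
qed

lemma thompson_event_measurable:
  "{l \<in> space (thompson_samples R hs). arg_max_on (\<lambda>j. l j * r j) {1..R} = i}
     \<in> sets (thompson_samples R hs)"
proof -
  let ?P = "thompson_samples R hs"
  define best where
    "best l = {j \<in> {1..R}. \<forall>k\<in>{1..R}. l k * r k \<le> l j * r j}" for l :: "nat \<Rightarrow> real"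
  define pick where "pick A = (SOME j. j \<in> A)" for A :: "nat set"
  have c [measurable]: "(\<lambda>l. l j) \<in> borel_measurable ?P" if "j \<in> {1..R}" for j
    using that measurable_component_singleton[OF that,
        of "\<lambda>i. beta_distr (real (successes i hs) + 1) (real (failures i hs) + 1)"]
    unfolding thompson_samples_def by (simp cong: measurable_cong_sets)
  have eq: "arg_max_on (\<lambda>j. l j * r j) {1..R} = pick (best l)" for l
    unfolding arg_max_on_def arg_max_def pick_def best_def
    by (intro arg_cong[where f = Eps] ext) (auto simp: is_arg_max_linorder)
  have best: "best l \<subseteq> {1..R}" for l
    by (auto simp: best_def)
  have mem: "{l \<in> space ?P. j \<in> best l} \<in> sets ?P" for j
  proof (cases "j \<in> {1..R}")
    case True
    have "{l \<in> space ?P. j \<in> best l} = {l \<in> space ?P. \<forall>k\<in>{1..R}. l k * r k \<le> l j * r j}"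
      using True by (auto simp: best_def)
    also have "\<dots> \<in> sets ?P"
    proof (intro sets.sets_Collect_finite_All')
      fix k assume "k \<in> {1..R}"
      with True show "{l \<in> space ?P. l k * r k \<le> l j * r j} \<in> sets ?P"
        by (intro borel_measurable_le borel_measurable_times c) auto
    qed (use True in auto)
    finally show ?thesis .
  next
    case False
    then have "{l \<in> space ?P. j \<in> best l} = {}"
      using best by blast
    then show ?thesis
      by (simp only: sets.empty_sets)
  qed
  have A: "{l \<in> space ?P. best l = A} \<in> sets ?P" if "A \<subseteq> {1..R}" for A
  proof -
    have "{l \<in> space ?P. best l = A} =
        {l \<in> space ?P. \<forall>j\<in>{1..R}. (j \<in> best l) = (j \<in> A)}"
      using that best by blast
    also have "\<dots> \<in> sets ?P"
    proof (intro sets.sets_Collect_finite_All)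
      fix j
      show "{l \<in> space ?P. (j \<in> best l) = (j \<in> A)} \<in> sets ?P"
        using mem[of j] by (cases "j \<in> A") (auto intro: sets.sets_Collect_neg)
    qed auto
    finally show ?thesis .
  qed
  have "{l \<in> space ?P. arg_max_on (\<lambda>j. l j * r j) {1..R} = i} =
      (\<Union>A\<in>{A \<in> Pow {1..R}. pick A = i}. {l \<in> space ?P. best l = A})"
    unfolding eq using best by blast
  also have "\<dots> \<in> sets ?P"
  proof (intro sets.finite_UN)
    show "{l \<in> space ?P. best l = A} \<in> sets ?P" if "A \<in> {A \<in> Pow {1..R}. pick A = i}" for A
      using that by (intro A) blast
  qed simp
  finally show ?thesis .
qed

lemma pmf_thompson_pmf:
  assumes "1 \<le> R"
  shows "pmf (thompson_pmf R r hs) i = measure (thompson_samples R hs)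
    {l \<in> space (thompson_samples R hs). arg_max_on (\<lambda>j. l j * r j) {1..R} = i}"
proof -
  let ?P = "thompson_samples R hs"
  let ?E = "\<lambda>i. {l \<in> space ?P. arg_max_on (\<lambda>j. l j * r j) {1..R} = i}"
  interpret prob_space ?P by (rule prob_space_thompson_samples)
  have in_range: "arg_max_on (\<lambda>j. l j * r j) {1..R} \<in> {1..R}" for l
    using assms by (intro arg_max_on_in) auto
  have 0: "measure ?P (?E i) = 0" if "i \<notin> {1..R}" for i
  proof -
    have "?E i = {}"
      using that in_range by blast
    then show ?thesis
      by (simp only: measure_empty)
  qed
  have "(\<integral>\<^sup>+i. ennreal (measure ?P (?E i)) \<partial>count_space UNIV) =
      (\<Sum>i\<in>{1..R}. emeasure ?P (?E i))"
  proof (subst nn_integral_count_space'[of "{1..R}"])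
    show "ennreal (measure ?P (?E j)) = 0" if "j \<in> UNIV" "j \<notin> {1..R}" for j
      by (simp only: 0[OF that(2)] ennreal_0)
  qed (simp_all add: emeasure_eq_measure)
  also have "\<dots> = emeasure ?P (\<Union>i\<in>{1..R}. ?E i)"
  proof (intro sum_emeasure)
    show "?E ` {1..R} \<subseteq> sets ?P"
      using thompson_event_measurable by blast
    show "disjoint_family_on ?E {1..R}"
      unfolding disjoint_family_on_def by blast
  qed simp
  also have "(\<Union>i\<in>{1..R}. ?E i) = space ?P"
    using in_range by blast
  finally show ?thesis
    unfolding thompson_pmf_def by (intro pmf_embed_pmf) (simp_all add: emeasure_space_1)
qed

end

(*
  The run starts afresh at every declared change, so the regret obeys a renewal inequality and it
  suffices to bound the cost of one cycle, which begins shortly after one change point and ends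
  shortly after the next. By Hoeffding's inequality false alarms and unnoticed full windows have
  polynomially small probability; the forced slots cost O(T / F) altogether; and Thompson sampling
  in a constant state loses only O(log^2) per cycle.

  The delicate part is the detection delay. Forced sampling alone guarantees detection within w F
  slots, but M w F can exceed the claimed bound. Right after a change, however, Thompson sampling
  keeps choosing rates that were used often in the old state, and these fill a detection window
  within R w slots, unless it picks a rate used at most w times so far. Comparing the law of the
  outcomes of such a rate with the law under a uniformly distributed success probability (the
  likelihood ratio is a martingale) shows that the posterior probability of such a pick is about
  1 / F, up to a small power of M T. The only exception is a rate k with r k equal to the
  best expected rate; there the posterior spread of the best rate gives order 1 / sqrt (w F).
  The expected delay is thus O(log^(3/2) sqrt F) per change, and since M blocks of length L fit
  into the horizon, the delays add up to O(sqrt (M T) log (M T)).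
*)

theory Submission
  imports Defs "HOL-Real_Asymp.Real_Asymp"
begin

section \<open>Tail integrals of the Beta distribution\<close>

text \<open>Let n = M T. The coherence time only gives M of order sqrt (n / (F log n)), so M w F may
  reach sqrt (n F log n), which is too much when 1/3 < \<alpha> < 1. A delay of order sqrt F fits,
  because max (\<alpha>, 1 - \<alpha>) is never below 1/2.

  Thompson sampling uses the posterior of a uniform prior. The posterior probability of a half line
  is therefore a quotient of two likelihood ratios against the true parameter, and each of them is a
  martingale whatever the policy does, although choices depend on outcomes.

  Two levels around the best expected rate are involved. Above the upper one no often used arm
  interferes, so a rarely used arm that is likely to sample there gets tried. Above the lower one a
  heavily used best arm nearly always samples, so a rarely used arm must sample there in order to
  win. Passing from one level to the other costs a factor exponential in the number of failures, at
  most w, whose base tends to 1 as the levels approach each other; this is the small power of n. If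
  \<open>r k\<close> equals the best expected rate, samples of k never reach the upper level and the
  passage breaks down.\<close>

definition beta_tail :: "nat \<Rightarrow> nat \<Rightarrow> real \<Rightarrow> real" where
  "beta_tail s f y = integral {y..1} (\<lambda>x. x ^ s * (1 - x) ^ f)"

lemma beta_integrand_integrable:
  "(\<lambda>x. x ^ s * (1 - x) ^ f) integrable_on {a..b::real}"
  by (intro integrable_continuous_real continuous_intros)

lemma beta_tail_split:
  assumes "y \<le> z" "z \<le> 1"
  shows "beta_tail s f y = integral {y..z} (\<lambda>x. x ^ s * (1 - x) ^ f) + beta_tail s f z"
  unfolding beta_tail_def
  by (rule Henstock_Kurzweil_Integration.integral_combine[symmetric])
     (use assms beta_integrand_integrable in auto)

lemma beta_tail_nonneg: "0 \<le> y \<Longrightarrow> 0 \<le> beta_tail s f y"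
  unfolding beta_tail_def by (intro integral_nonneg beta_integrand_integrable) auto

lemma integral_beta_nonneg:
  "0 \<le> y \<Longrightarrow> z \<le> 1 \<Longrightarrow> 0 \<le> integral {y..z::real} (\<lambda>x. x ^ s * (1 - x) ^ f)"
  by (intro integral_nonneg beta_integrand_integrable) auto

lemma beta_tail_antimono: "0 \<le> y \<Longrightarrow> y \<le> z \<Longrightarrow> z \<le> 1 \<Longrightarrow> beta_tail s f z \<le> beta_tail s f y"
  using beta_tail_split[of y z s f] integral_beta_nonneg[of y z s f] by simp

text \<open>Since x + (1 - x) = 1. This identity becomes the martingale property of the likelihood
  ratios.\<close>

lemma beta_tail_Suc: "beta_tail (Suc s) f y + beta_tail s (Suc f) y = beta_tail s f y"
proof -
  have "beta_tail (Suc s) f y + beta_tail s (Suc f) y =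
      integral {y..1} (\<lambda>x. x ^ Suc s * (1 - x) ^ f + x ^ s * (1 - x) ^ Suc f)"
    unfolding beta_tail_def
    by (rule Henstock_Kurzweil_Integration.integral_add[symmetric]) (rule beta_integrand_integrable)+
  also have "\<dots> = beta_tail s f y"
    unfolding beta_tail_def by (rule integral_cong) (simp add: algebra_simps)
  finally show ?thesis .
qed

lemma has_integral_real_power:
  "a \<le> b \<Longrightarrow> ((\<lambda>x. x ^ k) has_integral ((b ^ Suc k - a ^ Suc k) / real (Suc k))) {a..b::real}"
proof -
  assume "a \<le> b"
  have "((\<lambda>x. x ^ k) has_integral (b ^ Suc k / real (Suc k) - a ^ Suc k / real (Suc k))) {a..b}"
  proof (rule fundamental_theorem_of_calculus[OF \<open>a \<le> b\<close>])
    show "((\<lambda>x. x ^ Suc k / real (Suc k)) has_vector_derivative x ^ k) (at x within {a..b})" for x :: real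
      using DERIV_cdivide[OF DERIV_pow[of "Suc k" x "{a..b}"], of "real (Suc k)"]
      by (simp add: has_real_derivative_iff_has_vector_derivative del: of_nat_Suc power_Suc)
  qed
  then show ?thesis
    by (simp add: diff_divide_distrib)
qed

lemma has_integral_one_minus_power:
  "a \<le> b \<Longrightarrow> ((\<lambda>x. (1 - x) ^ k) has_integral (((1 - a) ^ Suc k - (1 - b) ^ Suc k) / real (Suc k))) {a..b::real}"
proof -
  assume "a \<le> b"
  have "((\<lambda>x. (1 - x) ^ k) has_integral (- ((1 - b) ^ Suc k / real (Suc k)) - (- ((1 - a) ^ Suc k / real (Suc k))))) {a..b}"
  proof (rule fundamental_theorem_of_calculus[OF \<open>a \<le> b\<close>])
    show "((\<lambda>x. - ((1 - x) ^ Suc k / real (Suc k))) has_vector_derivative (1 - x) ^ k) (at x within {a..b})" for x :: real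
      using DERIV_minus[OF DERIV_cdivide[OF DERIV_power_Suc[OF DERIV_diff[OF DERIV_const[of 1] DERIV_ident[of "at x within {a..b}"]], of k], of "real (Suc k)"]]
      by (simp add: has_real_derivative_iff_has_vector_derivative del: power_Suc)
  qed
  then show ?thesis
    by (simp add: diff_divide_distrib)
qed

text \<open>Left of \<theta> the factor 1 - x is at least 1 - \<theta>, and the remaining power is
  integrated exactly.\<close>

lemma integral_beta_left_ge:
  assumes "0 \<le> y" "y \<le> \<theta>" "\<theta> \<le> 1"
  shows "(\<theta> - y) * (\<theta> ^ s * (1 - \<theta>) ^ f) / real (Suc s) \<le> integral {y..\<theta>} (\<lambda>x. x ^ s * (1 - x) ^ f)"
proof -
  have "(\<theta> - y) * \<theta> ^ s \<le> \<theta> ^ Suc s - y ^ Suc s"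
    using assms by (simp add: algebra_simps mult_left_mono power_mono)
  then have "(\<theta> - y) * (\<theta> ^ s * (1 - \<theta>) ^ f) / real (Suc s) \<le> (\<theta> ^ Suc s - y ^ Suc s) / real (Suc s) * (1 - \<theta>) ^ f"
    using assms by (simp add: divide_right_mono mult_right_mono mult.assoc[symmetric] del: power_Suc of_nat_Suc)
  also have "\<dots> = integral {y..\<theta>} (\<lambda>x. x ^ s * (1 - \<theta>) ^ f)"
    by (rule integral_unique[symmetric]) (rule has_integral_mult_left[OF has_integral_real_power[OF assms(2)]])
  also have "\<dots> \<le> integral {y..\<theta>} (\<lambda>x. x ^ s * (1 - x) ^ f)"
    using assms by (intro integral_le beta_integrand_integrable)
      (auto intro!: mult_left_mono power_mono integrable_continuous_real continuous_intros)
  finally show ?thesis .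
qed

lemma beta_tail_ge:
  assumes "0 \<le> y" "y \<le> 1"
  shows "y ^ s * (1 - y) ^ Suc f / real (Suc f) \<le> beta_tail s f y"
proof -
  have "y ^ s * (1 - y) ^ Suc f / real (Suc f) = integral {y..1} (\<lambda>x. y ^ s * (1 - x) ^ f)"
    using integral_unique[OF has_integral_mult_right[OF has_integral_one_minus_power[OF assms(2), of f], of "y ^ s"]]
    by (simp only: power_one diff_self power_0_Suc diff_zero times_divide_eq_right)
  also have "\<dots> \<le> beta_tail s f y"
    unfolding beta_tail_def
    using assms by (intro integral_le beta_integrand_integrable)
      (auto intro!: mult_right_mono power_mono integrable_continuous_real continuous_intros)
  finally show ?thesis .
qed

lemma beta_tail_le:
  assumes "0 \<le> y" "y \<le> 1"
  shows "beta_tail s f y \<le> (1 - y) ^ Suc f / real (Suc f)"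
proof -
  have "beta_tail s f y \<le> integral {y..1} (\<lambda>x. (1 - x) ^ f)"
    unfolding beta_tail_def
    using assms by (intro integral_le beta_integrand_integrable)
      (auto intro!: mult_left_le_one_le power_le_one integrable_continuous_real continuous_intros)
  also have "\<dots> = (1 - y) ^ Suc f / real (Suc f)"
    using has_integral_one_minus_power[OF assms(2), of f] by (simp add: integral_unique)
  finally show ?thesis .
qed

lemma beta_tail_mean_ge:
  assumes "0 \<le> y" "y \<le> \<theta>" "\<theta> \<le> 1"
  shows "(\<theta> - y) * (\<theta> ^ s * (1 - \<theta>) ^ f) \<le> real (Suc s) * beta_tail s f y"
proof -
  have "beta_tail s f \<theta> \<ge> 0"
    using assms by (intro beta_tail_nonneg) auto
  then have "(\<theta> - y) * (\<theta> ^ s * (1 - \<theta>) ^ f) / real (Suc s) \<le> beta_tail s f y"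
    using integral_beta_left_ge[OF assms, of s f] beta_tail_split[of y \<theta> s f] assms by linarith
  then show ?thesis
    by (simp add: pos_divide_le_eq mult.commute del: of_nat_Suc)
qed

text \<open>A uniformly distributed parameter loses at most the factor s + f + 1 in likelihood
  against any fixed one. The point value is split into the shares \<theta> and 1 - \<theta>, which
  are charged to the integrals left and right of \<theta>.\<close>

lemma beta_tail_0_ge:
  assumes "0 \<le> \<theta>" "\<theta> \<le> 1"
  shows "\<theta> ^ s * (1 - \<theta>) ^ f \<le> real (s + f + 1) * beta_tail s f 0"
proof -
  let ?p = "\<theta> ^ s * (1 - \<theta>) ^ f" and ?j = "real (s + f + 1)"
  have p: "0 \<le> ?p"
    using assms by simp
  have "?p / ?j = \<theta> * ?p / ?j + (1 - \<theta>) * ?p / ?j"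
    by (simp only: left_diff_distrib diff_divide_distrib mult_1)
  also have "\<dots> \<le> \<theta> * ?p / real (Suc s) + (1 - \<theta>) * ?p / real (Suc f)"
    using assms p by (intro add_mono divide_left_mono) (auto intro!: mult_nonneg_nonneg)
  also have "\<dots> \<le> beta_tail s f 0"
    using integral_beta_left_ge[of 0 \<theta> s f] beta_tail_ge[of \<theta> s f] beta_tail_split[of 0 \<theta> s f] assms
    by (simp add: mult_ac del: of_nat_Suc)
  finally show ?thesis
    by (simp add: field_simps)
qed

lemma beta_tail_0_pos: "0 < beta_tail s f 0"
proof -
  have "0 < (1/2::real) ^ s * (1 - 1/2) ^ f"
    by simp
  also have "\<dots> \<le> real (s + f + 1) * beta_tail s f 0"
    by (rule beta_tail_0_ge) auto
  finally show ?thesis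
    by (simp add: zero_less_mult_iff)
qed

lemma beta_tail_lt_pos:
  assumes "0 \<le> y" "y < 1"
  shows "0 < beta_tail s f y"
proof -
  \<comment> \<open>At y itself the bound \<open>beta_tail_ge\<close> may vanish (y = 0), so it is
    used at the midpoint of y and 1.\<close>
  let ?z = "(y + 1) / 2"
  have "0 < ?z ^ s * (1 - ?z) ^ Suc f / real (Suc f)"
    using assms by (intro divide_pos_pos mult_pos_pos) (auto simp del: power_Suc)
  also have "\<dots> \<le> beta_tail s f ?z"
    using assms by (intro beta_tail_ge) auto
  also have "\<dots> \<le> beta_tail s f y"
    using assms by (intro beta_tail_antimono) auto
  finally show ?thesis .
qed

lemma beta_tail_0_eq_Beta: "beta_tail s f 0 = Beta (real s + 1) (real f + 1)"
proof -
  have "((\<lambda>x. x powr (real s + 1 - 1) * (1 - x) powr (real f + 1 - 1)) has_integral Beta (real s + 1) (real f + 1)) {0<..<1}"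
    using has_integral_Beta_real[of "real s + 1" "real f + 1"] by (simp add: has_integral_Icc_iff_Ioo)
  moreover have "x powr (real s + 1 - 1) * (1 - x) powr (real f + 1 - 1) = x ^ s * (1 - x) ^ f" if "x \<in> {0<..<1}" for x :: real
    using that by (simp add: powr_realpow)
  ultimately have "((\<lambda>x. x ^ s * (1 - x) ^ f) has_integral Beta (real s + 1) (real f + 1)) {0<..<1}"
    by (subst has_integral_cong[symmetric]) auto
  then show ?thesis
    unfolding beta_tail_def by (simp add: has_integral_Icc_iff_Ioo integral_unique)
qed

subsection \<open>Probabilities under the Beta distribution\<close>

definition upper_prob :: "nat \<Rightarrow> nat \<Rightarrow> real \<Rightarrow> real" where
  "upper_prob s f y = measure (beta_distr (real s + 1) (real f + 1)) {y<..}"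

lemma prob_space_beta_nat: "prob_space (beta_distr (real s + 1) (real f + 1))"
  by (rule prob_space_beta_distr) auto

lemma upper_prob_nonneg: "0 \<le> upper_prob s f y"
  by (simp add: upper_prob_def)

lemma upper_prob_le_1: "upper_prob s f y \<le> 1"
  unfolding upper_prob_def by (rule prob_space.prob_le_1[OF prob_space_beta_nat])

lemma lower_prob_eq:
  "measure (beta_distr (real s + 1) (real f + 1)) {..y} = 1 - upper_prob s f y"
proof -
  interpret prob_space "beta_distr (real s + 1) (real f + 1)" by (rule prob_space_beta_nat)
  have "UNIV - {y<..} = {..y}" by auto
  moreover have "space (beta_distr (real s + 1) (real f + 1)) = UNIV"
    by (simp add: beta_distr_def)
  ultimately show ?thesis
    using prob_compl[of "{y<..}"] by (simp add: upper_prob_def)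
qed

lemma nn_integral_beta_nat:
  assumes "\<And>x. 0 \<le> x \<Longrightarrow> x \<le> 1 \<Longrightarrow> 0 \<le> g x" and [measurable]: "g \<in> borel_measurable borel"
    and "((\<lambda>x. g x * (x ^ s * (1 - x) ^ f)) has_integral I) {0<..<1}"
  shows "(\<integral>\<^sup>+x. ennreal (g x) \<partial>beta_distr (real s + 1) (real f + 1)) = ennreal (I / beta_tail s f 0)"
proof -
  let ?d = "\<lambda>x. if x \<in> {0<..<1} then g x * (x ^ s * (1 - x) ^ f) / beta_tail s f 0 else 0"
  have pos: "0 < beta_tail s f 0" by (rule beta_tail_0_pos)
  have "(\<integral>\<^sup>+x. ennreal (g x) \<partial>beta_distr (real s + 1) (real f + 1)) =
     (\<integral>\<^sup>+x. ennreal (if x \<in> {0<..<1} then x powr (real s + 1 - 1) * (1 - x) powr (real f + 1 - 1) / Beta (real s + 1) (real f + 1) else 0) * ennreal (g x) \<partial>lborel)"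
    unfolding beta_distr_def by (subst nn_integral_density) auto
  also have "\<dots> = (\<integral>\<^sup>+x. ennreal (?d x) \<partial>lborel)"
    using assms(1) pos
    by (intro nn_integral_cong)
       (auto simp: powr_realpow beta_tail_0_eq_Beta[symmetric] ennreal_mult'[symmetric] mult_ac simp flip: ennreal_mult)
  also have "\<dots> = ennreal (I / beta_tail s f 0)"
  proof (rule nn_integral_has_integral_lborel)
    show "0 \<le> ?d x" for x
      using assms(1) pos by auto
    have "((\<lambda>x. g x * (x ^ s * (1 - x) ^ f) / beta_tail s f 0) has_integral (I / beta_tail s f 0)) {0<..<1}"
      using assms(3) by (rule has_integral_divide)
    then show "(?d has_integral (I / beta_tail s f 0)) UNIV"
      by (simp only: has_integral_restrict_UNIV)
  qed measurable
  finally show ?thesis .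
qed

lemma upper_prob_eq:
  assumes "0 \<le> y" "y \<le> 1"
  shows "upper_prob s f y = beta_tail s f y / beta_tail s f 0"
proof -
  have "((\<lambda>x. x ^ s * (1 - x) ^ f) has_integral beta_tail s f y) {y<..<1}"
    unfolding beta_tail_def has_integral_Icc_iff_Ioo[symmetric]
    by (rule integrable_integral) (rule beta_integrand_integrable)
  then have "((\<lambda>x. if x \<in> {y<..<1} then x ^ s * (1 - x) ^ f else 0) has_integral beta_tail s f y) UNIV"
    by (simp only: has_integral_restrict_UNIV)
  moreover have "(\<lambda>x. if x \<in> {y<..<1} then x ^ s * (1 - x) ^ f else 0) =
     (\<lambda>x. if x \<in> {0<..<1} then indicator {y<..} x * (x ^ s * (1 - x) ^ f) else 0)"
    using assms by (auto simp: fun_eq_iff)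
  ultimately have "((\<lambda>x. indicator {y<..} x * (x ^ s * (1 - x) ^ f)) has_integral beta_tail s f y) {0<..<1}"
    by (simp only: has_integral_restrict_UNIV)
  then have "(\<integral>\<^sup>+x. ennreal (indicator {y<..} x) \<partial>beta_distr (real s + 1) (real f + 1)) = ennreal (beta_tail s f y / beta_tail s f 0)"
    by (intro nn_integral_beta_nat) auto
  then have "emeasure (beta_distr (real s + 1) (real f + 1)) {y<..} = ennreal (beta_tail s f y / beta_tail s f 0)"
    by (simp add: ennreal_indicator)
  then show ?thesis
    unfolding upper_prob_def measure_def
    using beta_tail_nonneg[OF assms(1), of s f] beta_tail_0_pos[of s f] by simp
qed

lemma upper_prob_ge_1:
  assumes "1 \<le> y" shows "upper_prob s f y = 0"
proof -
  interpret prob_space "beta_distr (real s + 1) (real f + 1)" by (rule prob_space_beta_nat)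
  have "upper_prob s f y \<le> upper_prob s f 1"
    unfolding upper_prob_def using assms by (intro finite_measure_mono) auto
  also have "\<dots> = 0"
    by (simp add: upper_prob_eq beta_tail_def)
  finally show ?thesis
    using upper_prob_nonneg[of s f y] by simp
qed

text \<open>The substitution of 1 - x for x exchanges successes and failures; lower tails thus
  reduce to upper tails.\<close>

lemma beta_tail_reflect:
  assumes "0 \<le> y" "y \<le> 1"
  shows "beta_tail f s (1 - y) = beta_tail s f 0 - beta_tail s f y"
proof -
  have "((\<lambda>x. x ^ s * (1 - x) ^ f) has_integral integral {0..y} (\<lambda>x. x ^ s * (1 - x) ^ f)) (cbox 0 y)"
    using integrable_integral[OF beta_integrand_integrable[of s f 0 y]] by simp
  from has_integral_affinity[OF this, of "-1" 1]
  have "((\<lambda>x. (1 - x) ^ s * x ^ f) has_integral integral {0..y} (\<lambda>x. x ^ s * (1 - x) ^ f)) ((\<lambda>x. 1 - x) ` {0..y})"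
    by (simp add: image_affinity_cbox) 
  also have "(\<lambda>x. 1 - x) ` {0..y} = {1 - y..1::real}"
    by auto
  finally show ?thesis
    using beta_tail_split[of 0 y s f] assms
    by (simp add: beta_tail_def integral_unique mult.commute)
qed

lemma upper_prob_reflect:
  assumes "0 \<le> y" "y \<le> 1"
  shows "upper_prob f s (1 - y) = 1 - upper_prob s f y"
proof -
  have "beta_tail f s 0 = beta_tail s f 0"
    using beta_tail_reflect[where y = 1 and s = s and f = f] by (simp add: beta_tail_def[of s f 1])
  then show ?thesis
    using assms beta_tail_0_pos[of s f] beta_tail_reflect[OF assms, where s = s and f = f]
    by (simp add: upper_prob_eq diff_divide_distrib)
qed

section \<open>Concentration, change of level and second moment of the posterior\<close>

lemma power2_sum_le: "(a + b)\<^sup>2 \<le> 2 * a\<^sup>2 + 2 * b\<^sup>2" for a b :: real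
proof -
  have "2 * a\<^sup>2 + 2 * b\<^sup>2 - (a + b)\<^sup>2 = (a - b)\<^sup>2"
    by (simp add: power2_eq_square algebra_simps)
  then show ?thesis
    using zero_le_power2[of "a - b"] by linarith
qed

lemma one_plus_power_le_exp: "- 1 \<le> u \<Longrightarrow> (1 + u) ^ n \<le> exp (real n * u)" for u :: real
  using power_mono[OF exp_ge_add_one_self, of u n] by (simp add: exp_of_nat_mult)

text \<open>Concavity of the log likelihood: it lies below its tangent at z, whose slope is (s - (s
  + f) z) / (z (1 - z)).\<close>

lemma beta_integrand_compare:
  fixes x z :: real
  assumes "0 < z" "z < 1" "0 \<le> x" "x \<le> 1"
  shows "x ^ s * (1 - x) ^ f \<le>
    z ^ s * (1 - z) ^ f * exp ((x - z) * (real s - real (s + f) * z) / (z * (1 - z)))"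
proof -
  have "(x / z) ^ s \<le> exp (real s * ((x - z) / z))"
    using one_plus_power_le_exp[of "(x - z) / z" s] assms by (simp add: field_simps)
  moreover have "((1 - x) / (1 - z)) ^ f \<le> exp (real f * (- ((x - z) / (1 - z))))"
    using one_plus_power_le_exp[of "- ((x - z) / (1 - z))" f] assms by (simp add: field_simps)
  ultimately have "(x / z) ^ s * ((1 - x) / (1 - z)) ^ f \<le> exp (real s * ((x - z) / z)) * exp (real f * (- ((x - z) / (1 - z))))"
    using assms by (intro mult_mono) auto
  also have "\<dots> = exp ((x - z) * (real s - real (s + f) * z) / (z * (1 - z)))"
    using assms by (simp add: field_simps flip: exp_add)
  finally have "x ^ s * (1 - x) ^ f / (z ^ s * (1 - z) ^ f) \<le> exp ((x - z) * (real s - real (s + f) * z) / (z * (1 - z)))"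
    by (simp add: power_divide)
  then show ?thesis
    using assms by (simp add: pos_divide_le_eq mult_ac)
qed

lemma upper_prob_tail:
  assumes "0 < e" "real s \<le> real (s + f) * (y - e)"
  shows "upper_prob s f y \<le> real (s + f + 1) * exp (- (real (s + f) * e\<^sup>2))"
proof (cases "s + f = 0 \<or> 1 \<le> y")
  case True
  then show ?thesis
    using upper_prob_ge_1[of y s f] upper_prob_le_1[of s f y] by auto
next
  case False
  \<comment> \<open>Half way between the level y and the bound y - e on the empirical mean. Both x -
    z and the distance from the empirical mean to z are then at least e / 2, and z (1 - z) \<le> 1/4
    turns the exponent into (s + f) e^2.\<close>
  define z where "z = y - e / 2"
  have ye: "0 \<le> y - e"
  proof (rule ccontr)
    assume "\<not> 0 \<le> y - e"
    then have "real (s + f) * (y - e) < 0"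
      using False by (intro mult_pos_neg) auto
    then show False using assms(2) by linarith
  qed
  have z: "0 < z" "z < 1" "0 \<le> y" "y < 1"
    using ye assms(1) False by (auto simp: z_def)
  let ?g = "z ^ s * (1 - z) ^ f"
  have zz: "z * (1 - z) \<le> 1 / 4"
    using zero_le_power2[of "z - 1 / 2"] by (simp add: power2_eq_square algebra_simps)
  have "x ^ s * (1 - x) ^ f \<le> ?g * exp (- (real (s + f) * e\<^sup>2))" if x: "x \<in> {y..1}" for x
  proof -
    have d: "real (s + f) * (e / 2) \<le> real (s + f) * z - real s"
      using assms(2) by (simp add: z_def algebra_simps)
    have "(e / 2) * (real (s + f) * (e / 2)) \<le> (x - z) * (real (s + f) * z - real s)"
      using x assms(1) d by (intro mult_mono) (auto simp: z_def)
    moreover have "(e / 2) * (real (s + f) * (e / 2)) = real (s + f) * e\<^sup>2 * (1 / 4)"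
      by (simp add: power2_eq_square)
    moreover have "real (s + f) * e\<^sup>2 * (z * (1 - z)) \<le> real (s + f) * e\<^sup>2 * (1 / 4)"
      using zz by (intro mult_left_mono) auto
    ultimately have "real (s + f) * e\<^sup>2 * (z * (1 - z)) \<le> (x - z) * (real (s + f) * z - real s)"
      by linarith
    then have "(x - z) * (real s - real (s + f) * z) / (z * (1 - z)) \<le> - (real (s + f) * e\<^sup>2)"
      using z by (simp add: pos_divide_le_eq right_diff_distrib)
    then show ?thesis
      using beta_integrand_compare[of z x s f] z x
      by (intro order.trans[OF beta_integrand_compare[of z x s f]] mult_left_mono) auto
  qed
  then have "beta_tail s f y \<le> integral {y..1} (\<lambda>x. ?g * exp (- (real (s + f) * e\<^sup>2)))"
    unfolding beta_tail_def by (intro integral_le beta_integrand_integrable) auto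
  also have "\<dots> = (1 - y) * (?g * exp (- (real (s + f) * e\<^sup>2)))"
    using z by simp
  also have "\<dots> \<le> ?g * exp (- (real (s + f) * e\<^sup>2))"
    using z by (intro mult_left_le_one_le) auto
  also have "\<dots> \<le> real (s + f + 1) * beta_tail s f 0 * exp (- (real (s + f) * e\<^sup>2))"
    using z by (intro mult_right_mono beta_tail_0_ge) auto
  finally show ?thesis
    using z beta_tail_0_pos[of s f] by (simp add: upper_prob_eq pos_divide_le_eq mult_ac)
qed

lemma lower_prob_tail:
  assumes "0 < e" "0 \<le> y" "y \<le> 1" "real (s + f) * (y + e) \<le> real s"
  shows "1 - upper_prob s f y \<le> real (s + f + 1) * exp (- (real (s + f) * e\<^sup>2))"
proof -
  have "1 - upper_prob s f y = upper_prob f s (1 - y)"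
    using assms by (intro upper_prob_reflect[symmetric]) auto
  also have "\<dots> \<le> real (f + s + 1) * exp (- (real (f + s) * e\<^sup>2))"
    using assms by (intro upper_prob_tail) (auto simp: algebra_simps)
  finally show ?thesis
    by (simp add: add_ac)
qed

text \<open>The shares (z - y) / (1 - y) and (1 - z) / (1 - y) sum to 1, and the integral over
  {y..z} and the tail beyond z are each bounded by their share. The price of lowering a level is
  thus exponential in the failures only, not in the successes.\<close>

lemma beta_tail_ratio:
  assumes "0 \<le> y" "y \<le> z" "z < 1"
  shows "beta_tail s f y \<le> real (Suc f) * ((1 - y) / (1 - z)) ^ Suc f * beta_tail s f z"
proof -
  let ?t = "beta_tail s f z" and ?k = "(1 - y) / (1 - z)"
  have t: "z ^ s * (1 - z) ^ Suc f \<le> real (Suc f) * ?t"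
    using beta_tail_ge[of z s f] assms by (simp add: pos_divide_le_eq mult.commute del: of_nat_Suc)
  have k1: "1 \<le> ?k" using assms by simp
  have t0: "0 \<le> ?t" using assms by (intro beta_tail_nonneg) auto
  have "integral {y..z} (\<lambda>x. x ^ s * (1 - x) ^ f) \<le> integral {y..z} (\<lambda>x. z ^ s * (1 - y) ^ f)"
    using assms by (intro integral_le beta_integrand_integrable) (auto intro!: mult_mono power_mono)
  also have "\<dots> = (z - y) * (1 - y) ^ f * z ^ s"
    using assms by simp
  also have "\<dots> = (z - y) / (1 - y) * ?k ^ Suc f * (z ^ s * (1 - z) ^ Suc f)"
    using assms by (simp add: power_divide)
  also have "\<dots> \<le> (z - y) / (1 - y) * ?k ^ Suc f * (real (Suc f) * ?t)"
    using assms t by (intro mult_left_mono) (auto simp del: power_Suc)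
  finally have A: "integral {y..z} (\<lambda>x. x ^ s * (1 - x) ^ f) \<le> (z - y) / (1 - y) * (real (Suc f) * ?k ^ Suc f * ?t)"
    by (simp only: mult_ac)
  have "?t = (1 - z) / (1 - y) * (?k * ?t)"
    using assms by simp
  also have "\<dots> \<le> (1 - z) / (1 - y) * (real (Suc f) * ?k ^ Suc f * ?t)"
  proof (intro mult_left_mono mult_right_mono t0)
    have "1 * ?k ^ 1 \<le> real (Suc f) * ?k ^ Suc f"
      using k1 by (intro mult_mono power_increasing) auto
    then show "?k \<le> real (Suc f) * ?k ^ Suc f" by simp
  qed (use assms in auto)
  finally have B: "?t \<le> (1 - z) / (1 - y) * (real (Suc f) * ?k ^ Suc f * ?t)" .
  have "(z - y) / (1 - y) + (1 - z) / (1 - y) = 1"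
    using assms by (simp add: field_simps)
  then have "(z - y) / (1 - y) * (real (Suc f) * ?k ^ Suc f * ?t) + (1 - z) / (1 - y) * (real (Suc f) * ?k ^ Suc f * ?t) = real (Suc f) * ?k ^ Suc f * ?t"
    by (simp only: distrib_right[symmetric] mult_1)
  then show ?thesis
    using A B beta_tail_split[of y z s f] assms by simp
qed

lemma upper_prob_ratio:
  assumes "0 \<le> y" "y \<le> z" "z < 1"
  shows "upper_prob s f y \<le> real (Suc f) * ((1 - y) / (1 - z)) ^ Suc f * upper_prob s f z"
  using beta_tail_ratio[OF assms, of s f] assms beta_tail_0_pos[of s f]
  by (simp add: upper_prob_eq divide_right_mono del: of_nat_Suc power_Suc)

text \<open>The density is at most s + 1 here, so the tail is only linear in 1 - v. One failure
  makes it quadratic, as the next lemma shows; the case of a tie has to treat the two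
  differently.\<close>

lemma upper_prob_no_failures:
  assumes "v \<le> 1" shows "upper_prob s 0 v \<le> real (Suc s) * (1 - v)"
proof (cases "0 \<le> v")
  case True
  have "1 \<le> real (Suc s) * beta_tail s 0 0"
    using beta_tail_0_ge[of 1 s 0] by simp
  then have "(1 - v) * 1 \<le> (1 - v) * (real (Suc s) * beta_tail s 0 0)"
    using assms by (intro mult_left_mono) auto
  moreover have "beta_tail s 0 v \<le> 1 - v"
    using beta_tail_le[of v s 0] True assms by simp
  ultimately show ?thesis
    using True assms beta_tail_0_pos[of s 0] by (simp add: upper_prob_eq pos_divide_le_eq mult_ac del: of_nat_Suc)
next
  case False
  then have "1 * 1 \<le> real (Suc s) * (1 - v)"
    by (intro mult_mono) auto
  then show ?thesis
    using upper_prob_le_1[of s 0 v] by linarith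
qed

lemma upper_prob_failures:
  assumes "v \<le> 1" "1 \<le> f"
  shows "upper_prob s f v \<le> 2 * (real (s + f + 1))\<^sup>2 * (1 - v)\<^sup>2"
proof -
  define j where "j = s + f"
  have j: "1 \<le> j" using assms by (simp add: j_def)
  define a where "a = real (j + 1) * (1 - v)"
  have a0: "0 \<le> a" using assms by (simp add: a_def)
  have "upper_prob s f v \<le> 2 * a\<^sup>2"
  proof (cases "a \<le> 1")
    case False
    then have "1 * 1 \<le> a * a" by (intro mult_mono) auto
    then show ?thesis using upper_prob_le_1[of s f v] by (simp add: power2_eq_square)
  next
    case True
    have "1 - v \<le> a"
      unfolding a_def using assms by (intro mult_le_cancel_right1[THEN iffD2]) auto
    then have v: "0 \<le> v" using True by linarith
    \<comment> \<open>With this parameter (1 - \<theta>) ^ f is a power of 1 / (j + 1), while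
      \<theta> ^ s stays above 1/3 because (1 + 1 / j) ^ j \<le> e.\<close>
    define \<theta> where "\<theta> = real j / real (j + 1)"
    have th: "0 < \<theta>" "\<theta> < 1" "1 - \<theta> = 1 / real (j + 1)"
      using j by (auto simp: \<theta>_def field_simps)
    have "1 / \<theta> = 1 + 1 / real j"
      using j by (simp add: \<theta>_def add_divide_distrib)
    then have "(1 / \<theta>) ^ s \<le> (1 + 1 / real j) ^ j"
      using j by (simp only:) (intro power_increasing, auto simp: j_def)
    also have "\<dots> \<le> exp (real j * (1 / real j))"
      by (rule one_plus_power_le_exp) (rule order.trans[of _ 0], auto)
    also have "\<dots> \<le> 3"
      using j exp_le by simp
    finally have "1 \<le> 3 * \<theta> ^ s"
      using th by (simp add: power_divide field_simps)
    then have "1 * (1 - \<theta>) ^ f \<le> (3 * \<theta> ^ s) * (1 - \<theta>) ^ f"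
      using th by (intro mult_right_mono) auto
    also have "\<dots> \<le> 3 * (real (j + 1) * beta_tail s f 0)"
      using beta_tail_0_ge[of \<theta> s f] th by (simp add: j_def)
    finally have B: "1 \<le> 3 * real (j + 1) ^ Suc f * beta_tail s f 0"
      using th(3) by (simp add: power_divide field_simps)
    have "beta_tail s f v \<le> (1 - v) ^ Suc f / real (Suc f)"
      using v assms by (intro beta_tail_le) auto
    also have "\<dots> \<le> (1 - v) ^ Suc f / 2"
      using assms by (intro divide_left_mono) auto
    also have "\<dots> = (1 - v) ^ Suc f / 2 * 1" by simp
    also have "\<dots> \<le> (1 - v) ^ Suc f / 2 * (3 * real (j + 1) ^ Suc f * beta_tail s f 0)"
      using B assms by (intro mult_left_mono) (auto simp del: power_Suc)
    also have "\<dots> = 3 / 2 * a ^ Suc f * beta_tail s f 0"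
      by (simp add: a_def power_mult_distrib)
    also have "\<dots> \<le> 2 * a\<^sup>2 * beta_tail s f 0"
    proof (intro mult_right_mono mult_mono)
      show "a ^ Suc f \<le> a\<^sup>2"
        using a0 True assms by (intro power_decreasing) auto
    qed (use beta_tail_0_pos[of s f] a0 in auto)
    finally show ?thesis
      using v assms beta_tail_0_pos[of s f] by (simp add: upper_prob_eq pos_divide_le_eq)
  qed
  then show ?thesis
    by (simp add: a_def j_def power_mult_distrib)
qed

text \<open>Squared bias plus variance: with j = s + f the posterior has mean m = (s + 1) / (j + 2)
  and variance m (1 - m) / (j + 3).\<close>

lemma beta_second_moment:
  assumes "0 \<le> \<theta>" "\<theta> \<le> 1"
  shows "(\<integral>\<^sup>+x. ennreal ((x - \<theta>)\<^sup>2) \<partial>beta_distr (real s + 1) (real f + 1)) \<le>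
    ennreal (2 * (real s - \<theta> * real (s + f))\<^sup>2 / (real (s + f + 1))\<^sup>2 + 2 / real (s + f + 1))"
proof -
  have step: "beta_tail (Suc s) f 0 = beta_tail s f 0 * (real s + 1) / (real (s + f) + 2)" for s
  proof -
    have "real s + 1 \<notin> \<int>\<^sub>\<le>\<^sub>0"
      using nonpos_Ints_nonpos[of "real s + 1"] by auto
    then show ?thesis
      using Beta_plus1_left[of "real s + 1" "real f + 1"]
      by (simp add: beta_tail_0_eq_Beta field_simps)
  qed
  define m where "m = (real s + 1) / (real (s + f) + 2)"
  define j where "j = real (s + f)"
  have j0: "0 \<le> j" by (simp add: j_def)
  have m: "0 \<le> m" "m \<le> 1" by (auto simp: m_def)
  have I: "((\<lambda>x. x ^ k * (1 - x) ^ f) has_integral beta_tail k f 0) {0<..<1}" for k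
    unfolding beta_tail_def has_integral_Icc_iff_Ioo[symmetric]
    by (rule integrable_integral) (rule beta_integrand_integrable)
  have "((\<lambda>x. (x - \<theta>)\<^sup>2 * (x ^ s * (1 - x) ^ f)) has_integral
      (beta_tail (s + 2) f 0 - 2 * \<theta> * beta_tail (s + 1) f 0 + \<theta>\<^sup>2 * beta_tail s f 0)) {0<..<1}"
  proof (rule has_integral_eq)
    show "((\<lambda>x. x ^ (s + 2) * (1 - x) ^ f - 2 * \<theta> * (x ^ (s + 1) * (1 - x) ^ f) + \<theta>\<^sup>2 * (x ^ s * (1 - x) ^ f)) has_integral
      (beta_tail (s + 2) f 0 - 2 * \<theta> * beta_tail (s + 1) f 0 + \<theta>\<^sup>2 * beta_tail s f 0)) {0<..<1}"
      by (intro has_integral_add has_integral_diff has_integral_mult_right I)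
  qed (simp add: power2_eq_square algebra_simps)
  then have "(\<integral>\<^sup>+x. ennreal ((x - \<theta>)\<^sup>2) \<partial>beta_distr (real s + 1) (real f + 1)) =
     ennreal ((beta_tail (s + 2) f 0 - 2 * \<theta> * beta_tail (s + 1) f 0 + \<theta>\<^sup>2 * beta_tail s f 0) / beta_tail s f 0)"
    by (intro nn_integral_beta_nat) auto
  also have "(beta_tail (s + 2) f 0 - 2 * \<theta> * beta_tail (s + 1) f 0 + \<theta>\<^sup>2 * beta_tail s f 0) / beta_tail s f 0 =
      m * (m * (j + 2) + 1) / (j + 3) - 2 * \<theta> * m + \<theta>\<^sup>2"
  proof -
    have 1: "beta_tail (s + 1) f 0 = beta_tail s f 0 * m"
      using step[of s] by (simp add: m_def)
    have ms: "m * (j + 2) + 1 = real s + 2"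
      using j0 by (simp add: m_def j_def)
    have 2: "beta_tail (s + 2) f 0 = beta_tail s f 0 * (m * (m * (j + 2) + 1) / (j + 3))"
      unfolding ms using step[of "Suc s"] 1 by (simp add: j_def algebra_simps)
    show ?thesis
      unfolding 1 2 using beta_tail_0_pos[of s f] by (simp add: add_divide_distrib diff_divide_distrib)
  qed
  also have "\<dots> = (m - \<theta>)\<^sup>2 + m * (1 - m) / (j + 3)"
    using j0 by (simp add: field_simps power2_eq_square)
  also have "\<dots> \<le> 2 * (real s - \<theta> * j)\<^sup>2 / (j + 1)\<^sup>2 + 2 / (j + 1)"
  proof -
    have eq: "m - \<theta> = ((real s - \<theta> * j) + (1 - 2 * \<theta>)) / (j + 2)"
      using j0 by (simp add: m_def j_def field_simps)
    have sq: "(1 - 2 * \<theta>)\<^sup>2 \<le> 1"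
      using assms by (simp add: power2_eq_square algebra_simps mult_left_le)
    have "((real s - \<theta> * j) + (1 - 2 * \<theta>))\<^sup>2 \<le> 2 * (real s - \<theta> * j)\<^sup>2 + 2 * (1 - 2 * \<theta>)\<^sup>2"
      by (rule power2_sum_le)
    also have "\<dots> \<le> 2 * (real s - \<theta> * j)\<^sup>2 + 2"
      using sq by linarith
    finally have "(m - \<theta>)\<^sup>2 \<le> (2 * (real s - \<theta> * j)\<^sup>2 + 2) / (j + 2)\<^sup>2"
      unfolding eq power_divide by (intro divide_right_mono) auto
    also have "\<dots> = 2 * (real s - \<theta> * j)\<^sup>2 / (j + 2)\<^sup>2 + 2 / (j + 2)\<^sup>2"
      by (rule add_divide_distrib)
    also have "\<dots> \<le> 2 * (real s - \<theta> * j)\<^sup>2 / (j + 1)\<^sup>2 + 1 / (j + 1)"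
    proof (intro add_mono divide_left_mono)
      have "2 * (j + 1) \<le> (j + 2)\<^sup>2"
        using j0 by (simp add: power2_eq_square algebra_simps)
      then have "2 * (j + 1) / ((j + 2)\<^sup>2 * (j + 1)) \<le> (j + 2)\<^sup>2 / ((j + 2)\<^sup>2 * (j + 1))"
        using j0 by (intro divide_right_mono) auto
      then show "2 / (j + 2)\<^sup>2 \<le> 1 / (j + 1)"
        using j0 by (simp only: mult_divide_mult_cancel_right) simp
    qed (use j0 in \<open>auto intro!: power_mono\<close>)
    finally have 1: "(m - \<theta>)\<^sup>2 \<le> 2 * (real s - \<theta> * j)\<^sup>2 / (j + 1)\<^sup>2 + 1 / (j + 1)" .
    have "m * (1 - m) \<le> 1"
      using m by (intro mult_le_one) auto
    then have "m * (1 - m) / (j + 3) \<le> 1 / (j + 1)"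
      using j0 m by (intro frac_le) auto
    with 1 show ?thesis by (simp add: field_simps)
  qed
  finally show ?thesis
    by (simp add: j_def ennreal_leI add_ac)
qed

section \<open>Thompson sampling probabilities\<close>

lemma arg_max_on_ge:
  fixes f :: "'a \<Rightarrow> 'b :: linorder"
  assumes "finite S" "k \<in> S"
  shows "f k \<le> f (arg_max_on f S)"
proof -
  have "Max (f ` S) \<in> f ` S"
    using assms by (intro Max_in) auto
  then obtain x where "x \<in> S" "f x = Max (f ` S)"
    by force
  then have "is_arg_max f (\<lambda>x. x \<in> S) x"
    using assms by (auto simp: is_arg_max_linorder)
  then have "is_arg_max f (\<lambda>x. x \<in> S) (arg_max_on f S)"
    unfolding arg_max_on_def arg_max_def by (rule someI)
  then show ?thesis
    using assms by (simp add: is_arg_max_linorder)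
qed

abbreviation beta_of :: "history \<Rightarrow> nat \<Rightarrow> real measure" where
  "beta_of hs i \<equiv> beta_distr (real (successes i hs) + 1) (real (failures i hs) + 1)"

definition arm_prob :: "nat \<Rightarrow> real \<Rightarrow> history \<Rightarrow> real" where
  "arm_prob i y hs = upper_prob (successes i hs) (failures i hs) y"

lemma arm_prob_nonneg: "0 \<le> arm_prob i y hs"
  by (simp add: arm_prob_def upper_prob_nonneg)

lemma arm_prob_le_1: "arm_prob i y hs \<le> 1"
  by (simp add: arm_prob_def upper_prob_le_1)

lemma space_beta_distr [simp]: "space (beta_distr a b) = UNIV"
  by (simp add: beta_distr_def)

lemma prob_space_beta_of: "prob_space (beta_of hs i)"
  by (rule prob_space_beta_nat)

lemma thompson_box:
  assumes "\<And>i. A i \<in> sets borel"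
  shows "measure (thompson_samples R hs) {l \<in> space (thompson_samples R hs). \<forall>i\<in>{1..R}. l i \<in> A i} =
    (\<Prod>i\<in>{1..R}. measure (beta_of hs i) (A i))"
proof -
  interpret product_prob_space "beta_of hs" "{1..R}"
    by (intro product_prob_spaceI prob_space_beta_of)
  have "{l \<in> space (thompson_samples R hs). \<forall>i\<in>{1..R}. l i \<in> A i} = (\<Pi>\<^sub>E i\<in>{1..R}. A i)"
    by (auto simp: thompson_samples_def space_PiM)
  moreover have "emeasure (Pi\<^sub>M {1..R} (beta_of hs)) (\<Pi>\<^sub>E i\<in>{1..R}. A i) = (\<Prod>i\<in>{1..R}. emeasure (beta_of hs i) (A i))"
    using assms by (intro emeasure_PiM) auto
  ultimately show ?thesis
    unfolding thompson_samples_def measure_def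
    by (simp add: M.emeasure_eq_measure prod_ennreal prod_nonneg)
qed

lemma thompson_marginal:
  assumes "k \<in> {1..R}" "A \<in> sets borel"
  shows "measure (thompson_samples R hs) {l \<in> space (thompson_samples R hs). l k \<in> A} = measure (beta_of hs k) A"
proof -
  have "measure (beta_of hs k) A = measure (distr (thompson_samples R hs) (beta_of hs k) (\<lambda>l. l k)) A"
    unfolding thompson_samples_def
    by (subst distr_PiM_component) (use assms prob_space_beta_of in auto)
  also have "\<dots> = measure (thompson_samples R hs) ((\<lambda>l. l k) -` A \<inter> space (thompson_samples R hs))"
    using assms unfolding thompson_samples_def by (intro measure_distr) auto
  also have "(\<lambda>l. l k) -` A \<inter> space (thompson_samples R hs) = {l \<in> space (thompson_samples R hs). l k \<in> A}"
    by auto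
  finally show ?thesis by simp
qed

lemma thompson_component_measurable [measurable]:
  "k \<in> {1..R} \<Longrightarrow> (\<lambda>l. l k) \<in> borel_measurable (thompson_samples R hs)"
  unfolding thompson_samples_def by (rule measurable_PiM_component_rev[where N = borel]) auto

locale thompson =
  fixes R :: nat and r :: "nat \<Rightarrow> real"
  assumes R: "1 \<le> R" and r_pos: "\<And>i. i \<in> {1..R} \<Longrightarrow> 0 < r i"
begin

definition win :: "history \<Rightarrow> nat \<Rightarrow> (nat \<Rightarrow> real) set" where
  "win hs k = {l \<in> space (thompson_samples R hs). arg_max_on (\<lambda>j. l j * r j) {1..R} = k}"

lemma win_sets [measurable]: "win hs k \<in> sets (thompson_samples R hs)"
  unfolding win_def by (rule thompson_event_measurable)

lemma pmf_thompson: "pmf (thompson_pmf R r hs) k = measure (thompson_samples R hs) (win hs k)"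
  unfolding win_def using R by (rule pmf_thompson_pmf)

lemma winD:
  assumes "l \<in> win hs k" "i \<in> {1..R}"
  shows "l i * r i \<le> l k * r k"
  using assms arg_max_on_ge[of "{1..R}" i "\<lambda>j. l j * r j"] by (auto simp: win_def)

lemma win_range: "l \<in> win hs k \<Longrightarrow> k \<in> {1..R}"
  using arg_max_on_in[of "{1..R}" "\<lambda>j. l j * r j"] R by (auto simp: win_def)

lemma set_thompson_pmf: "set_pmf (thompson_pmf R r hs) \<subseteq> {1..R}"
proof
  fix k assume "k \<in> set_pmf (thompson_pmf R r hs)"
  then have "win hs k \<noteq> {}"
    by (auto simp: set_pmf_iff pmf_thompson)
  then show "k \<in> {1..R}"
    using win_range by blast
qed

sublocale T: prob_space "thompson_samples R hs" for hs
  by (rule prob_space_thompson_samples)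

lemma prob_above:
  assumes "k \<in> {1..R}"
  shows "measure (thompson_samples R hs) {l \<in> space (thompson_samples R hs). v < l k * r k} = arm_prob k (v / r k) hs"
proof -
  have "{l \<in> space (thompson_samples R hs). v < l k * r k} = {l \<in> space (thompson_samples R hs). l k \<in> {v / r k<..}}"
    using r_pos[OF assms] by (auto simp: pos_divide_less_eq)
  then show ?thesis
    using thompson_marginal[OF assms, of "{v / r k<..}" hs] by (simp add: arm_prob_def upper_prob_def)
qed

lemma prob_below:
  assumes "k \<in> {1..R}"
  shows "measure (thompson_samples R hs) {l \<in> space (thompson_samples R hs). l k * r k \<le> v} = 1 - arm_prob k (v / r k) hs"
proof -
  have "{l \<in> space (thompson_samples R hs). l k * r k \<le> v} = {l \<in> space (thompson_samples R hs). l k \<in> {..v / r k}}"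
    using r_pos[OF assms] by (auto simp: pos_le_divide_eq)
  then show ?thesis
    using thompson_marginal[OF assms, of "{..v / r k}" hs] by (simp add: arm_prob_def lower_prob_eq)
qed

lemma above_sets [measurable]:
  "k \<in> {1..R} \<Longrightarrow> {l \<in> space (thompson_samples R hs). v < l k * r k} \<in> sets (thompson_samples R hs)"
  by measurable

lemma below_sets [measurable]:
  "k \<in> {1..R} \<Longrightarrow> {l \<in> space (thompson_samples R hs). l k * r k \<le> v} \<in> sets (thompson_samples R hs)"
  by measurable

text \<open>If arm k wins with a value of at most v, then no arm exceeds v, in particular not
  i.\<close>

lemma pmf_thompson_le_above_below:
  assumes "k \<in> {1..R}" "i \<in> {1..R}"
  shows "pmf (thompson_pmf R r hs) k \<le> arm_prob k (v / r k) hs + (1 - arm_prob i (v / r i) hs)"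
proof -
  let ?A = "{l \<in> space (thompson_samples R hs). v < l k * r k}"
  let ?B = "{l \<in> space (thompson_samples R hs). l i * r i \<le> v}"
  have "win hs k \<subseteq> ?A \<union> ?B"
    using winD[OF _ assms(2), of _ hs k] by (force simp: win_def)
  then have "measure (thompson_samples R hs) (win hs k) \<le> measure (thompson_samples R hs) (?A \<union> ?B)"
    using assms by (intro T.finite_measure_mono sets.Un above_sets below_sets)
  also have "\<dots> \<le> measure (thompson_samples R hs) ?A + measure (thompson_samples R hs) ?B"
    using assms by (intro measure_Un_le above_sets below_sets)
  finally show ?thesis
    by (simp only: pmf_thompson prob_above[OF assms(1)] prob_below[OF assms(2)])
qed

text \<open>
  If arm \<open>k\<close> wins with a sample below the level \<open>v\<close>, all samples are below \<open>v\<close>. Raising only the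
  sample of arm \<open>i\<close> above \<open>v\<close> would let \<open>i\<close> win, and that sample is independent of the others.
\<close>

lemma pmf_thompson_le_odds:
  assumes "k \<in> {1..R}" "i \<in> {1..R}" and q: "0 < arm_prob i (v / r i) hs"
  shows "pmf (thompson_pmf R r hs) k \<le> arm_prob k (v / r k) hs + pmf (thompson_pmf R r hs) i / arm_prob i (v / r i) hs"
proof -
  let ?M = "thompson_samples R hs" and ?q = "arm_prob i (v / r i) hs"
  let ?A = "{l \<in> space ?M. v < l k * r k}"
  let ?B = "{l \<in> space ?M. \<forall>j\<in>{1..R}. l j \<in> {..v / r j}}"
  let ?C = "{l \<in> space ?M. \<forall>j\<in>{1..R}. l j \<in> (if j = i then {v / r j<..} else {..v / r j})}"
  define c where "c = (\<Prod>j\<in>{1..R} - {i}. measure (beta_of hs j) {..v / r j})"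
  have c0: "0 \<le> c" unfolding c_def by (intro prod_nonneg) auto
  have le: "x \<le> v / r j \<longleftrightarrow> x * r j \<le> v" if "j \<in> {1..R}" for x j
    using r_pos[OF that] by (simp add: pos_le_divide_eq)
  have less: "v / r j < x \<longleftrightarrow> v < x * r j" if "j \<in> {1..R}" for x j
    using r_pos[OF that] by (simp add: pos_divide_less_eq)
  have B: "measure ?M ?B = measure (beta_of hs i) {..v / r i} * c"
    using assms by (subst thompson_box, simp, unfold c_def, intro prod.remove) auto
  have "measure ?M ?C = measure (beta_of hs i) {v / r i<..} * c"
  proof -
    have "measure ?M ?C = (\<Prod>j\<in>{1..R}. measure (beta_of hs j) (if j = i then {v / r j<..} else {..v / r j}))"
      by (rule thompson_box) auto
    also have "\<dots> = measure (beta_of hs i) {v / r i<..} * (\<Prod>j\<in>{1..R} - {i}. measure (beta_of hs j) (if j = i then {v / r j<..} else {..v / r j}))"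
      using assms by (subst prod.remove[of _ i]) auto
    also have "(\<Prod>j\<in>{1..R} - {i}. measure (beta_of hs j) (if j = i then {v / r j<..} else {..v / r j})) = c"
      unfolding c_def by (intro prod.cong) auto
    finally show ?thesis .
  qed
  then have C: "measure ?M ?C = ?q * c"
    by (simp add: arm_prob_def upper_prob_def)
  have "?C \<subseteq> win hs i"
  proof
    fix l assume l: "l \<in> ?C"
    let ?a = "arg_max_on (\<lambda>j. l j * r j) {1..R}"
    have a: "?a \<in> {1..R}" using R by (intro arg_max_on_in) auto
    have lj: "l j \<in> (if j = i then {v / r j<..} else {..v / r j})" if "j \<in> {1..R}" for j
      using l that by blast
    have "l i * r i \<le> l ?a * r ?a"
      using arg_max_on_ge[of "{1..R}" i "\<lambda>j. l j * r j"] assms by auto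
    moreover have "v < l i * r i"
      using lj[OF assms(2)] less[OF assms(2), of "l i"] by simp
    moreover have "l ?a * r ?a \<le> v" if "?a \<noteq> i"
      using lj[OF a] that le[OF a, of "l ?a"] by simp
    ultimately have "?a = i" by fastforce
    then show "l \<in> win hs i" using l by (simp add: win_def)
  qed
  then have "?q * c \<le> pmf (thompson_pmf R r hs) i"
    unfolding pmf_thompson C[symmetric] by (intro T.finite_measure_mono) auto
  then have c: "c \<le> pmf (thompson_pmf R r hs) i / ?q"
    using q by (simp add: pos_le_divide_eq mult.commute)
  have "?B \<in> sets ?M"
    by measurable
  moreover have "win hs k \<subseteq> ?A \<union> ?B"
  proof
    fix l assume l: "l \<in> win hs k"
    show "l \<in> ?A \<union> ?B"
    proof (cases "v < l k * r k")
      case False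
      have "l j \<le> v / r j" if "j \<in> {1..R}" for j
        using winD[OF l that] False le[OF that, of "l j"] by linarith
      then show ?thesis using l by (auto simp: win_def)
    qed (use l in \<open>auto simp: win_def\<close>)
  qed
  ultimately have "measure ?M (win hs k) \<le> measure ?M (?A \<union> ?B)"
    using assms by (intro T.finite_measure_mono sets.Un above_sets)
  also have "\<dots> \<le> measure ?M ?A + measure ?M ?B"
    using assms \<open>?B \<in> sets ?M\<close> by (intro measure_Un_le above_sets)
  also have "measure ?M ?B \<le> c"
    unfolding B using c0 by (intro mult_left_le_one_le) (auto intro: prob_space.prob_le_1[OF prob_space_beta_of])
  finally show ?thesis
    using c by (simp add: pmf_thompson prob_above[OF assms(1)])
qed

text \<open>When the value of k exceeds v, so does that of the winner, which is either in A or an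
  arm outside A with a high sample. With A the rarely used arms, this forces one of them to be
  tried.\<close>

lemma arm_prob_le_progress:
  assumes "A \<subseteq> {1..R}" "k \<in> A"
  shows "arm_prob k (v / r k) hs \<le>
    (\<Sum>l\<in>A. pmf (thompson_pmf R r hs) l) + (\<Sum>l\<in>{1..R} - A. arm_prob l (v / r l) hs)"
proof -
  let ?M = "thompson_samples R hs"
  let ?U = "\<lambda>j. {l \<in> space ?M. v < l j * r j}"
  have fA: "finite A" using assms finite_subset by blast
  have k: "k \<in> {1..R}" using assms by auto
  have "?U k \<subseteq> (\<Union>j\<in>A. win hs j) \<union> (\<Union>j\<in>{1..R} - A. ?U j)"
  proof
    fix l assume l: "l \<in> ?U k"
    let ?a = "arg_max_on (\<lambda>j. l j * r j) {1..R}"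
    have a: "?a \<in> {1..R}" using R by (intro arg_max_on_in) auto
    have w: "l \<in> win hs ?a" using l by (simp add: win_def)
    show "l \<in> (\<Union>j\<in>A. win hs j) \<union> (\<Union>j\<in>{1..R} - A. ?U j)"
    proof (cases "?a \<in> A")
      case True then show ?thesis using w by blast
    next
      case False
      have "v < l ?a * r ?a" using winD[OF w k] l by auto
      then show ?thesis using False a l by blast
    qed
  qed
  then have "measure ?M (?U k) \<le> measure ?M ((\<Union>j\<in>A. win hs j) \<union> (\<Union>j\<in>{1..R} - A. ?U j))"
    using fA by (intro T.finite_measure_mono sets.Un sets.finite_UN above_sets win_sets) auto
  also have "\<dots> \<le> measure ?M (\<Union>j\<in>A. win hs j) + measure ?M (\<Union>j\<in>{1..R} - A. ?U j)"
    using fA by (intro measure_Un_le sets.finite_UN above_sets win_sets) auto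
  also have "\<dots> \<le> (\<Sum>j\<in>A. measure ?M (win hs j)) + (\<Sum>j\<in>{1..R} - A. measure ?M (?U j))"
    using fA by (intro add_mono measure_UNION_le) (auto simp del: atLeastAtMost_iff intro!: above_sets win_sets)
  also have "\<dots> = (\<Sum>l\<in>A. pmf (thompson_pmf R r hs) l) + (\<Sum>l\<in>{1..R} - A. arm_prob l (v / r l) hs)"
    by (intro arg_cong2[where f = "(+)"] sum.cong) (auto simp: pmf_thompson prob_above)
  finally show ?thesis
    by (simp add: prob_above[OF k])
qed

text \<open>Fubini for the samples of i and k: given the sample x of i, arm k can win only from x *
  r i / r k on. Unlike a fixed level this keeps track of the posterior spread of i.\<close>

lemma pmf_thompson_le_pair:
  assumes "k \<in> {1..R}" "i \<in> {1..R}" "k \<noteq> i"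
    and H [measurable]: "H \<in> borel_measurable borel"
    and le: "\<And>x. emeasure (beta_of hs k) {x * r i / r k..} \<le> H x"
  shows "ennreal (pmf (thompson_pmf R r hs) k) \<le> (\<integral>\<^sup>+x. H x \<partial>beta_of hs i)"
proof -
  let ?M = "thompson_samples R hs"
  interpret product_prob_space "beta_of hs" "{1..R}"
    by (intro product_prob_spaceI prob_space_beta_of)
  let ?f = "\<lambda>x y. indicator {(x, y). x * r i \<le> y * r k} (x, y) :: ennreal"
  have m: "{(x, y). x * r i \<le> y * r k} \<in> sets (borel :: (real \<times> real) measure)"
  proof -
    have "closed {z :: real \<times> real. fst z * r i \<le> snd z * r k}"
      by (intro closed_Collect_le continuous_intros)
    then show ?thesis
      by (simp add: split_beta' borel_closed)
  qed
  have ms: "sets (beta_of hs i \<Otimes>\<^sub>M beta_of hs k) = sets (borel :: (real \<times> real) measure)"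
    unfolding borel_prod[symmetric] by (intro sets_pair_measure_cong) auto
  have fm [measurable]: "case_prod ?f \<in> borel_measurable (beta_of hs i \<Otimes>\<^sub>M beta_of hs k)"
    using m ms by (auto simp: measurable_cong_sets[OF ms refl] split_beta')
  have "ennreal (pmf (thompson_pmf R r hs) k) = emeasure ?M (win hs k)"
    by (simp add: pmf_thompson T.emeasure_eq_measure)
  also have "\<dots> \<le> (\<integral>\<^sup>+l. ?f (l i) (l k) \<partial>?M)"
  proof -
    have "emeasure ?M (win hs k) = (\<integral>\<^sup>+l. indicator (win hs k) l \<partial>?M)" by simp
    also have "\<dots> \<le> (\<integral>\<^sup>+l. ?f (l i) (l k) \<partial>?M)"
      using winD[OF _ assms(2)] by (intro nn_integral_mono) (auto split: split_indicator)
    finally show ?thesis .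
  qed
  also have "\<dots> = (\<integral>\<^sup>+l. ?f (l i) (l k) \<partial>distr ?M (Pi\<^sub>M {i, k} (beta_of hs)) (\<lambda>l. restrict l {i, k}))"
    using assms unfolding thompson_samples_def
    by (subst nn_integral_distr) (auto intro!: measurable_restrict_subset nn_integral_cong
      measurable_compose[OF _ fm[unfolded split_beta'], of "\<lambda>l. (l i, l k)", simplified])
  also have "\<dots> = (\<integral>\<^sup>+l. ?f (l i) (l k) \<partial>Pi\<^sub>M {i, k} (beta_of hs))"
    unfolding thompson_samples_def using assms by (subst distr_restrict[symmetric]) auto
  also have "\<dots> = (\<integral>\<^sup>+z. ?f (fst z) (snd z) \<partial>(beta_of hs i \<Otimes>\<^sub>M beta_of hs k))"
    using assms by (intro product_nn_integral_pair[OF fm]) auto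
  also have "\<dots> = (\<integral>\<^sup>+x. \<integral>\<^sup>+y. ?f x y \<partial>beta_of hs k \<partial>beta_of hs i)"
    using fm M.nn_integral_fst[of "case_prod ?f" "beta_of hs i" k] by (simp add: split_beta')
  also have "\<dots> = (\<integral>\<^sup>+x. emeasure (beta_of hs k) {x * r i / r k..} \<partial>beta_of hs i)"
  proof (rule nn_integral_cong)
    fix x
    have "(\<integral>\<^sup>+y. ?f x y \<partial>beta_of hs k) = (\<integral>\<^sup>+y. indicator {x * r i / r k..} y \<partial>beta_of hs k)"
      using r_pos[OF assms(1)] by (intro nn_integral_cong) (auto split: split_indicator simp: pos_divide_le_eq)
    then show "(\<integral>\<^sup>+y. ?f x y \<partial>beta_of hs k) = emeasure (beta_of hs k) {x * r i / r k..}"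
      by simp
  qed
  also have "\<dots> \<le> (\<integral>\<^sup>+x. H x \<partial>beta_of hs i)"
    by (intro nn_integral_mono le)
  finally show ?thesis .
qed

end

lemma emeasure_beta_atLeast:
  "emeasure (beta_distr (real s + 1) (real f + 1)) {y..} = ennreal (upper_prob s f y)"
proof -
  let ?B = "beta_distr (real s + 1) (real f + 1)"
  interpret prob_space ?B by (rule prob_space_beta_nat)
  have "emeasure ?B {y} = 0"
    unfolding beta_distr_def by (subst emeasure_density) (auto simp: nn_integral_indicator_singleton)
  moreover have "{y..} = {y} \<union> {y<..}" by auto
  ultimately have "emeasure ?B {y..} = emeasure ?B {y<..}"
    by (simp only: Un_commute) (intro emeasure_Un_null_set, auto intro!: null_setsI)
  then show ?thesis
    by (simp add: upper_prob_def emeasure_eq_measure)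
qed

section \<open>The run of the algorithm\<close>

lemma slots_0 [simp]: "slots 0 (length hs) hs = hs"
  by (simp add: slots_def)

text \<open>Histories have the latest slot first, so in \<open>e @ g\<close> the slots of g come
  before those of e in time.\<close>

lemma slots_append:
  assumes "m \<le> length e"
  shows "slots (length g + a) (length g + m) (e @ g) = slots a m e"
  using assms by (simp add: slots_def)

lemma last_change_append:
  assumes "last_change w b g = length g"
  shows "last_change w b (e @ g) = length g + last_change w b e"
proof (induction e)
  case (Cons p e)
  have "slots (length g + last_change w b e) (length g + length (p # e)) ((p # e) @ g) =
      slots (last_change w b e) (length (p # e)) (p # e)"
    by (rule slots_append) simp
  then show ?case
    using Cons by (simp add: add.commute)
qed (use assms in simp)

definition best_gap :: "nat \<Rightarrow> (nat \<Rightarrow> real) \<Rightarrow> (nat \<Rightarrow> nat \<Rightarrow> real) \<Rightarrow> nat \<Rightarrow> nat \<Rightarrow> real" where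
  "best_gap R r \<theta> q i = r (best_rate R r \<theta> q) * \<theta> q (best_rate R r \<theta> q) - r i * \<theta> q i"

locale cdts_run = thompson R r for R :: nat and r :: "nat \<Rightarrow> real" +
  fixes \<theta> :: "nat \<Rightarrow> nat \<Rightarrow> real" and Q w F :: nat and b :: real
  assumes r_le: "\<And>i. i \<in> {1..R} \<Longrightarrow> r i \<le> r R"
    and \<theta>_bounds: "\<And>q i. q \<in> {1..Q} \<Longrightarrow> i \<in> {1..R} \<Longrightarrow> 0 < \<theta> q i \<and> \<theta> q i < 1"
    and w_pos: "1 \<le> w" and F_ge: "2 \<le> F"
begin

abbreviation pol :: policy where "pol \<equiv> cdts R r w b F"

text \<open>Valid states at every index, also outside the horizon, so that a shifted channel
  satisfies the same condition.\<close>

definition chan :: "(nat \<Rightarrow> nat) \<Rightarrow> bool" where "chan h \<longleftrightarrow> (\<forall>t. h t \<in> {1..Q})"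

definition EE :: "(nat \<Rightarrow> nat) \<Rightarrow> nat \<Rightarrow> (history \<Rightarrow> real) \<Rightarrow> real" where
  "EE h t f = measure_pmf.expectation (history_pmf \<theta> h pol t) f"

text \<open>The conditional expectation of f one slot later, as a finite sum. Martingale arguments
  become inequalities between \<open>step q hs f\<close> and \<open>f hs\<close>.\<close>

definition step :: "nat \<Rightarrow> history \<Rightarrow> (history \<Rightarrow> real) \<Rightarrow> real" where
  "step q hs f = (\<Sum>i\<in>{1..R}. pmf (pol hs) i *
     (\<theta> q i * f ((i, True) # hs) + (1 - \<theta> q i) * f ((i, False) # hs)))"

definition hists :: "nat \<Rightarrow> history set" where
  "hists t = {hs. length hs = t \<and> fst ` set hs \<subseteq> {1..R}}"

lemma chanD: "chan h \<Longrightarrow> h t \<in> {1..Q}"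
  unfolding chan_def by blast

lemma \<theta>_pos: "q \<in> {1..Q} \<Longrightarrow> i \<in> {1..R} \<Longrightarrow> 0 < \<theta> q i"
  and \<theta>_less: "q \<in> {1..Q} \<Longrightarrow> i \<in> {1..R} \<Longrightarrow> \<theta> q i < 1"
  using \<theta>_bounds by blast+

lemma \<theta>_nonneg: "q \<in> {1..Q} \<Longrightarrow> i \<in> {1..R} \<Longrightarrow> 0 \<le> \<theta> q i"
  and \<theta>_le: "q \<in> {1..Q} \<Longrightarrow> i \<in> {1..R} \<Longrightarrow> \<theta> q i \<le> 1"
  using \<theta>_bounds[of q i] by auto

lemma empirical_best_range: "empirical_best R r hs \<in> {1..R}"
  unfolding empirical_best_def using R by (intro arg_max_on_in) auto

lemma set_pol: "set_pmf (pol hs) \<subseteq> {1..R}"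
  using empirical_best_range set_thompson_pmf by (auto simp: cdts_def Let_def)

lemma sum_pol: "(\<Sum>i\<in>{1..R}. pmf (pol hs) i) = 1"
  by (rule sum_pmf_eq_1) (use set_pol in auto)

lemma finite_pol: "finite (set_pmf (pol hs))"
  using set_pol finite_subset by blast

lemma finite_history: "finite (set_pmf (history_pmf \<theta> h pol t))"
  by (induction t) (auto simp: finite_pol)

lemma set_history: "set_pmf (history_pmf \<theta> h pol t) \<subseteq> hists t"
proof (induction t)
  case (Suc t)
  show ?case
  proof
    fix hs' assume "hs' \<in> set_pmf (history_pmf \<theta> h pol (Suc t))"
    then obtain hs i x where "hs \<in> set_pmf (history_pmf \<theta> h pol t)" "i \<in> set_pmf (pol hs)" "hs' = (i, x) # hs"
      by auto
    then show "hs' \<in> hists (Suc t)"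
      using Suc subsetD[OF set_pol, of i hs] by (auto simp: hists_def)
  qed
qed (simp add: hists_def)

lemma hists_drop: "hs \<in> hists (t + m) \<Longrightarrow> drop m hs \<in> hists t"
  using set_drop_subset[of m hs] by (auto simp: hists_def)

lemma hists_length: "hs \<in> hists t \<Longrightarrow> length hs = t"
  by (simp add: hists_def)

lemma EE_0 [simp]: "EE h 0 f = f []"
  by (simp add: EE_def)

lemma EE_Suc:
  assumes "chan h"
  shows "EE h (Suc t) f = EE h t (\<lambda>hs. step (h (Suc t)) hs f)"
proof -
  let ?q = "h (Suc t)"
  have inner: "measure_pmf.expectation (pol hs \<bind> (\<lambda>i. map_pmf (\<lambda>x. (i, x) # hs) (bernoulli_pmf (\<theta> ?q i)))) f = step ?q hs f" for hs
  proof -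
    have "measure_pmf.expectation (pol hs \<bind> (\<lambda>i. map_pmf (\<lambda>x. (i, x) # hs) (bernoulli_pmf (\<theta> ?q i)))) f
       = (\<Sum>i\<in>{1..R}. pmf (pol hs) i *\<^sub>R measure_pmf.expectation (map_pmf (\<lambda>x. (i, x) # hs) (bernoulli_pmf (\<theta> ?q i))) f)"
      using set_pol by (intro pmf_expectation_bind) auto
    also have "\<dots> = step ?q hs f"
      unfolding step_def
    proof (intro sum.cong refl)
      fix i assume "i \<in> {1..R}"
      then have "0 \<le> \<theta> ?q i" "\<theta> ?q i \<le> 1"
        by (intro \<theta>_nonneg \<theta>_le chanD[OF assms]; assumption)+
      then show "pmf (pol hs) i *\<^sub>R measure_pmf.expectation (map_pmf (\<lambda>x. (i, x) # hs) (bernoulli_pmf (\<theta> ?q i))) f =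
         pmf (pol hs) i * (\<theta> ?q i * f ((i, True) # hs) + (1 - \<theta> ?q i) * f ((i, False) # hs))"
        by (simp add: integral_bernoulli_pmf mult_ac)
    qed
    finally show ?thesis .
  qed
  have "EE h (Suc t) f = (\<Sum>hs\<in>set_pmf (history_pmf \<theta> h pol t). pmf (history_pmf \<theta> h pol t) hs *\<^sub>R
      measure_pmf.expectation (pol hs \<bind> (\<lambda>i. map_pmf (\<lambda>x. (i, x) # hs) (bernoulli_pmf (\<theta> ?q i)))) f)"
    unfolding EE_def history_pmf.simps
    by (rule pmf_expectation_bind) (auto simp: finite_history finite_pol)
  also have "\<dots> = EE h t (\<lambda>hs. step ?q hs f)"
    unfolding EE_def inner by (rule integral_measure_pmf[symmetric]) (auto simp: finite_history)
  finally show ?thesis .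
qed

lemma EE_integrable: "integrable (measure_pmf (history_pmf \<theta> h pol t)) f"
  for f :: "history \<Rightarrow> real"
  by (rule integrable_measure_pmf_finite) (rule finite_history)

lemma EE_add: "EE h t (\<lambda>hs. f hs + g hs) = EE h t f + EE h t g"
  unfolding EE_def by (intro Bochner_Integration.integral_add EE_integrable)

lemma EE_diff: "EE h t (\<lambda>hs. f hs - g hs) = EE h t f - EE h t g"
  unfolding EE_def by (intro Bochner_Integration.integral_diff EE_integrable)

lemma EE_cmult: "EE h t (\<lambda>hs. c * f hs) = c * EE h t f"
  unfolding EE_def by (rule integral_mult_right_zero)

lemma EE_sum: "EE h t (\<lambda>hs. \<Sum>x\<in>A. f x hs) = (\<Sum>x\<in>A. EE h t (f x))"
  unfolding EE_def by (intro Bochner_Integration.integral_sum EE_integrable)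

lemma EE_const [simp]: "EE h t (\<lambda>hs. c) = c"
  unfolding EE_def by simp

lemma EE_mono: "(\<And>hs. hs \<in> hists t \<Longrightarrow> f hs \<le> g hs) \<Longrightarrow> EE h t f \<le> EE h t g"
  unfolding EE_def using set_history
  by (intro integral_mono_AE EE_integrable) (auto simp: AE_measure_pmf_iff)

lemma EE_mono_support:
  "(\<And>hs. hs \<in> set_pmf (history_pmf \<theta> h pol t) \<Longrightarrow> f hs \<le> g hs) \<Longrightarrow> EE h t f \<le> EE h t g"
  unfolding EE_def
  by (intro integral_mono_AE EE_integrable) (auto simp: AE_measure_pmf_iff)

lemma EE_cong: "(\<And>hs. hs \<in> hists t \<Longrightarrow> f hs = g hs) \<Longrightarrow> EE h t f = EE h t g"
  by (intro antisym EE_mono) auto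

lemma EE_nonneg: "(\<And>hs. hs \<in> hists t \<Longrightarrow> 0 \<le> f hs) \<Longrightarrow> 0 \<le> EE h t f"
  using EE_mono[of t "\<lambda>_. 0" f h] by simp

lemma EE_le_const: "(\<And>hs. hs \<in> hists t \<Longrightarrow> f hs \<le> c) \<Longrightarrow> EE h t f \<le> c"
  using EE_mono[of t f "\<lambda>_. c" h] by simp

lemma EE_channel_cong:
  assumes "\<And>s. 1 \<le> s \<Longrightarrow> s \<le> t \<Longrightarrow> h s = h' s"
  shows "EE h t f = EE h' t f"
proof -
  have "history_pmf \<theta> h pol t = history_pmf \<theta> h' pol t"
    using assms by (induction t) auto
  then show ?thesis by (simp add: EE_def)
qed

lemma step_mono:
  assumes "q \<in> {1..Q}" "\<And>i x. i \<in> {1..R} \<Longrightarrow> f ((i, x) # hs) \<le> g ((i, x) # hs)"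
  shows "step q hs f \<le> step q hs g"
  unfolding step_def using assms \<theta>_nonneg[OF assms(1)] \<theta>_le[OF assms(1)]
  by (intro sum_mono mult_left_mono add_mono) auto

lemma step_arm_eq:
  assumes "\<And>i x. i \<in> {1..R} \<Longrightarrow> f ((i, x) # hs) = g i"
  shows "step q hs f = (\<Sum>i\<in>{1..R}. pmf (pol hs) i * g i)"
  unfolding step_def using assms by (intro sum.cong) (auto simp: algebra_simps)

lemma EE_prefix:
  assumes "chan h"
  shows "EE h (t + m) (\<lambda>hs. f (drop m hs)) = EE h t f"
proof (induction m)
  case (Suc m)
  have "EE h (t + Suc m) (\<lambda>hs. f (drop (Suc m) hs)) = EE h (t + m) (\<lambda>hs. step (h (Suc (t + m))) hs (\<lambda>hs. f (drop (Suc m) hs)))"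
    using EE_Suc[OF assms, of "t + m"] by simp
  also have "\<dots> = EE h (t + m) (\<lambda>hs. f (drop m hs))"
    by (intro EE_cong) (subst step_arm_eq, auto simp: sum_distrib_right[symmetric] sum_pol[simplified])
  finally show ?case using Suc by simp
qed simp

subsection \<open>Renewal at declared changes\<close>

definition alive :: "history \<Rightarrow> bool" where "alive hs \<longleftrightarrow> last_change w b hs = 0"

lemma alive_Nil [simp]: "alive []"
  by (simp add: alive_def)

lemma alive_Cons: "alive (p # hs) \<longleftrightarrow> alive hs \<and> \<not> change_detected w b (fst p) (p # hs)"
  using slots_0[of "p # hs"] by (cases "last_change w b hs = 0") (simp_all add: alive_def)

lemma alive_drop: "alive hs \<Longrightarrow> alive (drop m hs)"
proof (induction m arbitrary: hs)
  case (Suc m)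
  then show ?case by (cases hs) (auto simp: alive_Cons)
qed simp

lemma pol_alive:
  assumes "alive hs"
  shows "pol hs = (if F dvd Suc (length hs) then return_pmf (empirical_best R r (slots 0 (F - 1) hs))
    else thompson_pmf R r hs)"
proof -
  have "(\<exists>k\<ge>1. Suc (length hs) = k * F) \<longleftrightarrow> F dvd Suc (length hs)"
  proof
    assume "F dvd Suc (length hs)"
    then obtain k where k: "Suc (length hs) = k * F"
      by (metis dvd_def mult.commute)
    then have "1 \<le> k" by (cases k) auto
    with k show "\<exists>k\<ge>1. Suc (length hs) = k * F" by blast
  qed auto
  then show ?thesis
    using assms by (simp add: cdts_def alive_def Let_def)
qed

text \<open>The policy reads only the slots since the last declared change, so it forgets g when a
  change is declared at the end of g.\<close>

lemma pol_append:
  assumes "last_change w b g = length g"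
  shows "pol (e @ g) = pol e"
proof -
  let ?c = "last_change w b e"
  have ex: "(\<exists>k\<ge>1. length (e @ g) + 1 = last_change w b (e @ g) + k * F) \<longleftrightarrow> (\<exists>k\<ge>1. length e + 1 = ?c + k * F)"
    using last_change_append[OF assms, of e] by simp
  have thompson: "slots (last_change w b (e @ g)) (length (e @ g) + 1 - 1) (e @ g) = slots ?c (length e + 1 - 1) e"
    using slots_append[of "length e" e g ?c] last_change_append[OF assms, of e] by (simp add: add.commute)
  \<comment> \<open>The F - 1 slots that determine the forced rate must lie inside e; this uses k
    \<ge> 1.\<close>
  have forced: "slots (last_change w b (e @ g)) (last_change w b (e @ g) + F - 1) (e @ g) = slots ?c (?c + F - 1) e"
    if "k \<ge> 1" "length e + 1 = ?c + k * F" for k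
  proof -
    have "1 * F \<le> k * F" using that by (intro mult_right_mono) auto
    then have "?c + F - 1 \<le> length e" using that by linarith
    moreover have "last_change w b (e @ g) + F - 1 = length g + (?c + F - 1)"
      using last_change_append[OF assms, of e] F_ge by simp
    ultimately show ?thesis
      using slots_append[of "?c + F - 1" e g ?c] last_change_append[OF assms, of e] by simp
  qed
  show ?thesis
  proof (cases "\<exists>k\<ge>1. length e + 1 = ?c + k * F")
    case True
    then have "slots (last_change w b (e @ g)) (last_change w b (e @ g) + F - 1) (e @ g) = slots ?c (?c + F - 1) e"
      using forced by blast
    then show ?thesis
      unfolding cdts_def Let_def using True ex by (simp only: if_True)
  next
    case False
    then show ?thesis
      unfolding cdts_def Let_def using ex thompson by (simp only: if_False)
  qed
qed

definition first_change :: "history \<Rightarrow> bool" where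
  "first_change g \<longleftrightarrow> g \<noteq> [] \<and> alive (tl g) \<and> \<not> alive g"

lemma first_change_length: "first_change g \<Longrightarrow> last_change w b g = length g"
  by (cases g) (auto simp: first_change_def alive_def split: if_splits)

text \<open>A case split over the end of the first cycle: dropping \<open>length hs - s\<close>
  entries leaves the history of the first s slots.\<close>

lemma alive_or_first_change:
  "of_bool (alive hs) + (\<Sum>s\<in>{1..length hs}. of_bool (first_change (drop (length hs - s) hs))) = (1::real)"
proof (induction hs)
  case (Cons p hs)
  have "(\<Sum>s\<in>{1..length (p # hs)}. of_bool (first_change (drop (length (p # hs) - s) (p # hs)))) =
     (\<Sum>s\<in>{1..length hs}. of_bool (first_change (drop (length (p # hs) - s) (p # hs)))) + (of_bool (first_change (p # hs)) :: real)"
    by simp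
  also have "(\<Sum>s\<in>{1..length hs}. of_bool (first_change (drop (length (p # hs) - s) (p # hs)))) =
     (\<Sum>s\<in>{1..length hs}. of_bool (first_change (drop (length hs - s) hs)) :: real)"
    by (intro sum.cong refl) (auto simp: Suc_diff_le)
  finally have *: "(\<Sum>s\<in>{1..length (p # hs)}. of_bool (first_change (drop (length (p # hs) - s) (p # hs)))) =
     (\<Sum>s\<in>{1..length hs}. of_bool (first_change (drop (length hs - s) hs))) + (of_bool (first_change (p # hs)) :: real)" .
  have "of_bool (alive (p # hs)) + of_bool (first_change (p # hs)) = (of_bool (alive hs) :: real)"
    by (auto simp: first_change_def alive_Cons)
  then show ?case
    unfolding * using Cons by linarith
qed simp

text \<open>Strong Markov property at the first declared change: by \<open>pol_append\<close>, what
  follows slot s is a fresh run on the channel shifted by s.\<close>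

lemma EE_restart:
  assumes h: "chan h"
  shows "EE h (s + m) (\<lambda>hs. of_bool (first_change (drop m hs)) * f hs) =
    EE h s (\<lambda>g. of_bool (first_change g) * EE (\<lambda>t. h (s + t)) m (\<lambda>e. f (e @ g)))"
proof (induction m arbitrary: f)
  case (Suc m)
  have h': "chan (\<lambda>t. h (s + t))" using h by (simp add: chan_def)
  have "EE h (s + Suc m) (\<lambda>hs. of_bool (first_change (drop (Suc m) hs)) * f hs) =
     EE h (s + m) (\<lambda>hs. of_bool (first_change (drop m hs)) * step (h (Suc (s + m))) hs f)"
    using EE_Suc[OF h, of "s + m"]
    by (simp add: step_def sum_distrib_left algebra_simps)
  also have "\<dots> = EE h s (\<lambda>g. of_bool (first_change g) * EE (\<lambda>t. h (s + t)) m (\<lambda>e. step (h (Suc (s + m))) (e @ g) f))"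
    by (rule Suc)
  also have "\<dots> = EE h s (\<lambda>g. of_bool (first_change g) * EE (\<lambda>t. h (s + t)) (Suc m) (\<lambda>e. f (e @ g)))"
  proof (intro EE_cong)
    fix g
    show "of_bool (first_change g) * EE (\<lambda>t. h (s + t)) m (\<lambda>e. step (h (Suc (s + m))) (e @ g) f) =
      of_bool (first_change g) * EE (\<lambda>t. h (s + t)) (Suc m) (\<lambda>e. f (e @ g))"
      using EE_Suc[OF h', of m "\<lambda>e. f (e @ g)"] pol_append[OF first_change_length, of g]
      by (cases "first_change g") (simp_all add: step_def)
  qed
  finally show ?case .
qed simp

definition gap_rate :: "nat \<Rightarrow> history \<Rightarrow> real" where
  "gap_rate q hs = (\<Sum>i\<in>{1..R}. pmf (pol hs) i * best_gap R r \<theta> q i)"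

lemma rate_at_Cons: "1 \<le> t \<Longrightarrow> t \<le> length hs \<Longrightarrow> rate_at (p # hs) t = rate_at hs t"
  by (simp add: rate_at_def nth_Cons' Suc_diff_le)

lemma regret_eq_sum:
  assumes h: "chan h"
  shows "regret R r \<theta> h pol m = (\<Sum>t<m. EE h t (gap_rate (h (Suc t))))"
proof -
  have reg: "regret R r \<theta> h pol m = EE h m (\<lambda>hs. \<Sum>t = 1..m. best_gap R r \<theta> (h t) (rate_at hs t))" for m
    by (simp add: regret_def EE_def best_gap_def)
  show ?thesis
  proof (induction m)
    case (Suc m)
    let ?S = "\<lambda>m hs. \<Sum>t = 1..m. best_gap R r \<theta> (h t) (rate_at hs t)"
    have "regret R r \<theta> h pol (Suc m) = EE h m (\<lambda>hs. step (h (Suc m)) hs (?S (Suc m)))"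
      unfolding reg by (rule EE_Suc[OF h])
    also have "\<dots> = EE h m (\<lambda>hs. ?S m hs + gap_rate (h (Suc m)) hs)"
    proof (intro EE_cong)
      fix hs assume hs: "hs \<in> hists m"
      have "?S (Suc m) ((i, x) # hs) = ?S m hs + best_gap R r \<theta> (h (Suc m)) i" for i x
        using hists_length[OF hs] by (simp add: rate_at_Cons) (simp add: rate_at_def)
      then have "step (h (Suc m)) hs (?S (Suc m)) = (\<Sum>i\<in>{1..R}. pmf (pol hs) i * (?S m hs + best_gap R r \<theta> (h (Suc m)) i))"
        by (intro step_arm_eq)
      also have "\<dots> = ?S m hs + gap_rate (h (Suc m)) hs"
        using sum_pol[of hs] by (simp add: gap_rate_def distrib_left sum.distrib flip: sum_distrib_right)
      finally show "step (h (Suc m)) hs (?S (Suc m)) = ?S m hs + gap_rate (h (Suc m)) hs" .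
    qed
    finally show ?case
      using Suc by (simp add: EE_add reg)
  qed (simp add: reg)
qed

definition change_prob :: "(nat \<Rightarrow> nat) \<Rightarrow> nat \<Rightarrow> real" where
  "change_prob h s = EE h s (\<lambda>g. of_bool (first_change g))"

definition alive_prob :: "(nat \<Rightarrow> nat) \<Rightarrow> nat \<Rightarrow> real" where
  "alive_prob h t = EE h t (\<lambda>hs. of_bool (alive hs))"

text \<open>Each slot is charged to the first cycle while that lasts, and otherwise to the run
  restarted at its end. Exchanging the sums over slots and restart times collects the regrets of the
  restarted runs.\<close>

lemma regret_renewal:
  assumes h: "chan h"
  shows "regret R r \<theta> h pol m = (\<Sum>t<m. EE h t (\<lambda>hs. of_bool (alive hs) * gap_rate (h (Suc t)) hs)) +
    (\<Sum>s\<in>{1..m}. change_prob h s * regret R r \<theta> (\<lambda>t. h (s + t)) pol (m - s))"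
proof -
  have split: "EE h t (gap_rate (h (Suc t))) = EE h t (\<lambda>hs. of_bool (alive hs) * gap_rate (h (Suc t)) hs) +
      (\<Sum>s\<in>{1..t}. change_prob h s * EE (\<lambda>t. h (s + t)) (t - s) (gap_rate (h (Suc t))))" for t
  proof -
    have "EE h t (gap_rate (h (Suc t))) = EE h t (\<lambda>hs. of_bool (alive hs) * gap_rate (h (Suc t)) hs +
       (\<Sum>s\<in>{1..t}. of_bool (first_change (drop (t - s) hs)) * gap_rate (h (Suc t)) hs))"
    proof (intro EE_cong)
      fix hs assume hs: "hs \<in> hists t"
      show "gap_rate (h (Suc t)) hs = of_bool (alive hs) * gap_rate (h (Suc t)) hs +
         (\<Sum>s\<in>{1..t}. of_bool (first_change (drop (t - s) hs)) * gap_rate (h (Suc t)) hs)"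
        using alive_or_first_change[of hs] hists_length[OF hs]
        unfolding sum_distrib_right[symmetric] distrib_right[symmetric] by simp
    qed
    also have "\<dots> = EE h t (\<lambda>hs. of_bool (alive hs) * gap_rate (h (Suc t)) hs) +
       (\<Sum>s\<in>{1..t}. EE h t (\<lambda>hs. of_bool (first_change (drop (t - s) hs)) * gap_rate (h (Suc t)) hs))"
      by (simp only: EE_add EE_sum)
    also have "(\<Sum>s\<in>{1..t}. EE h t (\<lambda>hs. of_bool (first_change (drop (t - s) hs)) * gap_rate (h (Suc t)) hs)) =
       (\<Sum>s\<in>{1..t}. change_prob h s * EE (\<lambda>t. h (s + t)) (t - s) (gap_rate (h (Suc t))))"
    proof (intro sum.cong refl)
      fix s assume s: "s \<in> {1..t}"
      have "EE h (s + (t - s)) (\<lambda>hs. of_bool (first_change (drop (t - s) hs)) * gap_rate (h (Suc t)) hs) =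
         EE h s (\<lambda>g. of_bool (first_change g) * EE (\<lambda>t. h (s + t)) (t - s) (\<lambda>e. gap_rate (h (Suc t)) (e @ g)))"
        by (rule EE_restart[OF h])
      also have "\<dots> = EE h s (\<lambda>g. EE (\<lambda>t. h (s + t)) (t - s) (gap_rate (h (Suc t))) * of_bool (first_change g))"
        by (intro EE_cong) (auto simp: gap_rate_def[abs_def] pol_append first_change_length)
      finally show "EE h t (\<lambda>hs. of_bool (first_change (drop (t - s) hs)) * gap_rate (h (Suc t)) hs) =
        change_prob h s * EE (\<lambda>t. h (s + t)) (t - s) (gap_rate (h (Suc t)))"
        using s by (simp add: EE_cmult change_prob_def)
    qed
    finally show ?thesis .
  qed
  have "regret R r \<theta> h pol m = (\<Sum>t<m. EE h t (\<lambda>hs. of_bool (alive hs) * gap_rate (h (Suc t)) hs)) +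
     (\<Sum>t<m. \<Sum>s\<in>{1..t}. change_prob h s * EE (\<lambda>t. h (s + t)) (t - s) (gap_rate (h (Suc t))))"
    unfolding regret_eq_sum[OF h] by (subst split) (simp add: sum.distrib)
  also have "(\<Sum>t<m. \<Sum>s\<in>{1..t}. change_prob h s * EE (\<lambda>t. h (s + t)) (t - s) (gap_rate (h (Suc t)))) =
     (\<Sum>s\<in>{1..m}. \<Sum>t\<in>{s..<m}. change_prob h s * EE (\<lambda>t. h (s + t)) (t - s) (gap_rate (h (Suc t))))"
    by (subst sum.Sigma, simp, simp, subst sum.Sigma, simp, simp,
        rule sum.reindex_bij_witness[of _ "\<lambda>(s, t). (t, s)" "\<lambda>(t, s). (s, t)"]) auto
  also have "\<dots> = (\<Sum>s\<in>{1..m}. change_prob h s * regret R r \<theta> (\<lambda>t. h (s + t)) pol (m - s))"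
  proof (intro sum.cong refl)
    fix s assume s: "s \<in> {1..m}"
    have h': "chan (\<lambda>t. h (s + t))" using h by (simp add: chan_def)
    have "(\<Sum>t\<in>{s..<m}. EE (\<lambda>t. h (s + t)) (t - s) (gap_rate (h (Suc t)))) = (\<Sum>u<m - s. EE (\<lambda>t. h (s + t)) u (gap_rate (h (s + Suc u))))"
      by (rule sum.reindex_bij_witness[of _ "\<lambda>u. u + s" "\<lambda>t. t - s"]) auto
    then show "(\<Sum>t\<in>{s..<m}. change_prob h s * EE (\<lambda>t. h (s + t)) (t - s) (gap_rate (h (Suc t)))) =
       change_prob h s * regret R r \<theta> (\<lambda>t. h (s + t)) pol (m - s)"
      unfolding regret_eq_sum[OF h'] sum_distrib_left[symmetric] by simp
  qed
  finally show ?thesis .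
qed

lemma alive_prob_Suc:
  assumes "chan h"
  shows "alive_prob h (Suc t) + change_prob h (Suc t) = alive_prob h t"
proof -
  have "alive_prob h (Suc t) + change_prob h (Suc t) = EE h (Suc t) (\<lambda>hs. of_bool (alive (drop 1 hs)))"
    unfolding alive_prob_def change_prob_def EE_add[symmetric]
  proof (intro EE_cong)
    fix hs assume "hs \<in> hists (Suc t)"
    then obtain p g where "hs = p # g" by (cases hs) (auto simp: hists_def)
    then show "of_bool (alive hs) + of_bool (first_change hs) = (of_bool (alive (drop 1 hs)) :: real)"
      by (auto simp: first_change_def alive_Cons)
  qed
  also have "\<dots> = alive_prob h t"
    using EE_prefix[OF assms, of t 1] by (simp add: alive_prob_def)
  finally show ?thesis .
qed

lemma alive_prob_nonneg: "0 \<le> alive_prob h t"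
  and change_prob_nonneg: "0 \<le> change_prob h t"
  unfolding alive_prob_def change_prob_def by (rule EE_nonneg, simp)+

lemma alive_prob_0 [simp]: "alive_prob h 0 = 1"
  by (simp add: alive_prob_def)

lemma alive_prob_antimono:
  assumes "chan h" "s \<le> t"
  shows "alive_prob h t \<le> alive_prob h s"
proof -
  have "alive_prob h (Suc t) \<le> alive_prob h t" for t
    using alive_prob_Suc[OF assms(1), of t] change_prob_nonneg[of h "Suc t"] by linarith
  then show ?thesis
    using assms(2) by (rule lift_Suc_antimono_le)
qed

lemma sum_change_prob:
  assumes "chan h" "s \<le> t"
  shows "(\<Sum>u\<in>{s<..t}. change_prob h u) = alive_prob h s - alive_prob h t"
  using assms(2)
proof (induction rule: dec_induct)
  case (step n)
  have "{s<..Suc n} = insert (Suc n) {s<..n}" using step by auto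
  then show ?case using step alive_prob_Suc[OF assms(1), of n] by simp
qed simp

end

section \<open>Martingale estimates\<close>

lemma transmissions_Nil [simp]: "transmissions i [] = 0"
  and successes_Nil [simp]: "successes i [] = 0"
  and failures_Nil [simp]: "failures i [] = 0"
  by (simp_all add: transmissions_def successes_def failures_def outcomes_def)

lemma transmissions_Cons [simp]: "transmissions i ((i', x) # hs) = transmissions i hs + of_bool (i' = i)"
  and successes_Cons [simp]: "successes i ((i', x) # hs) = successes i hs + of_bool (i' = i \<and> x)"
  and failures_Cons [simp]: "failures i ((i', x) # hs) = failures i hs + of_bool (i' = i \<and> \<not> x)"
  by (auto simp: transmissions_def successes_def failures_def outcomes_def)

lemma transmissions_eq: "transmissions i hs = successes i hs + failures i hs"
  by (simp add: transmissions_def successes_def failures_def sum_length_filter_compl)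

lemma transmissions_le_length: "transmissions i hs \<le> length hs"
  by (simp add: transmissions_def outcomes_def)

lemma of_bool_mult_le: "(C \<Longrightarrow> p \<le> r) \<Longrightarrow> 0 \<le> r \<Longrightarrow> of_bool C * p \<le> r" for p r :: real
  by simp

lemma real_minus_Suc: "real (J - Suc n) = real (J - n) - of_bool (n < J)"
  by (auto simp: of_nat_diff)

lemma inverse_le_ratio: "0 < D \<Longrightarrow> 0 < P \<Longrightarrow> D \<le> n * P \<Longrightarrow> 1 / P \<le> n / D" for D P n :: real
  by (simp add: field_simps)

text \<open>Hoeffding's lemma for a centred Bernoulli variable. Negative x reduce to positive ones
  by exchanging success and failure.\<close>

lemma bernoulli_mgf:
  fixes p x :: real
  assumes "0 \<le> p" "p \<le> 1"
  shows "p * exp (x * (1 - p)) + (1 - p) * exp (- (x * p)) \<le> exp (x\<^sup>2 / 8)"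
proof -
  have pos: "p * exp (x * (1 - p)) + (1 - p) * exp (- (x * p)) \<le> exp (x\<^sup>2 / 8)"
    if "0 \<le> x" "0 \<le> p" "p \<le> 1" for x p :: real
  proof -
    have "0 \<le> p * (exp x - 1)" using that by simp
    then have 1: "0 < 1 + p * (exp x - 1)" by linarith
    have "p * exp (x * (1 - p)) + (1 - p) * exp (- (x * p)) = exp (- (x * p)) * (1 + p * (exp x - 1))"
      by (simp add: algebra_simps exp_add[symmetric] exp_diff exp_minus divide_inverse)
    also have "\<dots> = exp (- x * p + ln (1 + p * (exp x - 1)))"
      using 1 by (simp only: exp_add exp_ln mult_minus_left)
    also have "\<dots> \<le> exp (x\<^sup>2 / 8)"
      using Hoeffdings_lemma_aux[of x p] that by simp
    finally show ?thesis .
  qed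
  show ?thesis
  proof (cases "0 \<le> x")
    case True then show ?thesis using pos assms by simp
  next
    case False
    then show ?thesis using pos[of "- x" "1 - p"] assms by (simp add: algebra_simps)
  qed
qed

text \<open>With u = sqrt x, the product (j + 1) u ^ j is at most the geometric sum 1 + u + ... + u
  ^ j; squaring turns u into x.\<close>

lemma square_times_power_le:
  fixes x :: real
  assumes "0 \<le> x" "x < 1"
  shows "(real j + 1)\<^sup>2 * x ^ j \<le> 1 / (1 - sqrt x)\<^sup>2"
proof -
  let ?u = "sqrt x"
  have u: "0 \<le> ?u" "?u < 1" using assms by auto
  have "(real j + 1) * ?u ^ j = (\<Sum>i\<le>j. ?u ^ j)" by simp
  also have "\<dots> \<le> (\<Sum>i\<le>j. ?u ^ i)"
    using u by (intro sum_mono power_decreasing) auto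
  also have "\<dots> \<le> 1 / (1 - ?u)"
    using u by (simp add: sum_gp0 divide_right_mono)
  finally have "((real j + 1) * ?u ^ j)\<^sup>2 \<le> (1 / (1 - ?u))\<^sup>2"
    using u by (intro power_mono) auto
  moreover have "(?u ^ j)\<^sup>2 = x ^ j"
    using assms by (simp add: power_mult[symmetric] mult.commute[of j] power_mult)
  ultimately show ?thesis
    by (simp add: power_mult_distrib power_divide)
qed

context cdts_run
begin

lemma step_arm:
  assumes k: "k \<in> {1..R}" and f: "\<And>i x. i \<noteq> k \<Longrightarrow> f ((i, x) # hs) = f hs"
  shows "step q hs f = f hs + pmf (pol hs) k * (\<theta> q k * f ((k, True) # hs) + (1 - \<theta> q k) * f ((k, False) # hs) - f hs)"
proof -
  have "step q hs f = pmf (pol hs) k * (\<theta> q k * f ((k, True) # hs) + (1 - \<theta> q k) * f ((k, False) # hs)) +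
     (\<Sum>i\<in>{1..R} - {k}. pmf (pol hs) i * f hs)"
    unfolding step_def using k f by (subst sum.remove[of _ k]) (auto simp: algebra_simps intro!: sum.cong)
  also have "(\<Sum>i\<in>{1..R} - {k}. pmf (pol hs) i * f hs) = (1 - pmf (pol hs) k) * f hs"
    using sum_pol[of hs] k by (simp add: sum.remove[of _ k] flip: sum_distrib_right)
  finally show ?thesis
    by (simp add: algebra_simps)
qed

lemma step_cmult: "step q hs (\<lambda>hs. c * f hs) = c * step q hs f"
  by (simp add: step_def sum_distrib_left algebra_simps)

text \<open>Drift method: a potential f that decreases by g on average pays for the total of g with
  its initial value. The bounds on expected numbers of choices come from suitable
  potentials.\<close>

lemma EE_potential:
  assumes h: "chan h" and st: "\<And>t hs. t < n \<Longrightarrow> hs \<in> hists t \<Longrightarrow> step (h (Suc t)) hs f \<le> f hs - g t hs"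
  shows "(\<Sum>t<n. EE h t (g t)) \<le> f [] - EE h n f"
  using st
proof (induction n)
  case (Suc n)
  have "EE h (Suc n) f \<le> EE h n (\<lambda>hs. f hs - g n hs)"
    unfolding EE_Suc[OF h] using Suc.prems by (intro EE_mono) auto
  then show ?case
    using Suc by (simp add: EE_diff)
qed simp

lemma EE_supermartingale:
  assumes h: "chan h" and st: "\<And>t hs. t < n \<Longrightarrow> hs \<in> hists t \<Longrightarrow> step (h (Suc t)) hs f \<le> f hs"
  shows "EE h n f \<le> f []"
  using EE_potential[OF h, of n f "\<lambda>_ _. 0"] st by simp

subsection \<open>Concentration of weighted outcome sums\<close>

text \<open>The coefficient c n belongs to the transmission that is preceded by n others of the same
  rate. It is known before the outcome, so for every fixed c the sum is a martingale.\<close>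

primrec weighted_sum :: "(nat \<Rightarrow> nat) \<Rightarrow> nat \<Rightarrow> (nat \<Rightarrow> real) \<Rightarrow> history \<Rightarrow> real" where
  "weighted_sum h i c [] = 0"
| "weighted_sum h i c (p # hs) = weighted_sum h i c hs +
     (if fst p = i then c (transmissions i hs) * (of_bool (snd p) - \<theta> (h (Suc (length hs))) i) else 0)"

lemma weighted_sum_minus: "weighted_sum h i (\<lambda>n. - c n) hs = - weighted_sum h i c hs"
  by (induction hs) auto

text \<open>The number of terms is random and depends on the outcomes, so the compensator grows with
  the transmissions actually made.\<close>

lemma weighted_sum_mgf:
  assumes h: "chan h" and i: "i \<in> {1..R}"
  shows "EE h m (\<lambda>hs. exp (l * weighted_sum h i c hs - l\<^sup>2 / 8 * (\<Sum>n<transmissions i hs. (c n)\<^sup>2))) \<le> 1"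
proof -
  let ?f = "\<lambda>hs. exp (l * weighted_sum h i c hs - l\<^sup>2 / 8 * (\<Sum>n<transmissions i hs. (c n)\<^sup>2))"
  have "EE h m ?f \<le> ?f []"
  proof (intro EE_supermartingale h)
    fix t hs assume hs: "hs \<in> hists t"
    let ?p = "\<theta> (h (Suc t)) i" and ?c = "c (transmissions i hs)"
    have p: "0 \<le> ?p" "?p \<le> 1"
      using \<theta>_nonneg[OF chanD[OF h] i] \<theta>_le[OF chanD[OF h] i] by auto
    have T: "?f ((i, True) # hs) = ?f hs * exp (- ((l * ?c)\<^sup>2 / 8)) * exp (l * ?c * (1 - ?p))"
      and F: "?f ((i, False) # hs) = ?f hs * exp (- ((l * ?c)\<^sup>2 / 8)) * exp (- (l * ?c * ?p))"
      using hists_length[OF hs] by (simp_all add: exp_add[symmetric] algebra_simps power_mult_distrib)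
    have "?p * ?f ((i, True) # hs) + (1 - ?p) * ?f ((i, False) # hs) =
       ?f hs * exp (- ((l * ?c)\<^sup>2 / 8)) * (?p * exp (l * ?c * (1 - ?p)) + (1 - ?p) * exp (- (l * ?c * ?p)))"
      unfolding T F by (simp add: algebra_simps)
    also have "\<dots> \<le> ?f hs * exp (- ((l * ?c)\<^sup>2 / 8)) * exp ((l * ?c)\<^sup>2 / 8)"
      using p by (intro mult_left_mono bernoulli_mgf) auto
    also have "\<dots> = ?f hs"
      by (simp add: exp_minus)
    finally have "?p * ?f ((i, True) # hs) + (1 - ?p) * ?f ((i, False) # hs) - ?f hs \<le> 0"
      by simp
    then show "step (h (Suc t)) hs ?f \<le> ?f hs"
      by (subst step_arm[OF i]) (auto intro!: mult_nonneg_nonpos)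
  qed
  then show ?thesis by simp
qed

lemma weighted_sum_tail_upper:
  assumes "chan h" "i \<in> {1..R}" "0 < e" "0 < A" "(\<Sum>n<j. (c n)\<^sup>2) \<le> A"
  shows "EE h m (\<lambda>hs. of_bool (transmissions i hs = j \<and> e \<le> weighted_sum h i c hs)) \<le> exp (- (2 * e\<^sup>2 / A))"
proof -
  \<comment> \<open>The minimiser of l^2 A / 8 - l e; the minimum is - 2 e^2 / A.\<close>
  define l where "l = 4 * e / A"
  have l: "0 < l" using assms by (simp add: l_def)
  let ?f = "\<lambda>hs. exp (l * weighted_sum h i c hs - l\<^sup>2 / 8 * (\<Sum>n<transmissions i hs. (c n)\<^sup>2))"
  have "EE h m (\<lambda>hs. of_bool (transmissions i hs = j \<and> e \<le> weighted_sum h i c hs)) \<le> EE h m (\<lambda>hs. exp (- (2 * e\<^sup>2 / A)) * ?f hs)"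
  proof (intro EE_mono)
    fix hs
    show "of_bool (transmissions i hs = j \<and> e \<le> weighted_sum h i c hs) \<le> exp (- (2 * e\<^sup>2 / A)) * ?f hs"
    proof (cases "transmissions i hs = j \<and> e \<le> weighted_sum h i c hs")
      case True
      have "l * e \<le> l * weighted_sum h i c hs"
        using True l by (intro mult_left_mono) auto
      moreover have "l\<^sup>2 / 8 * (\<Sum>n<transmissions i hs. (c n)\<^sup>2) \<le> l\<^sup>2 / 8 * A"
        using True assms by (intro mult_left_mono) auto
      moreover have "l * e - l\<^sup>2 / 8 * A = 2 * e\<^sup>2 / A"
        using assms by (simp add: l_def field_simps power2_eq_square)
      ultimately have "2 * e\<^sup>2 / A \<le> l * weighted_sum h i c hs - l\<^sup>2 / 8 * (\<Sum>n<transmissions i hs. (c n)\<^sup>2)"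
        by linarith
      then have "exp 0 \<le> exp (- (2 * e\<^sup>2 / A)) * ?f hs"
        unfolding exp_add[symmetric] by (subst exp_le_cancel_iff) linarith
      then show ?thesis using True by simp
    qed auto
  qed
  also have "\<dots> \<le> exp (- (2 * e\<^sup>2 / A)) * 1"
    unfolding EE_cmult using weighted_sum_mgf[OF assms(1,2)] by (intro mult_left_mono) auto
  finally show ?thesis by simp
qed

lemma weighted_sum_tail:
  assumes "chan h" "i \<in> {1..R}" "0 < e" "0 < A" "(\<Sum>n<j. (c n)\<^sup>2) \<le> A"
  shows "EE h m (\<lambda>hs. of_bool (transmissions i hs = j \<and> e \<le> \<bar>weighted_sum h i c hs\<bar>)) \<le> 2 * exp (- (2 * e\<^sup>2 / A))"
proof -
  have "EE h m (\<lambda>hs. of_bool (transmissions i hs = j \<and> e \<le> \<bar>weighted_sum h i c hs\<bar>)) \<le>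
     EE h m (\<lambda>hs. of_bool (transmissions i hs = j \<and> e \<le> weighted_sum h i c hs) +
       of_bool (transmissions i hs = j \<and> e \<le> weighted_sum h i (\<lambda>n. - c n) hs))"
    by (intro EE_mono) (auto simp: weighted_sum_minus abs_if)
  also have "\<dots> \<le> exp (- (2 * e\<^sup>2 / A)) + exp (- (2 * e\<^sup>2 / A))"
    unfolding EE_add using assms by (intro add_mono weighted_sum_tail_upper) auto
  finally show ?thesis by simp
qed

end

section \<open>Likelihood ratios and moments in a constant state\<close>

locale clean_run = cdts_run R r \<theta> Q w F b
  for R :: nat and r :: "nat \<Rightarrow> real" and \<theta> :: "nat \<Rightarrow> nat \<Rightarrow> real" and Q w F :: nat and b :: real +
  fixes h :: "nat \<Rightarrow> nat" and a m :: nat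
  assumes h: "chan h" and h_clean: "\<And>t. 1 \<le> t \<Longrightarrow> t \<le> m \<Longrightarrow> h t = a" and a: "a \<in> {1..Q}"
begin

lemma pos: "i \<in> {1..R} \<Longrightarrow> 0 < \<theta> a i" and less_1: "i \<in> {1..R} \<Longrightarrow> \<theta> a i < 1"
  using \<theta>_pos[OF a] \<theta>_less[OF a] by auto

lemma h_Suc: "t < n \<Longrightarrow> n \<le> m \<Longrightarrow> h (Suc t) = a"
  using h_clean[of "Suc t"] by simp

text \<open>The potential is the number of transmissions of k still missing to J.\<close>

lemma sum_plays_le:
  assumes "n \<le> m" "k \<in> {1..R}"
  shows "(\<Sum>t<n. EE h t (\<lambda>hs. of_bool (transmissions k hs < J) * pmf (pol hs) k)) \<le> real J"
proof -
  let ?f = "\<lambda>hs. real (J - transmissions k hs)"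
  have "(\<Sum>t<n. EE h t (\<lambda>hs. of_bool (transmissions k hs < J) * pmf (pol hs) k)) \<le> ?f [] - EE h n ?f"
  proof (intro EE_potential h)
    fix t hs
    show "step (h (Suc t)) hs ?f \<le> ?f hs - of_bool (transmissions k hs < J) * pmf (pol hs) k"
      by (subst step_arm[OF assms(2)]) (auto simp: real_minus_Suc algebra_simps)
  qed
  also have "\<dots> \<le> real J"
    using EE_nonneg[of n ?f h] by simp
  finally show ?thesis .
qed

text \<open>
  The likelihood ratio of a uniformly distributed success probability restricted to \<open>{y..1}\<close>
  against the true one; it is a martingale whatever the policy does.
\<close>

definition lik_ratio :: "real \<Rightarrow> nat \<Rightarrow> history \<Rightarrow> real" where
  "lik_ratio y k hs = beta_tail (successes k hs) (failures k hs) y /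
     (\<theta> a k ^ successes k hs * (1 - \<theta> a k) ^ failures k hs)"

lemma lik_ratio_other: "i \<noteq> k \<Longrightarrow> lik_ratio y k ((i, x) # hs) = lik_ratio y k hs"
  by (simp add: lik_ratio_def)

lemma lik_ratio_step:
  assumes "k \<in> {1..R}"
  shows "\<theta> a k * lik_ratio y k ((k, True) # hs) + (1 - \<theta> a k) * lik_ratio y k ((k, False) # hs) = lik_ratio y k hs"
proof -
  let ?s = "successes k hs" and ?f = "failures k hs"
  have "\<theta> a k * lik_ratio y k ((k, True) # hs) + (1 - \<theta> a k) * lik_ratio y k ((k, False) # hs) =
     (beta_tail (Suc ?s) ?f y + beta_tail ?s (Suc ?f) y) / (\<theta> a k ^ ?s * (1 - \<theta> a k) ^ ?f)"
    using pos[OF assms] less_1[OF assms] by (simp add: lik_ratio_def add_divide_distrib)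
  then show ?thesis
    by (simp only: beta_tail_Suc lik_ratio_def)
qed

lemma lik_ratio_nonneg: "k \<in> {1..R} \<Longrightarrow> 0 \<le> y \<Longrightarrow> 0 \<le> lik_ratio y k hs"
  unfolding lik_ratio_def using pos[of k] less_1[of k]
  by (intro divide_nonneg_nonneg beta_tail_nonneg mult_nonneg_nonneg) auto

lemma lik_ratio_0_Nil: "lik_ratio 0 k [] = 1"
  by (simp add: lik_ratio_def beta_tail_def)

lemma lik_ratio_0_ge:
  assumes "k \<in> {1..R}"
  shows "1 \<le> real (transmissions k hs + 1) * lik_ratio 0 k hs"
proof -
  let ?d = "\<theta> a k ^ successes k hs * (1 - \<theta> a k) ^ failures k hs"
  have "0 < ?d" using pos[OF assms] less_1[OF assms] by simp
  moreover have "?d \<le> real (transmissions k hs + 1) * beta_tail (successes k hs) (failures k hs) 0"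
    using beta_tail_0_ge[of "\<theta> a k"] pos[OF assms] less_1[OF assms] by (simp add: transmissions_eq)
  ultimately show ?thesis
    by (simp add: lik_ratio_def pos_le_divide_eq)
qed

text \<open>Bayes' rule: the normalising constant of the posterior of a uniform prior is the full
  likelihood ratio, up to the likelihood under the true parameter.\<close>

lemma lik_ratio_eq:
  assumes "0 \<le> y" "y \<le> 1"
  shows "lik_ratio y k hs = arm_prob k y hs * lik_ratio 0 k hs"
  using beta_tail_0_pos[of "successes k hs" "failures k hs"] assms
  by (simp add: lik_ratio_def arm_prob_def upper_prob_eq)

lemma arm_prob_le_lik_ratio:
  assumes "k \<in> {1..R}" "0 \<le> y" "y \<le> 1"
  shows "arm_prob k y hs \<le> real (transmissions k hs + 1) * lik_ratio y k hs"
  using mult_left_mono[OF lik_ratio_0_ge[OF assms(1), of hs] arm_prob_nonneg[of k y hs]]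
  by (simp add: lik_ratio_eq[OF assms(2,3)] mult_ac)

text \<open>If the true mean lies above the level, the posterior can give little mass to the half
  line only when the data are untypical for the true parameter, and then \<open>lik_ratio 0\<close>
  is large. A reciprocal probability is thereby bounded by a martingale.\<close>

lemma inverse_arm_prob_le:
  assumes "k \<in> {1..R}" "0 \<le> y" "y < \<theta> a k"
  shows "0 < arm_prob k y hs" "1 / arm_prob k y hs \<le> real (transmissions k hs + 1) / (\<theta> a k - y) * lik_ratio 0 k hs"
proof -
  let ?s = "successes k hs" and ?f = "failures k hs"
  let ?d = "\<theta> a k ^ ?s * (1 - \<theta> a k) ^ ?f"
  have d: "0 < ?d" using pos[OF assms(1)] less_1[OF assms(1)] by simp
  have y: "y < 1" using assms less_1[OF assms(1)] by simp
  have p: "0 < beta_tail ?s ?f y" using assms y by (intro beta_tail_lt_pos) auto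
  show "0 < arm_prob k y hs"
    using p beta_tail_0_pos assms y by (simp add: arm_prob_def upper_prob_eq)
  have "(\<theta> a k - y) * ?d \<le> real (Suc ?s) * beta_tail ?s ?f y"
    using assms less_1[OF assms(1)] by (intro beta_tail_mean_ge) auto
  also have "\<dots> \<le> real (transmissions k hs + 1) * beta_tail ?s ?f y"
    using p by (intro mult_right_mono) (auto simp: transmissions_eq)
  finally have "1 / beta_tail ?s ?f y \<le> real (transmissions k hs + 1) / ((\<theta> a k - y) * ?d)"
    using p d assms(3) by (intro inverse_le_ratio mult_pos_pos[OF _ d]) auto
  then have "beta_tail ?s ?f 0 * (1 / beta_tail ?s ?f y) \<le> beta_tail ?s ?f 0 * (real (transmissions k hs + 1) / ((\<theta> a k - y) * ?d))"
    using beta_tail_0_pos[of ?s ?f] by (intro mult_left_mono) auto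
  then show "1 / arm_prob k y hs \<le> real (transmissions k hs + 1) / (\<theta> a k - y) * lik_ratio 0 k hs"
    using assms y by (simp add: arm_prob_def upper_prob_eq lik_ratio_def mult.commute)
qed

text \<open>The potential is the number of transmissions missing to J times the likelihood ratio:
  the ratio is a martingale, and the counter drops by one at each choice of k.\<close>

lemma sum_plays_lik_ratio_le:
  assumes "n \<le> m" "k \<in> {1..R}"
  shows "(\<Sum>t<n. EE h t (\<lambda>hs. of_bool (transmissions k hs < J) * pmf (pol hs) k * lik_ratio 0 k hs)) \<le> real J"
proof -
  let ?f = "\<lambda>hs. real (J - transmissions k hs) * lik_ratio 0 k hs"
  have "(\<Sum>t<n. EE h t (\<lambda>hs. of_bool (transmissions k hs < J) * pmf (pol hs) k * lik_ratio 0 k hs)) \<le> ?f [] - EE h n ?f"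
  proof (intro EE_potential h)
    fix t hs assume t: "t < n"
    let ?c = "real (J - Suc (transmissions k hs))"
    have "\<theta> a k * ?f ((k, True) # hs) + (1 - \<theta> a k) * ?f ((k, False) # hs) =
       ?c * (\<theta> a k * lik_ratio 0 k ((k, True) # hs) + (1 - \<theta> a k) * lik_ratio 0 k ((k, False) # hs))"
      by (simp add: algebra_simps)
    also have "\<dots> = ?c * lik_ratio 0 k hs"
      by (simp only: lik_ratio_step[OF assms(2)])
    finally have "\<theta> a k * ?f ((k, True) # hs) + (1 - \<theta> a k) * ?f ((k, False) # hs) = ?c * lik_ratio 0 k hs" .
    then have "step a hs ?f = ?f hs + pmf (pol hs) k * (?c * lik_ratio 0 k hs - ?f hs)"
      by (subst step_arm[OF assms(2)]) (auto simp: lik_ratio_other)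
    then show "step (h (Suc t)) hs ?f \<le> ?f hs - of_bool (transmissions k hs < J) * pmf (pol hs) k * lik_ratio 0 k hs"
      by (simp add: h_Suc[OF t assms(1)] real_minus_Suc algebra_simps)
  qed
  also have "\<dots> \<le> real J"
    using EE_nonneg[of n ?f h] lik_ratio_nonneg[OF assms(2)] by (simp add: lik_ratio_0_Nil)
  finally show ?thesis .
qed

definition reached :: "nat \<Rightarrow> real \<Rightarrow> real \<Rightarrow> history \<Rightarrow> bool" where
  "reached k y \<eta> hs \<longleftrightarrow> (\<exists>j\<le>length hs. arm_prob k y (drop j hs) \<le> \<eta>)"

lemma reached_Cons: "reached k y \<eta> (p # hs) \<longleftrightarrow> arm_prob k y (p # hs) \<le> \<eta> \<or> reached k y \<eta> hs"
proof
  assume "reached k y \<eta> (p # hs)"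
  then obtain j where "j \<le> Suc (length hs)" "arm_prob k y (drop j (p # hs)) \<le> \<eta>"
    by (auto simp: reached_def)
  then show "arm_prob k y (p # hs) \<le> \<eta> \<or> reached k y \<eta> hs"
    by (cases j) (auto simp: reached_def)
next
  assume "arm_prob k y (p # hs) \<le> \<eta> \<or> reached k y \<eta> hs"
  then show "reached k y \<eta> (p # hs)"
  proof
    assume "arm_prob k y (p # hs) \<le> \<eta>"
    then show ?thesis unfolding reached_def by (intro exI[of _ 0]) simp
  next
    assume "reached k y \<eta> hs"
    then obtain j where "j \<le> length hs" "arm_prob k y (drop j hs) \<le> \<eta>"
      by (auto simp: reached_def)
    then show ?thesis unfolding reached_def by (intro exI[of _ "Suc j"]) simp
  qed
qed

text \<open>A small posterior probability does not recover: afterwards \<open>lik_ratio y\<close> stays a martingale.\<close>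

lemma EE_reached_lik_ratio:
  assumes "n \<le> m" "k \<in> {1..R}" "0 \<le> y" "y \<le> 1" "0 \<le> \<eta>"
  shows "EE h n (\<lambda>hs. of_bool (reached k y \<eta> hs) * lik_ratio y k hs) \<le> \<eta>"
proof -
  \<comment> \<open>The process follows \<eta> times \<open>lik_ratio 0\<close> until the posterior
    is first at most \<eta>, and \<open>lik_ratio y\<close> afterwards. Both are martingales, and by
    \<open>lik_ratio_eq\<close> the switch can only lower the value.\<close>
  let ?Y = "\<lambda>hs. if reached k y \<eta> hs then lik_ratio y k hs else \<eta> * lik_ratio 0 k hs"
  have stop: "?Y hs \<le> \<eta> * lik_ratio 0 k hs" if "reached k y \<eta> hs \<Longrightarrow> arm_prob k y hs \<le> \<eta>" for hs
    using that lik_ratio_nonneg[OF assms(2), of 0 hs] by (auto simp: lik_ratio_eq[OF assms(3,4)] intro: mult_right_mono)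
  have "EE h n (\<lambda>hs. of_bool (reached k y \<eta> hs) * lik_ratio y k hs) \<le> EE h n ?Y"
    using assms lik_ratio_nonneg[OF assms(2)] by (intro EE_mono) auto
  also have "\<dots> \<le> ?Y []"
  proof (intro EE_supermartingale h)
    fix t hs assume t: "t < n"
    have mart: "step a hs (lik_ratio z k) = lik_ratio z k hs" for z
      using lik_ratio_step[OF assms(2), of z hs] by (subst step_arm[OF assms(2)]) (auto simp: lik_ratio_other)
    have scale: "step a hs (\<lambda>hs. \<eta> * lik_ratio 0 k hs) = \<eta> * lik_ratio 0 k hs"
      by (simp add: step_cmult mart)
    show "step (h (Suc t)) hs ?Y \<le> ?Y hs"
    proof (cases "reached k y \<eta> hs")
      case True
      then have "step a hs ?Y = step a hs (lik_ratio y k)"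
        by (simp add: step_def reached_Cons)
      then show ?thesis using True mart by (simp add: h_Suc[OF t assms(1)])
    next
      case False
      have "step a hs ?Y \<le> step a hs (\<lambda>hs. \<eta> * lik_ratio 0 k hs)"
        using False by (intro step_mono a stop) (simp add: reached_Cons)
      then show ?thesis using False scale by (simp add: h_Suc[OF t assms(1)])
    qed
  qed
  also have "?Y [] \<le> \<eta> * lik_ratio 0 k []"
    by (rule stop) (auto simp: reached_def)
  finally show ?thesis
    by (simp add: lik_ratio_0_Nil)
qed

text \<open>The indicator of no failures divided by \<theta> ^ N, N the number of transmissions, is
  a martingale that starts at 1. Runs of successes are thus exponentially unlikely even for an
  adaptive policy, which beats the quadratic factor.\<close>

lemma EE_no_failures:
  assumes "n \<le> m" "k \<in> {1..R}"
  shows "EE h n (\<lambda>hs. of_bool (failures k hs = 0) * (real (transmissions k hs) + 1)\<^sup>2) \<le> 1 / (1 - sqrt (\<theta> a k))\<^sup>2"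
proof -
  let ?f = "\<lambda>hs. of_bool (failures k hs = 0) / \<theta> a k ^ transmissions k hs :: real" and ?C = "1 / (1 - sqrt (\<theta> a k))\<^sup>2"
  have "EE h n ?f \<le> ?f []"
  proof (intro EE_supermartingale h)
    fix t hs assume t: "t < n"
    have "\<theta> a k * ?f ((k, True) # hs) + (1 - \<theta> a k) * ?f ((k, False) # hs) = ?f hs"
      using pos[OF assms(2)] by simp
    then have "step a hs ?f = ?f hs"
      by (subst step_arm[OF assms(2)]) auto
    then show "step (h (Suc t)) hs ?f \<le> ?f hs"
      by (simp add: h_Suc[OF t assms(1)])
  qed
  then have f1: "EE h n ?f \<le> 1" by simp
  have C: "0 \<le> ?C" by simp
  have "EE h n (\<lambda>hs. of_bool (failures k hs = 0) * (real (transmissions k hs) + 1)\<^sup>2) \<le> EE h n (\<lambda>hs. ?C * ?f hs)"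
  proof (intro EE_mono)
    fix hs
    have "(real (transmissions k hs) + 1)\<^sup>2 * \<theta> a k ^ transmissions k hs \<le> ?C"
      using pos[OF assms(2)] less_1[OF assms(2)] by (intro square_times_power_le) auto
    then have "(real (transmissions k hs) + 1)\<^sup>2 \<le> ?C / \<theta> a k ^ transmissions k hs"
      using pos[OF assms(2)] by (subst pos_le_divide_eq) auto
    then show "of_bool (failures k hs = 0) * (real (transmissions k hs) + 1)\<^sup>2 \<le> ?C * ?f hs"
      by simp
  qed
  also have "\<dots> \<le> ?C * 1"
    unfolding EE_cmult using f1 C by (intro mult_left_mono)
  finally show ?thesis by simp
qed

text \<open>The centred number of successes is a martingale, and each slot adds at most \<theta> (1
  - \<theta>) \<le> 1 to its second moment.\<close>

lemma EE_variance:
  assumes "n \<le> m" "k \<in> {1..R}"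
  shows "EE h n (\<lambda>hs. (real (successes k hs) - \<theta> a k * real (transmissions k hs))\<^sup>2) \<le> real n"
  using assms(1)
proof (induction n)
  case (Suc n)
  let ?f = "\<lambda>hs. (real (successes k hs) - \<theta> a k * real (transmissions k hs))\<^sup>2"
  have "EE h (Suc n) ?f \<le> EE h n (\<lambda>hs. ?f hs + 1)"
    unfolding EE_Suc[OF h]
  proof (intro EE_mono)
    fix hs
    have eq: "\<theta> a k * ?f ((k, True) # hs) + (1 - \<theta> a k) * ?f ((k, False) # hs) - ?f hs = \<theta> a k * (1 - \<theta> a k)"
      by (simp add: power2_eq_square algebra_simps)
    have "pmf (pol hs) k * (\<theta> a k * (1 - \<theta> a k)) \<le> 1"
      using pos[OF assms(2)] less_1[OF assms(2)] by (intro mult_le_one pmf_le_1) auto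
    then have "step a hs ?f \<le> ?f hs + 1"
      by (subst step_arm[OF assms(2)], simp) (unfold eq, simp)
    then show "step (h (Suc n)) hs ?f \<le> ?f hs + 1"
      using Suc.prems by (simp add: h_clean)
  qed
  then show ?case using Suc by (simp add: EE_add)
qed simp

lemma weighted_sum_const:
  assumes "length hs \<le> m"
  shows "weighted_sum h i (\<lambda>_. 1) hs = real (successes i hs) - \<theta> a i * real (transmissions i hs)"
  using assms
proof (induction hs)
  case (Cons p hs)
  then show ?case by (cases p) (auto simp: h_clean algebra_simps)
qed simp

end

section \<open>Detection windows\<close>

text \<open>Coefficients that turn the detection statistic after j transmissions into a
  \<open>weighted_sum\<close>. Transmissions are counted from 0, so number n is among the latest w
  of them iff j \<le> n + w.\<close>

definition window :: "nat \<Rightarrow> nat \<Rightarrow> nat \<Rightarrow> real" where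
  "window w j n = (if n < j \<and> j \<le> n + w then 1 / real w
     else if n < j \<and> j \<le> n + 2 * w then - 1 / real w else 0)"

lemma length_outcomes [simp]: "length (outcomes i hs) = transmissions i hs"
  by (simp add: transmissions_def)

lemma outcomes_Cons [simp]: "outcomes i ((i', x) # hs) = (if i' = i then x # outcomes i hs else outcomes i hs)"
  by (simp add: outcomes_def)

lemma sum_list_take_drop:
  assumes "n + w \<le> length xs"
  shows "(\<Sum>x\<leftarrow>take w (drop n xs). f x) = (\<Sum>k<w. f (xs ! (n + k)))"
proof -
  have "(\<Sum>x\<leftarrow>take w (drop n xs). f x) = (\<Sum>k = 0..<w. map f (take w (drop n xs)) ! k)"
    using assms by (simp add: sum_list_sum_nth)
  also have "\<dots> = (\<Sum>k<w. f (xs ! (n + k)))"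
    using assms by (intro sum.cong) (auto simp: atLeast0LessThan)
  finally show ?thesis .
qed

lemma sum_window:
  assumes "2 * w \<le> j" "1 \<le> w"
  shows "(\<Sum>n<j. window w j n * f n) = ((\<Sum>k<w. f (j - 1 - k)) - (\<Sum>k<w. f (j - 1 - (w + k)))) / real w"
proof -
  have "(\<Sum>n<j. window w j n * f n) = (\<Sum>k<j. window w j (j - 1 - k) * f (j - 1 - k))"
    by (rule sum.reindex_bij_witness[of _ "\<lambda>k. j - 1 - k" "\<lambda>k. j - 1 - k"]) auto
  also have "\<dots> = (\<Sum>k<j. (if k < w then f (j - 1 - k) / real w else 0) + (if w \<le> k \<and> k < 2 * w then - (f (j - 1 - k) / real w) else 0))"
    by (intro sum.cong) (auto simp: window_def)
  also have "\<dots> = (\<Sum>k\<in>{k. k < j \<and> k < w}. f (j - 1 - k) / real w) + (\<Sum>k\<in>{k. k < j \<and> w \<le> k \<and> k < 2 * w}. - (f (j - 1 - k) / real w))"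
    by (simp add: sum.distrib sum.If_cases Int_def)
  also have "{k. k < j \<and> k < w} = {..<w}" using assms by auto
  also have "{k. k < j \<and> w \<le> k \<and> k < 2 * w} = {w..<2 * w}" using assms by auto
  also have "(\<Sum>k\<in>{w..<2 * w}. - (f (j - 1 - k) / real w)) = (\<Sum>k<w. - (f (j - 1 - (w + k)) / real w))"
    by (rule sum.reindex_bij_witness[of _ "\<lambda>k. w + k" "\<lambda>k. k - w"]) auto
  finally show ?thesis
    by (simp add: sum_negf diff_divide_distrib sum_divide_distrib)
qed

lemma sum_window_square:
  assumes "2 * w \<le> j" "1 \<le> w"
  shows "(\<Sum>n<j. (window w j n)\<^sup>2) = 2 / real w"
proof -
  have "(\<Sum>n<j. (window w j n)\<^sup>2) = (\<Sum>n<j. window w j n * window w j n)"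
    by (simp add: power2_eq_square)
  also have "\<dots> = ((\<Sum>k<w. window w j (j - 1 - k)) - (\<Sum>k<w. window w j (j - 1 - (w + k)))) / real w"
    by (rule sum_window[OF assms])
  also have "(\<Sum>k<w. window w j (j - 1 - k)) = (\<Sum>k<w. 1 / real w)"
    using assms by (intro sum.cong) (auto simp: window_def)
  also have "(\<Sum>k<w. window w j (j - 1 - (w + k))) = (\<Sum>k<w. - 1 / real w)"
    using assms by (intro sum.cong) (auto simp: window_def)
  finally show ?thesis
    using assms by simp
qed

section \<open>The detection statistic as a centred sum\<close>

context cdts_run
begin

text \<open>The success probabilities under which the entries of \<open>outcomes i hs\<close> were
  drawn, in the same order.\<close>

primrec play_means :: "(nat \<Rightarrow> nat) \<Rightarrow> nat \<Rightarrow> history \<Rightarrow> real list" where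
  "play_means h i [] = []"
| "play_means h i (p # hs) = (if fst p = i then [\<theta> (h (Suc (length hs))) i] else []) @ play_means h i hs"

lemma length_play_means [simp]: "length (play_means h i hs) = transmissions i hs"
proof (induction hs)
  case (Cons p hs)
  then show ?case by (cases p) auto
qed simp

text \<open>Outcome lists start with the latest entry, whereas the coefficients count from the
  earliest transmission; hence the reversed index.\<close>

lemma weighted_sum_eq:
  "weighted_sum h i c hs = (\<Sum>n<transmissions i hs. c n *
     (of_bool (outcomes i hs ! (transmissions i hs - 1 - n)) - play_means h i hs ! (transmissions i hs - 1 - n)))"
proof (induction hs)
  case (Cons p hs)
  obtain i' x where p: "p = (i', x)" by (cases p)
  show ?case
  proof (cases "i' = i")
    case True
    let ?N = "transmissions i hs"
    have "(\<Sum>n<?N. c n * (of_bool ((x # outcomes i hs) ! (?N - n)) - (\<theta> (h (Suc (length hs))) i # play_means h i hs) ! (?N - n)))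
       = (\<Sum>n<?N. c n * (of_bool (outcomes i hs ! (?N - 1 - n)) - play_means h i hs ! (?N - 1 - n)))"
      by (intro sum.cong refl) (auto simp: nth_Cons')
    then show ?thesis
      using True Cons p by simp
  next
    case False
    then show ?thesis using Cons p by simp
  qed
qed simp

abbreviation window_diff :: "nat \<Rightarrow> history \<Rightarrow> real" where
  "window_diff i hs \<equiv> mean_outcome (take w (outcomes i hs)) - mean_outcome (take w (drop w (outcomes i hs)))"

lemma weighted_sum_window:
  assumes "2 * w \<le> transmissions i hs"
  shows "weighted_sum h i (window w (transmissions i hs)) hs = window_diff i hs -
    (\<Sum>k<w. play_means h i hs ! k - play_means h i hs ! (w + k)) / real w"
proof -
  let ?N = "transmissions i hs" and ?o = "outcomes i hs" and ?m = "play_means h i hs"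
  have nth: "?N - 1 - (?N - 1 - k) = k" if "k < ?N" for k
    using that by simp
  have "weighted_sum h i (window w ?N) hs =
     ((\<Sum>k<w. of_bool (?o ! k) - ?m ! k) - (\<Sum>k<w. of_bool (?o ! (w + k)) - ?m ! (w + k))) / real w"
    unfolding weighted_sum_eq sum_window[OF assms w_pos]
    using assms by (intro arg_cong2[where f = "(/)"] arg_cong2[where f = "(-)"] sum.cong refl) (subst nth; simp)+
  also have "\<dots> = (\<Sum>k<w. of_bool (?o ! k)) / real w - (\<Sum>k<w. of_bool (?o ! (w + k))) / real w -
      (\<Sum>k<w. ?m ! k - ?m ! (w + k)) / real w"
    by (simp add: sum_subtractf diff_divide_distrib)
  also have "(\<Sum>k<w. of_bool (?o ! k)) / real w = mean_outcome (take w ?o)"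
    using sum_list_take_drop[of 0 w ?o "of_bool :: bool \<Rightarrow> real"] assms by (simp add: mean_outcome_def del: sum_of_bool_eq)
  also have "(\<Sum>k<w. of_bool (?o ! (w + k))) / real w = mean_outcome (take w (drop w ?o))"
    using sum_list_take_drop[of w w ?o "of_bool :: bool \<Rightarrow> real"] assms by (simp add: mean_outcome_def del: sum_of_bool_eq)
  finally show ?thesis .
qed

text \<open>Union bound over the number j of transmissions. For each j the squared coefficients sum
  to 2 / w, so the exponent 2 e^2 / A of the tail bound is w e^2.\<close>

lemma window_tail:
  assumes "chan h" "i \<in> {1..R}" "0 < e"
  shows "EE h n (\<lambda>hs. of_bool (2 * w \<le> transmissions i hs \<and> e \<le> \<bar>weighted_sum h i (window w (transmissions i hs)) hs\<bar>))
    \<le> real (n + 1) * (2 * exp (- (real w * e\<^sup>2)))"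
proof -
  have "EE h n (\<lambda>hs. of_bool (2 * w \<le> transmissions i hs \<and> e \<le> \<bar>weighted_sum h i (window w (transmissions i hs)) hs\<bar>))
    \<le> EE h n (\<lambda>hs. \<Sum>j\<in>{2 * w..n}. of_bool (transmissions i hs = j \<and> e \<le> \<bar>weighted_sum h i (window w j) hs\<bar>))"
  proof (intro EE_mono)
    fix hs assume hs: "hs \<in> hists n"
    let ?g = "\<lambda>j. of_bool (transmissions i hs = j \<and> e \<le> \<bar>weighted_sum h i (window w j) hs\<bar>) :: real"
    show "of_bool (2 * w \<le> transmissions i hs \<and> e \<le> \<bar>weighted_sum h i (window w (transmissions i hs)) hs\<bar>) \<le> (\<Sum>j\<in>{2 * w..n}. ?g j)"
    proof (cases "2 * w \<le> transmissions i hs \<and> e \<le> \<bar>weighted_sum h i (window w (transmissions i hs)) hs\<bar>")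
      case True
      have "transmissions i hs \<in> {2 * w..n}"
        using True transmissions_le_length[of i hs] hists_length[OF hs] by simp
      then have "?g (transmissions i hs) \<le> (\<Sum>j\<in>{2 * w..n}. ?g j)"
        by (intro member_le_sum) auto
      then show ?thesis using True by simp
    qed (auto intro!: sum_nonneg simp del: sum_of_bool_eq)
  qed
  also have "\<dots> \<le> (\<Sum>j\<in>{2 * w..n}. 2 * exp (- (real w * e\<^sup>2)))"
    unfolding EE_sum
  proof (intro sum_mono)
    fix j assume j: "j \<in> {2 * w..n}"
    have "EE h n (\<lambda>hs. of_bool (transmissions i hs = j \<and> e \<le> \<bar>weighted_sum h i (window w j) hs\<bar>)) \<le> 2 * exp (- (2 * e\<^sup>2 / (2 / real w)))"
      using assms j w_pos by (intro weighted_sum_tail) (auto simp: sum_window_square)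
    then show "EE h n (\<lambda>hs. of_bool (transmissions i hs = j \<and> e \<le> \<bar>weighted_sum h i (window w j) hs\<bar>)) \<le> 2 * exp (- (real w * e\<^sup>2))"
      by (simp add: mult.commute)
  qed
  also have "\<dots> \<le> real (n + 1) * (2 * exp (- (real w * e\<^sup>2)))"
    unfolding sum_constant by (intro mult_right_mono) auto
  finally show ?thesis .
qed

end

context clean_run
begin

lemma play_means_clean:
  "length hs \<le> m \<Longrightarrow> k < transmissions i hs \<Longrightarrow> play_means h i hs ! k = \<theta> a i"
proof (induction hs arbitrary: k)
  case (Cons p hs)
  then show ?case by (cases p; cases k) (auto simp: h_clean)
qed simp

text \<open>In a constant state both windows have the same mean, so an alarm is a deviation of the
  centred statistic by more than b.\<close>

lemma false_alarm:
  assumes "0 < b" "n \<le> m"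
  shows "change_prob h n \<le> real R * (real (m + 1) * (2 * exp (- (real w * b\<^sup>2))))"
proof -
  have "change_prob h n \<le> EE h n (\<lambda>hs. \<Sum>i\<in>{1..R}. of_bool (2 * w \<le> transmissions i hs \<and> b \<le> \<bar>weighted_sum h i (window w (transmissions i hs)) hs\<bar>))"
    unfolding change_prob_def
  proof (intro EE_mono)
    fix hs assume hs: "hs \<in> hists n"
    let ?g = "\<lambda>i. of_bool (2 * w \<le> transmissions i hs \<and> b \<le> \<bar>weighted_sum h i (window w (transmissions i hs)) hs\<bar>) :: real"
    show "of_bool (first_change hs) \<le> (\<Sum>i\<in>{1..R}. ?g i)"
    proof (cases "first_change hs")
      case True
      then obtain p g where pg: "hs = p # g" "alive g" "\<not> alive hs"
        by (cases hs) (auto simp: first_change_def)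
      then have cd: "change_detected w b (fst p) hs" by (simp add: alive_Cons)
      have i: "fst p \<in> {1..R}" using hs pg by (auto simp: hists_def)
      have N: "2 * w < transmissions (fst p) hs" and d: "b < \<bar>window_diff (fst p) hs\<bar>"
        using cd by (auto simp: change_detected_def)
      have "(\<Sum>k<w. play_means h (fst p) hs ! k - play_means h (fst p) hs ! (w + k)) = 0"
        using N assms(2) hists_length[OF hs] by (intro sum.neutral) (auto simp: play_means_clean)
      then have "?g (fst p) = 1"
        using N d by (simp add: weighted_sum_window)
      moreover have "?g (fst p) \<le> (\<Sum>i\<in>{1..R}. ?g i)"
        using i by (intro member_le_sum) auto
      ultimately show ?thesis using True by simp
    qed (auto intro!: sum_nonneg simp del: sum_of_bool_eq)
  qed
  also have "\<dots> \<le> (\<Sum>i\<in>{1..R}. real (m + 1) * (2 * exp (- (real w * b\<^sup>2))))"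
    unfolding EE_sum
  proof (intro sum_mono)
    fix i assume "i \<in> {1..R}"
    then have "EE h n (\<lambda>hs. of_bool (2 * w \<le> transmissions i hs \<and> b \<le> \<bar>weighted_sum h i (window w (transmissions i hs)) hs\<bar>))
       \<le> real (n + 1) * (2 * exp (- (real w * b\<^sup>2)))"
      by (intro window_tail h assms)
    also have "\<dots> \<le> real (m + 1) * (2 * exp (- (real w * b\<^sup>2)))"
      using assms by (intro mult_right_mono) auto
    finally show "EE h n (\<lambda>hs. of_bool (2 * w \<le> transmissions i hs \<and> b \<le> \<bar>weighted_sum h i (window w (transmissions i hs)) hs\<bar>))
       \<le> real (m + 1) * (2 * exp (- (real w * b\<^sup>2)))" .
  qed
  finally show ?thesis by simp
qed

end

section \<open>Thompson sampling in a constant state\<close>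

text \<open>
  \<open>vs\<close> is the largest expected rate in state \<open>a\<close>. After \<open>J\<close> transmissions the posterior of an arm is
  concentrated well enough to resolve differences of order \<open>e0\<close> in the expected rate.
\<close>

locale clean_bandit = clean_run R r \<theta> Q w F b h a m
  for R :: nat and r :: "nat \<Rightarrow> real" and \<theta> :: "nat \<Rightarrow> nat \<Rightarrow> real" and Q w F :: nat and b :: real
    and h :: "nat \<Rightarrow> nat" and a m :: nat +
  fixes J :: nat and e0 vs :: real and i0 :: nat
  assumes J: "1 \<le> J" and e0: "0 < e0" "e0 < vs"
    and vs_max: "\<And>i. i \<in> {1..R} \<Longrightarrow> r i * \<theta> a i \<le> vs"
    and vs_gap: "\<And>i. i \<in> {1..R} \<Longrightarrow> r i * \<theta> a i < vs \<Longrightarrow> r i * \<theta> a i \<le> vs - 2 * e0"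
    and i0: "i0 \<in> {1..R}" "r i0 * \<theta> a i0 = vs"
begin

text \<open>The resolution for success probabilities: by \<open>two_ep_le\<close>, a shift by 2
  \<open>ep\<close> moves the expected rate of any arm by at most \<open>e0\<close>.\<close>

definition ep :: real where "ep = e0 / (2 * r R)"

definition del :: real where "del = real (m + 1) * exp (- (real J * ep\<^sup>2))"

definition emp_bad :: "nat \<Rightarrow> history \<Rightarrow> bool" where
  "emp_bad k hs \<longleftrightarrow> J \<le> transmissions k hs \<and>
     ep * real (transmissions k hs) \<le> \<bar>real (successes k hs) - \<theta> a k * real (transmissions k hs)\<bar>"

lemma r_R: "0 < r R"
  using R by (intro r_pos) auto

lemma ep_pos: "0 < ep"
  using e0 r_R by (simp add: ep_def)

lemma del_pos: "0 < del"
  by (simp add: del_def)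

lemma two_ep_le: "k \<in> {1..R} \<Longrightarrow> 2 * ep \<le> e0 / r k"
  using r_le[of k] r_pos[of k] e0 r_R by (simp add: ep_def divide_left_mono)

lemma EE_emp_bad:
  assumes "n \<le> m" "k \<in> {1..R}"
  shows "EE h n (\<lambda>hs. of_bool (emp_bad k hs)) \<le> 2 * del"
proof -
  let ?g = "\<lambda>j hs. of_bool (transmissions k hs = j \<and> ep * real j \<le> \<bar>weighted_sum h k (\<lambda>_. 1) hs\<bar>) :: real"
  have "EE h n (\<lambda>hs. of_bool (emp_bad k hs)) \<le> EE h n (\<lambda>hs. \<Sum>j\<in>{J..n}. ?g j hs)"
  proof (intro EE_mono)
    fix hs assume hs: "hs \<in> hists n"
    show "of_bool (emp_bad k hs) \<le> (\<Sum>j\<in>{J..n}. ?g j hs)"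
    proof (cases "emp_bad k hs")
      case True
      have "transmissions k hs \<in> {J..n}"
        using True transmissions_le_length[of k hs] hists_length[OF hs] by (simp add: emp_bad_def)
      then have "?g (transmissions k hs) hs \<le> (\<Sum>j\<in>{J..n}. ?g j hs)"
        by (intro member_le_sum) auto
      moreover have "?g (transmissions k hs) hs = 1"
        using True hists_length[OF hs] assms(1) by (simp add: emp_bad_def weighted_sum_const)
      ultimately show ?thesis using True by simp
    qed (auto intro!: sum_nonneg simp del: sum_of_bool_eq)
  qed
  also have "\<dots> \<le> (\<Sum>j\<in>{J..n}. 2 * exp (- (real J * ep\<^sup>2)))"
    unfolding EE_sum
  proof (intro sum_mono)
    fix j assume j: "j \<in> {J..n}"
    have "EE h n (?g j) \<le> 2 * exp (- (2 * (ep * real j)\<^sup>2 / real j))"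
      using assms(2) ep_pos J j by (intro weighted_sum_tail h) auto
    also have "2 * (ep * real j)\<^sup>2 / real j = 2 * (real j * ep\<^sup>2)"
      using J j by (simp add: power2_eq_square)
    also have "exp (- (2 * (real j * ep\<^sup>2))) \<le> exp (- (real J * ep\<^sup>2))"
    proof -
      have "real J * ep\<^sup>2 \<le> real j * ep\<^sup>2" using j by (intro mult_right_mono) auto
      moreover have "0 \<le> real j * ep\<^sup>2" by simp
      ultimately show ?thesis by (subst exp_le_cancel_iff) linarith
    qed
    finally show "EE h n (?g j) \<le> 2 * exp (- (real J * ep\<^sup>2))" by simp
  qed
  also have "\<dots> \<le> real (m + 1) * (2 * exp (- (real J * ep\<^sup>2)))"
    unfolding sum_constant using assms by (intro mult_right_mono) auto
  finally show ?thesis by (simp add: del_def)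
qed

lemma tail_le_del:
  assumes "J \<le> transmissions k hs" "length hs \<le> m"
  shows "real (transmissions k hs + 1) * exp (- (real (transmissions k hs) * ep\<^sup>2)) \<le> del"
  unfolding del_def
proof (intro mult_mono)
  show "real (transmissions k hs + 1) \<le> real (m + 1)"
    using transmissions_le_length[of k hs] assms by simp
  show "exp (- (real (transmissions k hs) * ep\<^sup>2)) \<le> exp (- (real J * ep\<^sup>2))"
    using assms by (auto intro: mult_right_mono)
qed auto

text \<open>Half of the margin 2 \<open>ep\<close> covers the deviation of the empirical mean, the
  other half the posterior spread.\<close>

lemma arm_prob_small:
  assumes "J \<le> transmissions k hs" "length hs \<le> m" "\<not> emp_bad k hs" "\<theta> a k + 2 * ep \<le> y"
  shows "arm_prob k y hs \<le> del"
proof -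
  let ?N = "real (transmissions k hs)"
  have "real (successes k hs) \<le> ?N * (\<theta> a k + ep)"
    using assms(1,3) by (auto simp: emp_bad_def algebra_simps)
  also have "\<dots> \<le> ?N * (y - ep)"
    using assms(4) by (intro mult_left_mono) auto
  finally have "arm_prob k y hs \<le> real (transmissions k hs + 1) * exp (- (?N * ep\<^sup>2))"
    using upper_prob_tail[OF ep_pos] by (simp add: arm_prob_def transmissions_eq)
  then show ?thesis using tail_le_del[OF assms(1,2)] by linarith
qed

lemma arm_prob_large:
  assumes "k \<in> {1..R}" "J \<le> transmissions k hs" "length hs \<le> m" "\<not> emp_bad k hs" "0 \<le> y" "y \<le> \<theta> a k - 2 * ep"
  shows "1 - arm_prob k y hs \<le> del"
proof -
  let ?N = "real (transmissions k hs)"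
  have "?N * (y + ep) \<le> ?N * (\<theta> a k - ep)"
    using assms(6) by (intro mult_left_mono) auto
  also have "\<dots> \<le> real (successes k hs)"
    using assms(2,4) by (auto simp: emp_bad_def algebra_simps)
  finally have "1 - arm_prob k y hs \<le> real (transmissions k hs + 1) * exp (- (?N * ep\<^sup>2))"
    using lower_prob_tail[OF ep_pos, of y] assms(5,6) ep_pos less_1[OF assms(1)]
    by (simp add: arm_prob_def transmissions_eq)
  then show ?thesis using tail_le_del[OF assms(2,3)] by linarith
qed

lemma level_below:
  assumes "i \<in> {1..R}" "r i * \<theta> a i = vs"
  shows "(vs - e0) / r i = \<theta> a i - e0 / r i" "0 < (vs - e0) / r i"
  using assms r_pos[OF assms(1)] e0 by (auto simp: field_simps)

text \<open>The comparison level is \<open>vs - e0\<close>, at distance at least \<open>e0\<close>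
  from both expected rates. If i0 has been used often, concentration decides. Otherwise the choice
  of k is charged to a choice of i0 through \<open>pmf_thompson_le_odds\<close>, and
  \<open>inverse_arm_prob_le\<close> bounds the price.\<close>

lemma pmf_suboptimal:
  assumes k: "k \<in> {1..R}" "r k * \<theta> a k < vs" and hs: "length hs \<le> m" "alive hs" "\<not> F dvd Suc (length hs)"
  shows "pmf (pol hs) k \<le> of_bool (transmissions k hs < J) * pmf (pol hs) k +
    of_bool (emp_bad k hs) + of_bool (emp_bad i0 hs) + 2 * del +
    real (J + 1) * r i0 / e0 * (of_bool (transmissions i0 hs < J) * pmf (pol hs) i0 * lik_ratio 0 i0 hs)"
proof -
  have tp: "pol hs = thompson_pmf R r hs"
    using pol_alive[OF hs(2)] hs(3) by simp
  have L: "0 \<le> real (J + 1) * r i0 / e0 * (of_bool (transmissions i0 hs < J) * pmf (pol hs) i0 * lik_ratio 0 i0 hs)"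
    using e0 r_pos[OF i0(1)] lik_ratio_nonneg[OF i0(1), of 0 hs]
    by (intro mult_nonneg_nonneg divide_nonneg_nonneg) auto
  have p1: "pmf (pol hs) k \<le> 1" by (rule pmf_le_1)
  show ?thesis
  proof (cases "transmissions k hs < J \<or> emp_bad k hs \<or> emp_bad i0 hs")
    case True
    then show ?thesis using L p1 del_pos by auto
  next
    case False
    let ?v = "vs - e0"
    have "\<theta> a k + 2 * ep \<le> ?v / r k"
    proof -
      have "r k * (\<theta> a k + e0 / r k) \<le> ?v"
        using vs_gap[OF k] r_pos[OF k(1)] by (simp add: algebra_simps)
      then have "\<theta> a k + e0 / r k \<le> ?v / r k"
        using r_pos[OF k(1)] by (simp add: pos_le_divide_eq mult.commute)
      then show ?thesis using two_ep_le[OF k(1)] by linarith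
    qed
    then have ak: "arm_prob k (?v / r k) hs \<le> del"
      using False hs by (intro arm_prob_small) auto
    show ?thesis
    proof (cases "J \<le> transmissions i0 hs")
      case True
      have "1 - arm_prob i0 (?v / r i0) hs \<le> del"
        using False hs True i0 level_below[OF i0] two_ep_le[OF i0(1)]
        by (intro arm_prob_large) auto
      then show ?thesis
        using pmf_thompson_le_above_below[OF k(1) i0(1), of hs ?v] ak False True tp by simp
    next
      case N: False
      have y: "0 \<le> ?v / r i0" "?v / r i0 < \<theta> a i0"
        using level_below[OF i0] e0 r_pos[OF i0(1)] by (auto simp del: zero_less_divide_iff)
      have d: "\<theta> a i0 - ?v / r i0 = e0 / r i0"
        using level_below[OF i0] by simp
      let ?q = "arm_prob i0 (?v / r i0) hs"
      have "1 / ?q \<le> real (transmissions i0 hs + 1) / (e0 / r i0) * lik_ratio 0 i0 hs"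
        using inverse_arm_prob_le(2)[OF i0(1) y, of hs] unfolding d .
      also have "\<dots> \<le> real (J + 1) / (e0 / r i0) * lik_ratio 0 i0 hs"
        using N e0 r_pos[OF i0(1)] lik_ratio_nonneg[OF i0(1), of 0 hs]
        by (intro mult_right_mono divide_right_mono) auto
      finally have "pmf (pol hs) i0 * (1 / ?q) \<le> pmf (pol hs) i0 * (real (J + 1) / (e0 / r i0) * lik_ratio 0 i0 hs)"
        by (intro mult_left_mono) auto
      then have "pmf (pol hs) i0 / ?q \<le> real (J + 1) * r i0 / e0 * (of_bool (transmissions i0 hs < J) * pmf (pol hs) i0 * lik_ratio 0 i0 hs)"
        using N by (simp add: mult_ac)
      then show ?thesis
        using pmf_thompson_le_odds[OF k(1) i0(1) inverse_arm_prob_le(1)[OF i0(1) y], of hs] ak False tp del_pos by simp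
    qed
  qed
qed

text \<open>Each term of \<open>pmf_suboptimal\<close> has a bounded sum; the charge to i0
  contributes order J^2, which is the squared logarithm lost per cycle.\<close>

lemma sum_suboptimal_le:
  assumes k: "k \<in> {1..R}" "r k * \<theta> a k < vs" and n: "n \<le> m"
  shows "(\<Sum>t<n. EE h t (\<lambda>hs. of_bool (alive hs \<and> \<not> F dvd Suc t) * pmf (pol hs) k)) \<le>
    real J + real (J + 1) * r i0 / e0 * real J + 6 * real n * del"
proof -
  let ?c = "real (J + 1) * r i0 / e0"
  have "(\<Sum>t<n. EE h t (\<lambda>hs. of_bool (alive hs \<and> \<not> F dvd Suc t) * pmf (pol hs) k)) \<le>
    (\<Sum>t<n. EE h t (\<lambda>hs. of_bool (transmissions k hs < J) * pmf (pol hs) k) + EE h t (\<lambda>hs. of_bool (emp_bad k hs)) +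
       EE h t (\<lambda>hs. of_bool (emp_bad i0 hs)) + 2 * del +
       ?c * EE h t (\<lambda>hs. of_bool (transmissions i0 hs < J) * pmf (pol hs) i0 * lik_ratio 0 i0 hs))"
  proof (intro sum_mono)
    fix t assume t: "t \<in> {..<n}"
    have "EE h t (\<lambda>hs. of_bool (alive hs \<and> \<not> F dvd Suc t) * pmf (pol hs) k) \<le>
       EE h t (\<lambda>hs. of_bool (transmissions k hs < J) * pmf (pol hs) k + of_bool (emp_bad k hs) +
       of_bool (emp_bad i0 hs) + 2 * del + ?c * (of_bool (transmissions i0 hs < J) * pmf (pol hs) i0 * lik_ratio 0 i0 hs))"
    proof (intro EE_mono)
      fix hs assume hs: "hs \<in> hists t"
      let ?r = "of_bool (transmissions k hs < J) * pmf (pol hs) k + of_bool (emp_bad k hs) +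
       of_bool (emp_bad i0 hs) + 2 * del + ?c * (of_bool (transmissions i0 hs < J) * pmf (pol hs) i0 * lik_ratio 0 i0 hs)"
      have "0 \<le> ?r"
        using e0 r_pos[OF i0(1)] lik_ratio_nonneg[OF i0(1), of 0 hs] del_pos
        by (intro add_nonneg_nonneg mult_nonneg_nonneg divide_nonneg_nonneg) auto
      moreover have "pmf (pol hs) k \<le> ?r" if "alive hs" "\<not> F dvd Suc t"
        by (rule pmf_suboptimal[OF k]) (use that hists_length[OF hs] t n in auto)
      ultimately show "of_bool (alive hs \<and> \<not> F dvd Suc t) * pmf (pol hs) k \<le> ?r"
        by (intro of_bool_mult_le) auto
    qed
    also have "\<dots> = EE h t (\<lambda>hs. of_bool (transmissions k hs < J) * pmf (pol hs) k) + EE h t (\<lambda>hs. of_bool (emp_bad k hs)) +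
       EE h t (\<lambda>hs. of_bool (emp_bad i0 hs)) + 2 * del +
       ?c * EE h t (\<lambda>hs. of_bool (transmissions i0 hs < J) * pmf (pol hs) i0 * lik_ratio 0 i0 hs)"
      by (simp only: EE_add EE_cmult EE_const)
    finally show "EE h t (\<lambda>hs. of_bool (alive hs \<and> \<not> F dvd Suc t) * pmf (pol hs) k) \<le> \<dots>" .
  qed
  also have "\<dots> \<le> real J + real n * (2 * del) + real n * (2 * del) + real n * (2 * del) + ?c * real J"
    unfolding sum.distrib sum_distrib_left[symmetric]
  proof (intro add_mono mult_left_mono)
    show "(\<Sum>t<n. EE h t (\<lambda>hs. of_bool (emp_bad k hs))) \<le> real n * (2 * del)"
      using sum_bounded_above[of "{..<n}" "\<lambda>t. EE h t (\<lambda>hs. of_bool (emp_bad k hs))" "2 * del"] EE_emp_bad[OF _ k(1)] n by simp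
    show "(\<Sum>t<n. EE h t (\<lambda>hs. of_bool (emp_bad i0 hs))) \<le> real n * (2 * del)"
      using sum_bounded_above[of "{..<n}" "\<lambda>t. EE h t (\<lambda>hs. of_bool (emp_bad i0 hs))" "2 * del"] EE_emp_bad[OF _ i0(1)] n by simp
  qed (use sum_plays_le[OF n k(1)] sum_plays_lik_ratio_le[OF n i0(1)] e0 r_pos[OF i0(1)] in \<open>auto\<close>)
  finally show ?thesis by (simp add: algebra_simps)
qed

subsection \<open>Rarely used rates\<close>

definition progress :: "history \<Rightarrow> real" where
  "progress hs = (\<Sum>l\<in>{1..R}. real (min (transmissions l hs) J))"

lemma progress_le: "progress hs \<le> real (R * J)"
  using sum_bounded_above[of "{1..R}" "\<lambda>l. real (min (transmissions l hs) J)" "real J"]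
  by (simp add: progress_def)

lemma progress_nonneg: "0 \<le> progress hs"
  by (simp add: progress_def sum_nonneg)

lemma progress_Cons:
  assumes "i \<in> {1..R}"
  shows "progress ((i, x) # hs) = progress hs + of_bool (transmissions i hs < J)"
proof -
  have "progress ((i, x) # hs) = real (min (transmissions i hs + 1) J) + (\<Sum>l\<in>{1..R} - {i}. real (min (transmissions l hs) J))"
    unfolding progress_def using assms by (subst sum.remove[of _ i]) (auto intro!: sum.cong)
  moreover have "progress hs = real (min (transmissions i hs) J) + (\<Sum>l\<in>{1..R} - {i}. real (min (transmissions l hs) J))"
    unfolding progress_def using assms by (subst sum.remove[of _ i]) auto
  ultimately show ?thesis by (auto simp: min_def)
qed

text \<open>
  While arm \<open>k\<close> is still rarely used and has probability at least \<open>\<eta>\<close> of a sample above the level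
  \<open>vs + e0\<close>, every slot has probability about \<open>\<eta>\<close> that the winner is one of the arms with fewer
  than \<open>J\<close> transmissions, and this can happen at most \<open>R * J\<close> times.
\<close>

lemma EE_rare_not_reached:
  assumes k: "k \<in> {1..R}" and wJ: "w < J" and n: "n \<le> m"
    and z: "0 < z" "z \<le> 1" and \<eta>: "0 < \<eta>" "\<eta> \<le> 1" "2 * real R * del \<le> \<eta>"
  shows "EE h n (\<lambda>hs. of_bool (alive hs \<and> transmissions k hs \<le> w \<and> \<not> reached k ((vs + e0) / r k) \<eta> hs) * exp (- (z * progress hs)))
    \<le> (1 - z * \<eta> / 4) ^ (n - n div F) + 2 * real n * real R * del"
  using n
proof (induction n)
  case 0
  then show ?case using progress_def[of "[]"] by (simp add: z)
next
  case (Suc n)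
  let ?x = "z * \<eta> / 4"
  let ?y = "(vs + e0) / r k"
  let ?ind = "\<lambda>hs. alive hs \<and> transmissions k hs \<le> w \<and> \<not> reached k ?y \<eta> hs"
  let ?W = "\<lambda>hs. of_bool (?ind hs) * exp (- (z * progress hs))"
  have x: "0 \<le> ?x" "?x \<le> 1" using z \<eta> mult_le_one[of z \<eta>] by auto
  have W1: "?W hs \<le> 1" for hs
    using z mult_nonneg_nonneg[OF _ progress_nonneg[of hs], of z] by auto
  have Cons_le: "?W ((i, x) # hs) \<le> ?W hs * exp (- (z * of_bool (transmissions i hs < J)))" if "i \<in> {1..R}" for i x hs
    using that by (auto simp: alive_Cons reached_Cons progress_Cons algebra_simps exp_add[symmetric] split: if_splits)
  have stepW: "step (h (Suc n)) hs ?W \<le> ?W hs * (\<Sum>i\<in>{1..R}. pmf (pol hs) i * exp (- (z * of_bool (transmissions i hs < J))))" for hs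
  proof -
    have "step (h (Suc n)) hs ?W \<le> step (h (Suc n)) hs (\<lambda>g. ?W hs * exp (- (z * of_bool (transmissions (fst (hd g)) hs < J))))"
      using Cons_le by (intro step_mono chanD h) simp
    also have "\<dots> = (\<Sum>i\<in>{1..R}. pmf (pol hs) i * (?W hs * exp (- (z * of_bool (transmissions i hs < J)))))"
      by (rule step_arm_eq) simp
    finally show ?thesis by (simp add: sum_distrib_left mult_ac)
  qed
  have step_le: "step (h (Suc n)) hs ?W \<le> ?W hs" for hs
  proof -
    have "(\<Sum>i\<in>{1..R}. pmf (pol hs) i * exp (- (z * of_bool (transmissions i hs < J)))) \<le> (\<Sum>i\<in>{1..R}. pmf (pol hs) i * 1)"
      using z by (intro sum_mono mult_left_mono) auto
    then show ?thesis
      using stepW[of hs] sum_pol[of hs] mult_left_mono[of _ 1 "?W hs"] by fastforce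
  qed
  show ?case
  \<comment> \<open>Forced slots guarantee no progress and are left out of the exponent n - n div
    F.\<close>
  proof (cases "F dvd Suc n")
    case True
    have "EE h (Suc n) ?W \<le> EE h n ?W"
      unfolding EE_Suc[OF h] by (intro EE_mono step_le)
    moreover have "Suc n - Suc n div F = n - n div F"
      using True F_ge by (auto simp: div_Suc dvd_eq_mod_eq_0)
    moreover have "2 * real n * real R * del \<le> 2 * real (Suc n) * real R * del"
      using del_pos by (intro mult_right_mono) auto
    moreover have "EE h n ?W \<le> (1 - ?x) ^ (n - n div F) + 2 * real n * real R * del"
      using Suc by simp
    ultimately show ?thesis by (simp del: of_nat_Suc)
  next
    case False
    have main: "step (h (Suc n)) hs ?W \<le> (1 - ?x) * ?W hs + (\<Sum>l\<in>{1..R}. of_bool (emp_bad l hs))" if hs: "hs \<in> hists n" for hs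
    proof (cases "?ind hs \<and> (\<forall>l\<in>{1..R}. \<not> emp_bad l hs)")
      case True
      let ?A = "{l \<in> {1..R}. transmissions l hs < J}"
      have tp: "pol hs = thompson_pmf R r hs"
        using pol_alive[of hs] True \<open>\<not> F dvd Suc n\<close> hists_length[OF hs] by simp
      have "\<eta> < arm_prob k ?y hs"
        using True by (auto simp: reached_def not_le dest: spec[of _ 0])
      also have "\<dots> \<le> (\<Sum>l\<in>?A. pmf (pol hs) l) + (\<Sum>l\<in>{1..R} - ?A. arm_prob l ((vs + e0) / r l) hs)"
        unfolding tp using True k wJ by (intro arm_prob_le_progress) auto
      also have "(\<Sum>l\<in>{1..R} - ?A. arm_prob l ((vs + e0) / r l) hs) \<le> (\<Sum>l\<in>{1..R} - ?A. del)"
      proof (intro sum_mono)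
        fix l assume l: "l \<in> {1..R} - ?A"
        then have l': "l \<in> {1..R}" "J \<le> transmissions l hs" by auto
        have "\<theta> a l + e0 / r l \<le> (vs + e0) / r l"
          using vs_max[OF l'(1)] r_pos[OF l'(1)] by (simp add: pos_le_divide_eq add_divide_distrib mult.commute)
        then show "arm_prob l ((vs + e0) / r l) hs \<le> del"
          using True l' hists_length[OF hs] Suc.prems two_ep_le[OF l'(1)] by (intro arm_prob_small) auto
      qed
      also have "\<dots> \<le> (\<Sum>l\<in>{1..R}. del)"
        using del_pos by (intro sum_mono2) auto
      \<comment> \<open>The often used arms account for at most \<open>real R * del\<close>, hence
        for at most half of \<eta>. This half and the bound z / 2 for 1 - exp (- z) make up the 1/4
        in the decay rate.\<close>
      finally have P: "\<eta> / 2 \<le> (\<Sum>l\<in>?A. pmf (pol hs) l)"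
        using \<eta>(3) by simp
      have ez: "z / 2 \<le> 1 - exp (- z)"
      proof -
        have "exp (- z) \<le> 1 / (1 + z)"
          using z exp_ge_add_one_self[of z] by (simp add: exp_minus inverse_eq_divide frac_le)
        also have "\<dots> \<le> 1 - z / 2"
        proof -
          have "z * z \<le> z * 1"
            using z by (intro mult_left_mono) auto
          then have "1 \<le> (1 - z / 2) * (1 + z)"
            by (simp add: algebra_simps)
          then show ?thesis
            using z by (subst pos_divide_le_eq) auto
        qed
        finally show ?thesis by simp
      qed
      have "(\<Sum>i\<in>{1..R}. pmf (pol hs) i * exp (- (z * of_bool (transmissions i hs < J)))) =
         (\<Sum>i\<in>{1..R}. pmf (pol hs) i - (1 - exp (- z)) * (if transmissions i hs < J then pmf (pol hs) i else 0))"
        by (intro sum.cong) (auto simp: algebra_simps)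
      also have "\<dots> = 1 - (1 - exp (- z)) * (\<Sum>l\<in>?A. pmf (pol hs) l)"
        unfolding sum_subtractf sum_distrib_left[symmetric] sum_pol
        by (subst sum.inter_filter) auto
      also have "\<dots> \<le> 1 - z / 2 * (\<eta> / 2)"
        using ez P z \<eta> by (intro diff_left_mono mult_mono) auto
      finally have "?W hs * (\<Sum>i\<in>{1..R}. pmf (pol hs) i * exp (- (z * of_bool (transmissions i hs < J)))) \<le> ?W hs * (1 - ?x)"
        by (intro mult_left_mono) auto
      moreover have "0 \<le> (\<Sum>l\<in>{1..R}. of_bool (emp_bad l hs) :: real)"
        by (intro sum_nonneg) auto
      ultimately show ?thesis
        using stepW[of hs] unfolding mult.commute[of "1 - ?x"] by linarith
    next
      case no: False
      show ?thesis
      proof (cases "?ind hs")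
        case True
        then obtain l where l: "l \<in> {1..R}" "emp_bad l hs" using no by blast
        have "of_bool (emp_bad l hs) \<le> (\<Sum>l\<in>{1..R}. of_bool (emp_bad l hs) :: real)"
          using l by (intro member_le_sum) auto
        then have "1 \<le> (\<Sum>l\<in>{1..R}. of_bool (emp_bad l hs) :: real)" using l by simp
        moreover have "?x * ?W hs \<le> 1"
          by (rule mult_le_one[OF x(2) _ W1]) simp
        moreover have "(1 - ?x) * ?W hs = ?W hs - ?x * ?W hs" by (simp add: left_diff_distrib)
        ultimately show ?thesis using step_le[of hs] by linarith
      next
        case False
        then have "of_bool (?ind hs) = (0::real)" by (subst of_bool_eq_0_iff)
        then have W0: "?W hs = 0" by (simp only: mult_zero_left)
        moreover have "(1 - ?x) * ?W hs = 0" by (simp only: W0 mult_zero_right)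
        moreover have "0 \<le> (\<Sum>l\<in>{1..R}. of_bool (emp_bad l hs) :: real)"
          by (intro sum_nonneg) auto
        ultimately show ?thesis using step_le[of hs] by linarith
      qed
    qed
    have "EE h (Suc n) ?W \<le> EE h n (\<lambda>hs. (1 - ?x) * ?W hs + (\<Sum>l\<in>{1..R}. of_bool (emp_bad l hs)))"
      unfolding EE_Suc[OF h] by (intro EE_mono main)
    also have "\<dots> = (1 - ?x) * EE h n ?W + (\<Sum>l\<in>{1..R}. EE h n (\<lambda>hs. of_bool (emp_bad l hs)))"
      by (simp only: EE_add EE_cmult EE_sum)
    also have "\<dots> \<le> (1 - ?x) * ((1 - ?x) ^ (n - n div F) + 2 * real n * real R * del) + (\<Sum>l\<in>{1..R}. 2 * del)"
      using Suc x by (intro add_mono mult_left_mono sum_mono EE_emp_bad) auto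
    also have "\<dots> \<le> (1 - ?x) ^ Suc (n - n div F) + 2 * real (Suc n) * real R * del"
    proof -
      have "(1 - ?x) * (2 * real n * real R * del) \<le> 1 * (2 * real n * real R * del)"
        using x del_pos by (intro mult_right_mono) auto
      then show ?thesis by (simp add: algebra_simps)
    qed
    also have "Suc (n - n div F) = Suc n - Suc n div F"
      using False div_le_dividend[of n F] by (simp add: div_Suc dvd_eq_mod_eq_0 Suc_diff_le)
    finally show ?thesis .
  qed
qed

text \<open>Either the posterior has been at most \<eta> before, and then the likelihood ratio
  controls its present size up to the factor w + 1; or it never was, and then m slots of progress
  would have to fit below R * J. Removing the exponential weight costs exp (z R J).\<close>

lemma EE_rare_arm_prob:
  assumes k: "k \<in> {1..R}" and lv: "vs + e0 < r k" and wJ: "w < J"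
    and z: "0 < z" "z \<le> 1" and \<eta>: "0 < \<eta>" "\<eta> \<le> 1" "2 * real R * del \<le> \<eta>"
  shows "EE h m (\<lambda>hs. of_bool (alive hs \<and> transmissions k hs \<le> w) * arm_prob k ((vs + e0) / r k) hs) \<le>
    real (w + 1) * \<eta> + exp (z * real (R * J)) * (exp (- (z * \<eta> / 4 * real (m - m div F))) + 2 * real m * real R * del)"
proof -
  let ?y = "(vs + e0) / r k"
  let ?ind = "\<lambda>hs. alive hs \<and> transmissions k hs \<le> w \<and> \<not> reached k ?y \<eta> hs"
  let ?W = "\<lambda>hs. of_bool (?ind hs) * exp (- (z * progress hs))"
  have y: "0 \<le> ?y" "?y \<le> 1"
    using e0 lv r_pos[OF k] by auto
  have "EE h m (\<lambda>hs. of_bool (alive hs \<and> transmissions k hs \<le> w) * arm_prob k ?y hs) \<le>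
     EE h m (\<lambda>hs. real (w + 1) * (of_bool (reached k ?y \<eta> hs) * lik_ratio ?y k hs) + exp (z * real (R * J)) * ?W hs)"
  proof (intro EE_mono)
    fix hs
    have ap: "arm_prob k ?y hs \<le> 1" by (rule arm_prob_le_1)
    have L: "0 \<le> lik_ratio ?y k hs" by (intro lik_ratio_nonneg k y)
    have W: "of_bool (?ind hs) \<le> exp (z * real (R * J)) * ?W hs"
    proof -
      have "0 \<le> z * real (R * J) + - (z * progress hs)"
        using z mult_left_mono[OF progress_le[of hs], of z] by simp
      then have "1 \<le> exp (z * real (R * J)) * exp (- (z * progress hs))"
        unfolding exp_add[symmetric] by simp
      then show ?thesis by auto
    qed
    show "of_bool (alive hs \<and> transmissions k hs \<le> w) * arm_prob k ?y hs \<le>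
       real (w + 1) * (of_bool (reached k ?y \<eta> hs) * lik_ratio ?y k hs) + exp (z * real (R * J)) * ?W hs"
    proof (cases "alive hs \<and> transmissions k hs \<le> w \<and> reached k ?y \<eta> hs")
      case True
      have "arm_prob k ?y hs \<le> real (transmissions k hs + 1) * lik_ratio ?y k hs"
        by (intro arm_prob_le_lik_ratio k y)
      also have "\<dots> \<le> real (w + 1) * lik_ratio ?y k hs"
        using True L by (intro mult_right_mono) auto
      finally show ?thesis using True by simp
    next
      case False
      then have "of_bool (alive hs \<and> transmissions k hs \<le> w) * arm_prob k ?y hs \<le> of_bool (?ind hs)"
        using ap by auto
      then show ?thesis using W L by (auto intro: order_trans add_increasing)
    qed
  qed
  also have "\<dots> = real (w + 1) * EE h m (\<lambda>hs. of_bool (reached k ?y \<eta> hs) * lik_ratio ?y k hs) + exp (z * real (R * J)) * EE h m ?W"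
    by (simp only: EE_add EE_cmult)
  also have "\<dots> \<le> real (w + 1) * \<eta> + exp (z * real (R * J)) * ((1 - z * \<eta> / 4) ^ (m - m div F) + 2 * real m * real R * del)"
    using y k wJ z \<eta> by (intro add_mono mult_left_mono EE_reached_lik_ratio EE_rare_not_reached) auto
  also have "(1 - z * \<eta> / 4) ^ (m - m div F) \<le> exp (- (z * \<eta> / 4 * real (m - m div F)))"
  proof -
    have "z * \<eta> \<le> 1" using z \<eta> by (intro mult_le_one) auto
    then show ?thesis
      using one_plus_power_le_exp[of "- (z * \<eta> / 4)" "m - m div F"] by (simp add: mult.commute)
  qed
  finally show ?thesis by simp
qed

end

section \<open>Detection delay\<close>

lemma outcomes_append: "outcomes i (e @ g) = outcomes i e @ outcomes i g"
  by (simp add: outcomes_def)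

lemma transmissions_append: "transmissions i (e @ g) = transmissions i e + transmissions i g"
  by (simp add: transmissions_def outcomes_append del: length_outcomes)

lemma successes_append: "successes i (e @ g) = successes i e + successes i g"
  by (simp add: successes_def outcomes_append)

lemma failures_append: "failures i (e @ g) = failures i e + failures i g"
  by (simp add: failures_def outcomes_append)

lemma transmissions_drop_le: "transmissions i (drop n hs) \<le> transmissions i hs"
  using transmissions_append[of i "take n hs" "drop n hs"] by simp

text \<open>Going back in time from a count above c to one of at most c, one passes the slot in
  which the count rose from c to c + 1.\<close>

lemma transmissions_crossing:
  assumes "n \<le> length hs" "c < transmissions k hs" "transmissions k (drop n hs) \<le> c"
  shows "\<exists>j x hs'. j < n \<and> drop j hs = (k, x) # hs' \<and> transmissions k hs' = c"
  using assms
proof (induction n arbitrary: hs)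
  case (Suc n)
  then obtain i x g where hs: "hs = (i, x) # g"
    by (cases hs) auto
  show ?case
  proof (cases "c < transmissions k g")
    case True
    then obtain j y hs' where j: "j < n" "drop j g = (k, y) # hs'" "transmissions k hs' = c"
      using Suc.IH[of g] Suc.prems hs by auto
    then show ?thesis unfolding hs by (intro exI[of _ "Suc j"] exI[of _ y] exI[of _ hs']) simp
  next
    case False
    then have "i = k \<and> transmissions k g = c"
      using Suc.prems hs by (cases "i = k") simp_all
    then show ?thesis unfolding hs by (intro exI[of _ 0] exI[of _ x] exI[of _ g]) simp
  qed
qed simp

lemma sum_transmissions:
  "fst ` set hs \<subseteq> {1..R} \<Longrightarrow> (\<Sum>l\<in>{1..R}. transmissions l hs) = length hs"
proof (induction hs)
  case (Cons p hs)
  obtain i x where p: "p = (i, x)" by (cases p)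
  have "(\<Sum>l\<in>{1..R}. of_bool (i = l)) = (1::nat)"
    using Cons.prems p by simp
  then show ?case
    using Cons p by (simp add: sum.distrib del: sum_of_bool_eq)
qed simp

context cdts_run
begin

text \<open>The first F - 1 slots of a cycle determine the forced rate for the whole cycle, so it
  gains one use at every multiple of F. Both sides are sums only to avoid truncated
  subtraction.\<close>

lemma forced_plays:
  assumes "hs \<in> set_pmf (history_pmf \<theta> h pol t)" "alive hs" "j \<le> t"
  shows "transmissions (empirical_best R r (slots 0 (F - 1) hs)) (drop j hs) + t div F \<le>
    transmissions (empirical_best R r (slots 0 (F - 1) hs)) hs + (t - j) div F"
  using assms
proof (induction t arbitrary: hs j)
  case (Suc t)
  from Suc.prems(1) obtain g i x where g: "g \<in> set_pmf (history_pmf \<theta> h pol t)" "i \<in> set_pmf (pol g)" "hs = (i, x) # g"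
    by auto
  have len: "length g = t"
    using g(1) set_history hists_length by blast
  have al: "alive g" using Suc.prems(2) g(3) by (simp add: alive_Cons)
  let ?e = "empirical_best R r (slots 0 (F - 1) hs)"
  show ?case
  \<comment> \<open>Up to slot F - 1 no forced slot has occurred and the forced rate may still
    change.\<close>
  proof (cases "j = 0 \<or> Suc t < F")
    case True
    then show ?thesis using transmissions_drop_le[of ?e j hs] by auto
  next
    case False
    then obtain j' where j: "j = Suc j'" by (cases j) auto
    have "slots 0 (F - 1) hs = slots 0 (F - 1) g"
    proof -
      have "Suc t - (F - 1) = Suc (t - (F - 1))"
        using False by linarith
      then show ?thesis
        using len by (simp add: slots_def g(3))
    qed
    then have e: "?e = empirical_best R r (slots 0 (F - 1) g)" by simp
    have IH: "transmissions ?e (drop j' g) + t div F \<le> transmissions ?e g + (t - j') div F"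
      unfolding e using Suc.IH[OF g(1) al, of j'] Suc.prems(3) j by simp
    have "Suc t div F + transmissions ?e g \<le> t div F + transmissions ?e hs"
    proof (cases "F dvd Suc t")
      case True
      then have "i = ?e"
        using g(2) pol_alive[OF al] len e by simp
      then show ?thesis
        using True F_ge by (simp add: g(3) div_Suc dvd_eq_mod_eq_0)
    next
      case False
      then show ?thesis
        by (simp add: g(3) div_Suc dvd_eq_mod_eq_0)
    qed
    then show ?thesis
      using IH j g(3) by simp
  qed
qed simp

lemma forced_plays_total:
  assumes "hs \<in> set_pmf (history_pmf \<theta> h pol t)" "alive hs"
  shows "t div F \<le> transmissions (empirical_best R r (slots 0 (F - 1) hs)) hs"
proof -
  have "length hs = t" using assms(1) set_history hists_length by blast
  then show ?thesis using forced_plays[OF assms, of t] by simp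
qed

lemma count_multiples: "card {t. t < n \<and> F dvd Suc t} = n div F"
proof (induction n)
  case (Suc n)
  have "{t. t < Suc n \<and> F dvd Suc t} = {t. t < n \<and> F dvd Suc t} \<union> (if F dvd Suc n then {n} else {})"
    by (auto simp: less_Suc_eq)
  then show ?case
    using Suc by (simp add: div_Suc dvd_eq_mod_eq_0 card_insert_if)
qed simp

lemma sum_multiples: "(\<Sum>t<n. of_bool (F dvd Suc t)) = real (n div F)"
  using count_multiples[of n] by (simp add: Int_def)

end

section \<open>Detection of a change of state after slot m\<close>

locale two_phase = clean_bandit R r \<theta> Q w F b h a m J e0 vs i0
  for R :: nat and r :: "nat \<Rightarrow> real" and \<theta> :: "nat \<Rightarrow> nat \<Rightarrow> real" and Q w F :: nat and b :: real
    and h :: "nat \<Rightarrow> nat" and a m J :: nat and e0 vs :: real and i0 :: nat +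
  fixes a' :: nat
  assumes a': "a' \<in> {1..Q}" and h_late: "\<And>t. m < t \<Longrightarrow> h t = a'"
    and b_pos: "0 < b" and sep: "\<And>i. i \<in> {1..R} \<Longrightarrow> 2 * b \<le> \<bar>\<theta> a' i - \<theta> a i\<bar>"
    and m_large: "(w + 1) * F \<le> m"
begin

abbreviation past :: "history \<Rightarrow> history" where
  "past hs \<equiv> drop (length hs - m) hs"

text \<open>At the moment with exactly w new and more than w old outcomes, the two windows lie
  entirely in the new and in the old state, and the test requires more than 2 w outcomes.\<close>

definition miss :: "history \<Rightarrow> bool" where
  "miss hs \<longleftrightarrow> (\<exists>l\<in>{1..R}. w < transmissions l (past hs) \<and>
     transmissions l hs = transmissions l (past hs) + w \<and> \<bar>window_diff l hs\<bar> \<le> b)"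

lemma play_means_append:
  assumes "length g = m"
  shows "play_means h l (e @ g) = replicate (transmissions l e) (\<theta> a' l) @ play_means h l g"
proof (induction e)
  case (Cons p e)
  then show ?case using assms by (cases p) (auto simp: h_late)
qed simp

text \<open>The window means differ by at least 2 b, so a statistic of at most b is a deviation of
  at least b.\<close>

lemma EE_miss:
  assumes n: "m \<le> n"
  shows "EE h n (\<lambda>hs. of_bool (miss hs)) \<le> real R * (real (n + 1) * (2 * exp (- (real w * b\<^sup>2))))"
proof -
  have "EE h n (\<lambda>hs. of_bool (miss hs)) \<le> EE h n (\<lambda>hs. \<Sum>i\<in>{1..R}. of_bool (2 * w \<le> transmissions i hs \<and> b \<le> \<bar>weighted_sum h i (window w (transmissions i hs)) hs\<bar>))"
  proof (intro EE_mono)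
    fix hs assume hs: "hs \<in> hists n"
    let ?g = "\<lambda>i. of_bool (2 * w \<le> transmissions i hs \<and> b \<le> \<bar>weighted_sum h i (window w (transmissions i hs)) hs\<bar>) :: real"
    show "of_bool (miss hs) \<le> (\<Sum>i\<in>{1..R}. ?g i)"
    proof (cases "miss hs")
      case True
      then obtain l where l: "l \<in> {1..R}" "w < transmissions l (past hs)"
          "transmissions l hs = transmissions l (past hs) + w" "\<bar>window_diff l hs\<bar> \<le> b"
        by (auto simp: miss_def)
      define e where "e = take (length hs - m) hs"
      have eg: "hs = e @ past hs" by (simp add: e_def)
      have g: "length (past hs) = m" using n hists_length[OF hs] by simp
      have Ne: "transmissions l e = w"
        using l(3) transmissions_append[of l e "past hs"] eg by simp
      have pm: "play_means h l hs = replicate w (\<theta> a' l) @ play_means h l (past hs)"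
        using play_means_append[OF g, of l e] eg Ne by simp
      have "play_means h l hs ! k - play_means h l hs ! (w + k) = \<theta> a' l - \<theta> a l" if "k < w" for k
        using that l(2) g by (simp add: pm nth_append play_means_clean)
      then have "(\<Sum>k<w. play_means h l hs ! k - play_means h l hs ! (w + k)) / real w = \<theta> a' l - \<theta> a l"
        using w_pos by simp
      moreover have "2 * w \<le> transmissions l hs"
        using l by simp
      ultimately have "?g l = 1"
        using l(4) sep[OF l(1)] by (simp add: weighted_sum_window)
      moreover have "?g l \<le> (\<Sum>i\<in>{1..R}. ?g i)"
        using l(1) by (intro member_le_sum) auto
      ultimately show ?thesis using True by simp
    qed (auto intro!: sum_nonneg simp del: sum_of_bool_eq)
  qed
  also have "\<dots> \<le> (\<Sum>i\<in>{1..R}. real (n + 1) * (2 * exp (- (real w * b\<^sup>2))))"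
    unfolding EE_sum by (intro sum_mono window_tail h b_pos)
  finally show ?thesis by simp
qed

text \<open>The w-th new use of l falls into one of the last n slots, and no alarm was raised in
  that slot.\<close>

lemma alive_imp_miss:
  assumes "length hs = m + n" "alive hs" "l \<in> {1..R}"
    and "w < transmissions l (drop n hs)" "transmissions l (drop n hs) + w \<le> transmissions l hs"
  shows "\<exists>j<n. miss (drop j hs)"
proof -
  let ?c = "transmissions l (drop n hs) + w - 1"
  have "?c < transmissions l hs" "transmissions l (drop n hs) \<le> ?c"
    using assms(5) w_pos by auto
  then obtain j x hs' where j: "j < n" "drop j hs = (l, x) # hs'" "transmissions l hs' = ?c"
    using transmissions_crossing[of n hs ?c l] assms(1) by auto
  have past: "past (drop j hs) = drop n hs"
    using assms(1) j(1) by simp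
  have N: "transmissions l (drop j hs) = transmissions l (drop n hs) + w"
    using j w_pos by simp
  have "alive (drop j hs)" by (rule alive_drop) fact
  then have "\<not> change_detected w b l (drop j hs)"
    unfolding j(2) by (simp add: alive_Cons)
  then have "\<bar>window_diff l (drop j hs)\<bar> \<le> b"
    using N assms(4) by (auto simp: change_detected_def)
  then have "miss (drop j hs)"
    unfolding miss_def past using N assms(3,4) by blast
  then show ?thesis using j(1) by blast
qed

lemma EE_drop_miss:
  assumes "n \<le> n'"
  shows "EE h (m + n) (\<lambda>hs. \<Sum>j<n. of_bool (miss (drop j hs))) \<le> real n * (real R * (real (m + n' + 1) * (2 * exp (- (real w * b\<^sup>2)))))"
proof -
  have "EE h (m + n) (\<lambda>hs. of_bool (miss (drop j hs))) \<le> real R * (real (m + n' + 1) * (2 * exp (- (real w * b\<^sup>2))))" if "j < n" for j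
  proof -
    have "EE h (m + n) (\<lambda>hs. of_bool (miss (drop j hs))) = EE h (m + (n - j)) (\<lambda>hs. of_bool (miss hs))"
      using EE_prefix[OF h, of "m + (n - j)" j "\<lambda>hs. of_bool (miss hs)"] that by simp
    also have "\<dots> \<le> real R * (real (m + (n - j) + 1) * (2 * exp (- (real w * b\<^sup>2))))"
      by (rule EE_miss) simp
    also have "\<dots> \<le> real R * (real (m + n' + 1) * (2 * exp (- (real w * b\<^sup>2))))"
      using assms by (intro mult_left_mono mult_right_mono) auto
    finally show ?thesis .
  qed
  then show ?thesis
    unfolding EE_sum
    using sum_bounded_above[of "{..<n}" "\<lambda>j. EE h (m + n) (\<lambda>hs. of_bool (miss (drop j hs)))"
      "real R * (real (m + n' + 1) * (2 * exp (- (real w * b\<^sup>2))))"] by simp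
qed

lemma forced_arm_used:
  assumes "hs \<in> set_pmf (history_pmf \<theta> h pol (m + n))" "alive hs"
  shows "w < transmissions (empirical_best R r (slots 0 (F - 1) hs)) (drop n hs)"
    and "transmissions (empirical_best R r (slots 0 (F - 1) hs)) (drop n hs) + (m + n) div F \<le>
      transmissions (empirical_best R r (slots 0 (F - 1) hs)) hs + m div F"
proof -
  have len: "length hs = m + n" using assms(1) set_history hists_length by blast
  show "transmissions (empirical_best R r (slots 0 (F - 1) hs)) (drop n hs) + (m + n) div F \<le>
      transmissions (empirical_best R r (slots 0 (F - 1) hs)) hs + m div F"
    using forced_plays[OF assms, of n] by simp
  have g: "drop n hs \<in> set_pmf (history_pmf \<theta> h pol m)"
    using assms(1)
  proof (induction n arbitrary: hs)
    case (Suc n)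
    then show ?case by auto
  qed simp
  have Fm: "F \<le> m" using m_large by simp
  have "slots 0 (F - 1) hs = slots 0 (F - 1) (drop n hs)"
    using len Fm by (simp add: slots_def)
  then have "m div F \<le> transmissions (empirical_best R r (slots 0 (F - 1) hs)) (drop n hs)"
    using forced_plays_total[OF g alive_drop[OF assms(2)]] by simp
  moreover have "w + 1 \<le> m div F"
    using m_large F_ge by (simp add: less_eq_div_iff_mult_less_eq)
  ultimately show "w < transmissions (empirical_best R r (slots 0 (F - 1) hs)) (drop n hs)"
    by simp
qed

text \<open>Any w F slots contain w forced ones, all with the same rate, and that rate was used more
  than w times in the old state.\<close>

lemma alive_prob_late:
  "alive_prob h (m + w * F) \<le> real (w * F) * (real R * (real (m + w * F + 1) * (2 * exp (- (real w * b\<^sup>2)))))"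
proof -
  let ?n = "w * F"
  have "alive_prob h (m + ?n) \<le> EE h (m + ?n) (\<lambda>hs. \<Sum>j<?n. of_bool (miss (drop j hs)))"
    unfolding alive_prob_def
  proof (intro EE_mono_support)
    fix hs assume hs: "hs \<in> set_pmf (history_pmf \<theta> h pol (m + ?n))"
    have len: "length hs = m + ?n" using hs set_history hists_length by blast
    show "of_bool (alive hs) \<le> (\<Sum>j<?n. of_bool (miss (drop j hs)) :: real)"
    proof (cases "alive hs")
      case True
      have "(m + w * F) div F = m div F + w" using F_ge by simp
      then obtain j where j: "j < ?n" "miss (drop j hs)"
        using alive_imp_miss[OF len True empirical_best_range forced_arm_used(1)[OF hs True]]
          forced_arm_used(2)[OF hs True] by auto
      then have "of_bool (miss (drop j hs)) \<le> (\<Sum>j<?n. of_bool (miss (drop j hs)) :: real)"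
        by (intro member_le_sum) auto
      then show ?thesis using j True by simp
    qed (auto intro!: sum_nonneg simp del: sum_of_bool_eq)
  qed
  also have "\<dots> \<le> real ?n * (real R * (real (m + ?n + 1) * (2 * exp (- (real w * b\<^sup>2)))))"
    by (rule EE_drop_miss) simp
  finally show ?thesis .
qed

text \<open>The factor 2 R: if the best arms together take half of the m slots, one of them takes m
  / (2 R).\<close>

definition heavy :: "nat \<Rightarrow> history \<Rightarrow> bool" where
  "heavy i g \<longleftrightarrow> i \<in> {1..R} \<and> r i * \<theta> a i = vs \<and> m \<le> 2 * R * transmissions i g"

definition no_heavy :: "history \<Rightarrow> bool" where
  "no_heavy g \<longleftrightarrow> alive g \<and> (\<forall>i. \<not> heavy i g)"

text \<open>Without a heavy arm the suboptimal arms have at least m / 2 transmissions. Markov's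
  inequality is applied to their expected number, which consists of the losses of Thompson sampling
  and at most m / F forced slots.\<close>

lemma EE_no_heavy:
  shows "EE h m (\<lambda>g. of_bool (no_heavy g)) \<le>
    2 / real m * (real R * (real J + real (J + 1) * r i0 / e0 * real J + 6 * real m * del)) + 2 / real F"
proof -
  let ?S = "{k \<in> {1..R}. r k * \<theta> a k < vs}"
  let ?D = "real J + real (J + 1) * r i0 / e0 * real J + 6 * real m * del"
  let ?f = "\<lambda>hs. of_bool (alive hs) * (\<Sum>k\<in>?S. real (transmissions k hs))"
  have D0: "0 \<le> ?D"
    using e0 r_pos[OF i0(1)] del_pos by (intro add_nonneg_nonneg mult_nonneg_nonneg divide_nonneg_nonneg) auto
  have m0: "0 < m"
    using m_large F_ge by (cases m) auto
  \<comment> \<open>The potential counts transmissions and grows, hence the negative drift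
    term.\<close>
  have "(\<Sum>t<m. EE h t (\<lambda>hs. - (of_bool (alive hs) * (\<Sum>k\<in>?S. pmf (pol hs) k)))) \<le> ?f [] - EE h m ?f"
  proof (rule EE_potential[OF h])
    fix t hs
    have "step (h (Suc t)) hs ?f \<le> step (h (Suc t)) hs (\<lambda>g. of_bool (alive hs) * ((\<Sum>k\<in>?S. real (transmissions k hs)) + of_bool (fst (hd g) \<in> ?S)))"
    proof (intro step_mono chanD[OF h])
      fix i x assume "i \<in> {1..R}"
      have "(\<Sum>k\<in>?S. real (transmissions k ((i, x) # hs))) = (\<Sum>k\<in>?S. real (transmissions k hs)) + (\<Sum>k\<in>?S. if k = i then 1 else 0)"
        unfolding sum.distrib[symmetric] by (intro sum.cong) auto
      also have "(\<Sum>k\<in>?S. if k = i then 1 else 0) = (of_bool (i \<in> ?S) :: real)"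
        by (subst sum.delta) auto
      finally show "?f ((i, x) # hs) \<le> of_bool (alive hs) * ((\<Sum>k\<in>?S. real (transmissions k hs)) + of_bool (fst (hd ((i, x) # hs)) \<in> ?S))"
        by (auto simp: alive_Cons intro!: sum_nonneg add_nonneg_nonneg)
    qed
    also have "\<dots> = (\<Sum>i\<in>{1..R}. pmf (pol hs) i * (of_bool (alive hs) * ((\<Sum>k\<in>?S. real (transmissions k hs)) + of_bool (i \<in> ?S))))"
      by (rule step_arm_eq) simp
    also have "\<dots> = of_bool (alive hs) * ((\<Sum>i\<in>{1..R}. pmf (pol hs) i) * (\<Sum>k\<in>?S. real (transmissions k hs)) + (\<Sum>i\<in>{1..R}. if r i * \<theta> a i < vs then pmf (pol hs) i else 0))"
    proof -
      define T where "T = (\<Sum>k\<in>?S. real (transmissions k hs))"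
      have "(\<Sum>i\<in>{1..R}. pmf (pol hs) i * (of_bool (alive hs) * (T + of_bool (i \<in> ?S)))) =
         (\<Sum>i\<in>{1..R}. of_bool (alive hs) * (pmf (pol hs) i * T + (if r i * \<theta> a i < vs then pmf (pol hs) i else 0)))"
        by (intro sum.cong) (auto simp: algebra_simps)
      then show ?thesis
        unfolding T_def[symmetric] by (simp only: sum_distrib_left[symmetric] sum.distrib sum_distrib_right)
    qed
    also have "\<dots> = ?f hs - - (of_bool (alive hs) * (\<Sum>k\<in>?S. pmf (pol hs) k))"
      unfolding sum_pol by (subst (2) sum.inter_filter) (auto simp: distrib_left)
    finally show "step (h (Suc t)) hs ?f \<le> ?f hs - - (of_bool (alive hs) * (\<Sum>k\<in>?S. pmf (pol hs) k))" .
  qed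
  then have "EE h m ?f \<le> (\<Sum>t<m. EE h t (\<lambda>hs. of_bool (alive hs) * (\<Sum>k\<in>?S. pmf (pol hs) k)))"
    using EE_cmult[of h _ "- 1"] by (simp add: sum_negf)
  also have "\<dots> \<le> (\<Sum>t<m. of_bool (F dvd Suc t) + (\<Sum>k\<in>?S. EE h t (\<lambda>hs. of_bool (alive hs \<and> \<not> F dvd Suc t) * pmf (pol hs) k)))"
  proof (intro sum_mono)
    fix t
    have "EE h t (\<lambda>hs. of_bool (alive hs) * (\<Sum>k\<in>?S. pmf (pol hs) k)) \<le>
      EE h t (\<lambda>hs. of_bool (F dvd Suc t) + (\<Sum>k\<in>?S. of_bool (alive hs \<and> \<not> F dvd Suc t) * pmf (pol hs) k))"
    proof (intro EE_mono)
      fix hs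
      have "(\<Sum>k\<in>?S. pmf (pol hs) k) \<le> (\<Sum>k\<in>{1..R}. pmf (pol hs) k)"
        by (intro sum_mono2) auto
      then have "(\<Sum>k\<in>?S. pmf (pol hs) k) \<le> 1" using sum_pol[of hs] by simp
      then show "of_bool (alive hs) * (\<Sum>k\<in>?S. pmf (pol hs) k) \<le> of_bool (F dvd Suc t) + (\<Sum>k\<in>?S. of_bool (alive hs \<and> \<not> F dvd Suc t) * pmf (pol hs) k)"
        unfolding sum_distrib_left[symmetric] by auto
    qed
    then show "EE h t (\<lambda>hs. of_bool (alive hs) * (\<Sum>k\<in>?S. pmf (pol hs) k)) \<le>
      of_bool (F dvd Suc t) + (\<Sum>k\<in>?S. EE h t (\<lambda>hs. of_bool (alive hs \<and> \<not> F dvd Suc t) * pmf (pol hs) k))"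
      by (simp only: EE_add EE_sum EE_const)
  qed
  also have "\<dots> = real (m div F) + (\<Sum>k\<in>?S. \<Sum>t<m. EE h t (\<lambda>hs. of_bool (alive hs \<and> \<not> F dvd Suc t) * pmf (pol hs) k))"
    unfolding sum.distrib sum_multiples by (subst sum.swap) simp
  also have "\<dots> \<le> real m / real F + (\<Sum>k\<in>?S. ?D)"
    by (intro add_mono sum_mono sum_suboptimal_le of_nat_div_le_of_nat) auto
  also have "(\<Sum>k\<in>?S. ?D) \<le> (\<Sum>k\<in>{1..R}. ?D)"
    using D0 by (intro sum_mono2) auto
  finally have E: "EE h m ?f \<le> real m / real F + real R * ?D" by simp
  have "EE h m (\<lambda>g. of_bool (no_heavy g)) \<le> EE h m (\<lambda>g. 2 / real m * ?f g)"
  proof (intro EE_mono)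
    fix g assume g: "g \<in> hists m"
    show "of_bool (no_heavy g) \<le> 2 / real m * ?f g"
    proof (cases "no_heavy g")
      case True
      let ?O = "{k \<in> {1..R}. r k * \<theta> a k = vs}"
      have "{1..R} = ?S \<union> ?O" using vs_max by force
      then have "(\<Sum>l\<in>{1..R}. real (transmissions l g)) = (\<Sum>l\<in>?S \<union> ?O. real (transmissions l g))"
        by (rule sum.cong) (rule refl)
      also have "\<dots> = (\<Sum>l\<in>?S. real (transmissions l g)) + (\<Sum>l\<in>?O. real (transmissions l g))"
        by (rule sum.union_disjoint) auto
      finally have "(\<Sum>l\<in>{1..R}. real (transmissions l g)) = (\<Sum>l\<in>?S. real (transmissions l g)) + (\<Sum>l\<in>?O. real (transmissions l g))" .
      moreover have "(\<Sum>l\<in>{1..R}. real (transmissions l g)) = real m"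
        using sum_transmissions[of g R] g by (simp add: hists_def flip: of_nat_sum)
      moreover have "(\<Sum>l\<in>?O. real (transmissions l g)) \<le> (\<Sum>l\<in>?O. real m / (2 * real R))"
      proof (intro sum_mono)
        fix l assume "l \<in> ?O"
        then have "2 * R * transmissions l g < m"
          using True by (auto simp: no_heavy_def heavy_def)
        then have "real (2 * R * transmissions l g) \<le> real m" by linarith
        then show "real (transmissions l g) \<le> real m / (2 * real R)"
          using R by (simp add: pos_le_divide_eq mult.commute)
      qed
      moreover have "(\<Sum>l\<in>?O. real m / (2 * real R)) \<le> (\<Sum>l\<in>{1..R}. real m / (2 * real R))"
        by (intro sum_mono2) auto
      moreover have "(\<Sum>l\<in>{1..R}. real m / (2 * real R)) = real m / 2"
        using R by simp
      ultimately have "real m / 2 \<le> (\<Sum>l\<in>?S. real (transmissions l g))" by linarith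
      then show ?thesis
        using True m0 by (simp add: no_heavy_def field_simps)
    qed (auto intro!: sum_nonneg mult_nonneg_nonneg divide_nonneg_nonneg)
  qed
  also have "\<dots> \<le> 2 / real m * (real m / real F + real R * ?D)"
    unfolding EE_cmult using E by (intro mult_left_mono) auto
  also have "\<dots> = 2 / real m * (real R * ?D) + 2 / real F"
    using m0 by (simp add: distrib_left)
  finally show ?thesis .
qed

text \<open>The equation between the two counts says that k has not been used since the change, so
  its posterior is still the one of slot m.\<close>

definition newcomer :: "nat \<Rightarrow> nat \<Rightarrow> history \<Rightarrow> bool" where
  "newcomer k i hs \<longleftrightarrow> alive hs \<and> transmissions k (past hs) \<le> w \<and>
     transmissions k hs = transmissions k (past hs) \<and> heavy i (past hs)"

text \<open>
  If no change is declared within \<open>R * w\<close> slots after the change, either a full window of new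
  outcomes went unnoticed, or a rate with at most \<open>w\<close> transmissions in the old state was used; the
  latter can only be an outcome of Thompson sampling, as the forced rate has been used often.
\<close>

lemma alive_prob_delay:
  assumes \<zeta>: "\<And>k i t. k \<in> {1..R} \<Longrightarrow> i \<in> {1..R} \<Longrightarrow> m \<le> t \<Longrightarrow> t < m + R * w \<Longrightarrow>
    EE h t (\<lambda>hs. of_bool (newcomer k i hs) * pmf (thompson_pmf R r hs) k) \<le> \<zeta>"
  shows "alive_prob h (m + R * w) \<le> EE h m (\<lambda>g. of_bool (no_heavy g)) +
    real (R * w) * (real R * (real (m + R * w + 1) * (2 * exp (- (real w * b\<^sup>2))))) + real (R * w) * (real R * (real R * \<zeta>))"
proof -
  let ?n = "R * w"
  let ?Y = "\<lambda>k i hs. hs \<noteq> [] \<and> fst (hd hs) = k \<and> newcomer k i (tl hs)"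
  have "alive_prob h (m + ?n) \<le> EE h (m + ?n) (\<lambda>hs. of_bool (no_heavy (drop ?n hs)) + (\<Sum>j<?n. of_bool (miss (drop j hs))) +
     (\<Sum>j<?n. \<Sum>k\<in>{1..R}. \<Sum>i\<in>{1..R}. of_bool (?Y k i (drop j hs))))"
    unfolding alive_prob_def
  proof (intro EE_mono)
    fix hs assume hs: "hs \<in> hists (m + ?n)"
    have len: "length hs = m + ?n" by (rule hists_length) fact
    have nn: "0 \<le> (\<Sum>j<?n. of_bool (miss (drop j hs)) :: real)"
        "0 \<le> (\<Sum>j<?n. \<Sum>k\<in>{1..R}. \<Sum>i\<in>{1..R}. of_bool (?Y k i (drop j hs)) :: real)"
      by (intro sum_nonneg, simp)+
    show "of_bool (alive hs) \<le> of_bool (no_heavy (drop ?n hs)) + (\<Sum>j<?n. of_bool (miss (drop j hs))) +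
     (\<Sum>j<?n. \<Sum>k\<in>{1..R}. \<Sum>i\<in>{1..R}. of_bool (?Y k i (drop j hs)) :: real)"
    proof (cases "alive hs \<and> \<not> no_heavy (drop ?n hs) \<and> (\<forall>j<?n. \<not> miss (drop j hs))")
      case True
      then have al: "alive hs" by blast
      obtain i where i: "heavy i (drop ?n hs)"
        using True alive_drop[OF al] by (auto simp: no_heavy_def)
      have few: "transmissions l hs < transmissions l (drop ?n hs) + w" if "l \<in> {1..R}" "w < transmissions l (drop ?n hs)" for l
      proof (rule ccontr)
        assume "\<not> ?thesis"
        then have "transmissions l (drop ?n hs) + w \<le> transmissions l hs" by simp
        then show False using alive_imp_miss[OF len al that] True by blast
      qed
      \<comment> \<open>Pigeonhole: otherwise every rate has fewer than w uses since the change, and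
        these cannot fill R * w slots.\<close>
      have "\<exists>k\<in>{1..R}. transmissions k (drop ?n hs) \<le> w \<and> transmissions k (drop ?n hs) < transmissions k hs"
      proof (rule ccontr)
        assume no: "\<not> ?thesis"
        have "(\<Sum>l\<in>{1..R}. transmissions l hs) < (\<Sum>l\<in>{1..R}. transmissions l (drop ?n hs) + w)"
        proof (intro sum_strict_mono)
          fix l assume l: "l \<in> {1..R}"
          show "transmissions l hs < transmissions l (drop ?n hs) + w"
            using few[OF l] no l w_pos by (cases "w < transmissions l (drop ?n hs)") (auto simp: not_less intro: le_less_trans)
        qed (use R in auto)
        moreover have "(\<Sum>l\<in>{1..R}. transmissions l hs) = m + ?n"
          using sum_transmissions[of hs R] hs by (simp add: hists_def)
        moreover have "(\<Sum>l\<in>{1..R}. transmissions l (drop ?n hs)) = m"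
          using sum_transmissions[of "drop ?n hs" R] hists_drop[OF hs] by (simp add: hists_def)
        ultimately show False by (simp add: sum.distrib)
      qed
      then obtain k where k: "k \<in> {1..R}" "transmissions k (drop ?n hs) \<le> w" "transmissions k (drop ?n hs) < transmissions k hs"
        by blast
      then obtain j x hs' where j: "j < ?n" "drop j hs = (k, x) # hs'" "transmissions k hs' = transmissions k (drop ?n hs)"
        using transmissions_crossing[of ?n hs "transmissions k (drop ?n hs)" k] len by auto
      have hs': "hs' = drop (Suc j) hs"
        using j(2) by (metis drop_Suc list.sel(3) tl_drop)
      have past: "past hs' = drop ?n hs"
      proof -
        have "length hs' - m = ?n - Suc j"
          using len by (simp add: hs')
        then have "past hs' = drop ((?n - Suc j) + Suc j) hs"
          unfolding hs' drop_drop[symmetric] by simp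
        also have "(?n - Suc j) + Suc j = ?n"
          using j(1) by linarith
        finally show ?thesis .
      qed
      have "?Y k i (drop j hs)"
        unfolding newcomer_def using j k i past alive_drop[OF al, of "Suc j"] hs' by simp
      then have "1 \<le> (of_bool (?Y k i (drop j hs)) :: real)" by simp
      also have "\<dots> \<le> (\<Sum>i\<in>{1..R}. of_bool (?Y k i (drop j hs)))"
        by (intro member_le_sum[of i "{1..R}" "\<lambda>i. of_bool (?Y k i (drop j hs))"]) (use i in \<open>auto simp: heavy_def\<close>)
      also have "\<dots> \<le> (\<Sum>k\<in>{1..R}. \<Sum>i\<in>{1..R}. of_bool (?Y k i (drop j hs)))"
        by (intro member_le_sum[of k "{1..R}" "\<lambda>k. \<Sum>i\<in>{1..R}. of_bool (?Y k i (drop j hs))"] k) (auto intro!: sum_nonneg simp del: sum_of_bool_eq)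
      also have "\<dots> \<le> (\<Sum>j<?n. \<Sum>k\<in>{1..R}. \<Sum>i\<in>{1..R}. of_bool (?Y k i (drop j hs)))"
        using j(1) by (intro member_le_sum[of j "{..<?n}" "\<lambda>j. \<Sum>k\<in>{1..R}. \<Sum>i\<in>{1..R}. of_bool (?Y k i (drop j hs))"]) (auto intro!: sum_nonneg simp del: sum_of_bool_eq)
      finally have "1 \<le> (\<Sum>j<?n. \<Sum>k\<in>{1..R}. \<Sum>i\<in>{1..R}. of_bool (?Y k i (drop j hs)) :: real)" .
      moreover have "of_bool (alive hs) \<le> (1::real)" "0 \<le> (of_bool (no_heavy (drop ?n hs)) :: real)" by simp_all
      ultimately show ?thesis using nn(1) by linarith
    next
      case False
      then consider "\<not> alive hs" | "no_heavy (drop ?n hs)" | j where "j < ?n" "miss (drop j hs)" by blast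
      then show ?thesis
      proof cases
        case 3
        then have "of_bool (miss (drop j hs)) \<le> (\<Sum>j<?n. of_bool (miss (drop j hs)) :: real)"
          by (intro member_le_sum) auto
        then have "1 \<le> (\<Sum>j<?n. of_bool (miss (drop j hs)) :: real)" using 3 by simp
        moreover have "of_bool (alive hs) \<le> (1::real)" "0 \<le> (of_bool (no_heavy (drop ?n hs)) :: real)" by simp_all
        ultimately show ?thesis using nn(2) by linarith
      next
        case 1
        then have "of_bool (alive hs) = (0::real)" by simp
        moreover have "0 \<le> (of_bool (no_heavy (drop ?n hs)) :: real)" by simp
        ultimately show ?thesis using nn by linarith
      next
        case 2
        then have "of_bool (no_heavy (drop ?n hs)) = (1::real)" by simp
        moreover have "of_bool (alive hs) \<le> (1::real)" by simp
        ultimately show ?thesis using nn by linarith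
      qed
    qed
  qed
  also have "\<dots> = EE h (m + ?n) (\<lambda>hs. of_bool (no_heavy (drop ?n hs))) + EE h (m + ?n) (\<lambda>hs. \<Sum>j<?n. of_bool (miss (drop j hs))) +
     (\<Sum>j<?n. \<Sum>k\<in>{1..R}. \<Sum>i\<in>{1..R}. EE h (m + ?n) (\<lambda>hs. of_bool (?Y k i (drop j hs))))"
    by (simp only: EE_add EE_sum)
  also have "EE h (m + ?n) (\<lambda>hs. of_bool (no_heavy (drop ?n hs))) = EE h m (\<lambda>g. of_bool (no_heavy g))"
    by (rule EE_prefix[OF h])
  also have "(\<Sum>j<?n. \<Sum>k\<in>{1..R}. \<Sum>i\<in>{1..R}. EE h (m + ?n) (\<lambda>hs. of_bool (?Y k i (drop j hs)))) \<le> (\<Sum>j<?n. \<Sum>k\<in>{1..R}. \<Sum>i\<in>{1..R}. \<zeta>)"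
  proof (intro sum_mono)
    fix j k i assume j: "j \<in> {..<?n}" and k: "k \<in> {1..R}" and i: "i \<in> {1..R}"
    define n where "n = ?n - Suc j"
    have n: "n < ?n" "m + ?n = Suc (m + n) + j" using j by (auto simp: n_def)
    have "EE h (m + ?n) (\<lambda>hs. of_bool (?Y k i (drop j hs))) = EE h (Suc (m + n)) (\<lambda>hs. of_bool (?Y k i hs))"
      unfolding n(2) by (rule EE_prefix[OF h])
    also have "\<dots> = EE h (m + n) (\<lambda>hs. of_bool (newcomer k i hs) * pmf (pol hs) k)"
      unfolding EE_Suc[OF h]
    proof (intro EE_cong)
      fix hs
      have "step (h (Suc (m + n))) hs (\<lambda>hs. of_bool (?Y k i hs)) = (\<Sum>l\<in>{1..R}. pmf (pol hs) l * of_bool (l = k \<and> newcomer k i hs))"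
        by (subst step_arm_eq[of _ _ "\<lambda>l. of_bool (l = k \<and> newcomer k i hs)"]) auto
      also have "\<dots> = (\<Sum>l\<in>{1..R}. if l = k then of_bool (newcomer k i hs) * pmf (pol hs) k else 0)"
        by (intro sum.cong) auto
      also have "\<dots> = of_bool (newcomer k i hs) * pmf (pol hs) k"
        using k by simp
      finally show "step (h (Suc (m + n))) hs (\<lambda>hs. of_bool (?Y k i hs)) = of_bool (newcomer k i hs) * pmf (pol hs) k" .
    qed
    also have "\<dots> \<le> EE h (m + n) (\<lambda>hs. of_bool (newcomer k i hs) * pmf (thompson_pmf R r hs) k)"
    proof (intro EE_mono_support)
      fix hs assume hs: "hs \<in> set_pmf (history_pmf \<theta> h pol (m + n))"
      have len: "length hs = m + n" using hs set_history hists_length by blast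
      show "of_bool (newcomer k i hs) * pmf (pol hs) k \<le> of_bool (newcomer k i hs) * pmf (thompson_pmf R r hs) k"
      \<comment> \<open>In a forced slot k is not chosen at all, as the forced rate has more than w
        old uses.\<close>
      proof (cases "newcomer k i hs \<and> F dvd Suc (m + n)")
        case True
        then have al: "alive hs" by (simp add: newcomer_def)
        have "k \<noteq> empirical_best R r (slots 0 (F - 1) hs)"
          using forced_arm_used(1)[OF hs al] True len by (auto simp: newcomer_def)
        then show ?thesis
          using pol_alive[OF al] True len by simp
      next
        case False
        then show ?thesis
          using pol_alive[of hs] len by (auto simp: newcomer_def)
      qed
    qed
    also have "\<dots> \<le> \<zeta>"
      using n by (intro \<zeta> k i) auto
    finally show "EE h (m + ?n) (\<lambda>hs. of_bool (?Y k i (drop j hs))) \<le> \<zeta>" .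
  qed
  finally show ?thesis
    using EE_drop_miss[of ?n ?n] by simp
qed

end

section \<open>Ties between a certain success and the best expected rate\<close>

context thompson
begin

text \<open>
  The degenerate case in which even a certain success of rate \<open>k\<close> only ties with rate \<open>i\<close>: levels
  at a fixed distance around the common value are useless, so the posterior spread of \<open>i\<close> enters.
\<close>

lemma pmf_thompson_tied:
  assumes ki: "k \<in> {1..R}" "i \<in> {1..R}" "k \<noteq> i" and tie: "r k = r i * p" and p: "0 < p" "p \<le> 1" and c: "0 < c"
  shows "pmf (thompson_pmf R r hs) k \<le> of_bool (failures k hs = 0) * (real (transmissions k hs) + 1)\<^sup>2 / (2 * c) +
    (c / 2 + 2 * (real (transmissions k hs) + 1)\<^sup>2) / p\<^sup>2 *
    (2 * (real (successes i hs) - p * real (transmissions i hs))\<^sup>2 / (real (transmissions i hs + 1))\<^sup>2 + 2 / real (transmissions i hs + 1))"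
proof -
  let ?N = "real (transmissions k hs) + 1"
  define A where "A = of_bool (failures k hs = 0) * ?N\<^sup>2 / (2 * c)"
  define B where "B = (c / 2 + 2 * ?N\<^sup>2) / p\<^sup>2"
  let ?V = "2 * (real (successes i hs) - p * real (transmissions i hs))\<^sup>2 / (real (transmissions i hs + 1))\<^sup>2 + 2 / real (transmissions i hs + 1)"
  have AB: "0 \<le> A" "0 \<le> B" using c by (auto simp: A_def B_def)
  have V0: "0 \<le> ?V" by simp
  have point: "upper_prob (successes k hs) (failures k hs) (x / p) \<le> A + B * (x - p)\<^sup>2" for x
  proof (cases "x / p \<le> 1")
    case True
    define u where "u = 1 - x / p"
    have Bu: "B * (x - p)\<^sup>2 = (c / 2 + 2 * ?N\<^sup>2) * u\<^sup>2"
      using p by (simp add: B_def u_def field_simps power2_eq_square)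
    show ?thesis
    proof (cases "failures k hs = 0")
      case f: True
      have "upper_prob (successes k hs) (failures k hs) (x / p) \<le> ?N * u"
        using upper_prob_no_failures[OF True, of "successes k hs"] f by (simp add: transmissions_eq u_def add.commute)
      \<comment> \<open>Completing the square. The weight c will be sqrt m: the first term is then
        of order 1 / sqrt m, and so is c times the second moment of a heavy arm.\<close>
      also have "?N * u \<le> ?N\<^sup>2 / (2 * c) + c / 2 * u\<^sup>2"
      proof -
        have "0 \<le> (?N - c * u)\<^sup>2 / (2 * c)" using c by simp
        also have "\<dots> = ?N\<^sup>2 / (2 * c) + c / 2 * u\<^sup>2 - ?N * u"
          using c by (simp add: field_simps power2_eq_square)
        finally show ?thesis by simp
      qed
      also have "\<dots> \<le> A + B * (x - p)\<^sup>2"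
        unfolding Bu A_def by (simp add: f distrib_right)
      finally show ?thesis .
    next
      case False
      then have "upper_prob (successes k hs) (failures k hs) (x / p) \<le> 2 * ?N\<^sup>2 * u\<^sup>2"
        using upper_prob_failures[OF True, of "failures k hs" "successes k hs"] by (simp add: transmissions_eq u_def add_ac)
      also have "\<dots> \<le> B * (x - p)\<^sup>2"
        unfolding Bu using c by (intro mult_right_mono) auto
      finally show ?thesis using AB by simp
    qed
  next
    case False
    then show ?thesis using upper_prob_ge_1[of "x / p"] AB by simp
  qed
  have "ennreal (pmf (thompson_pmf R r hs) k) \<le> (\<integral>\<^sup>+x. ennreal (A + B * (x - p)\<^sup>2) \<partial>beta_of hs i)"
  proof (rule pmf_thompson_le_pair[OF ki])
    fix x
    have "x * r i / r k = x / p"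
      using r_pos[OF ki(2)] tie by simp
    then show "emeasure (beta_of hs k) {x * r i / r k..} \<le> ennreal (A + B * (x - p)\<^sup>2)"
      using point[of x] by (simp add: emeasure_beta_atLeast ennreal_leI)
  qed measurable
  also have "\<dots> = ennreal A + ennreal B * (\<integral>\<^sup>+x. ennreal ((x - p)\<^sup>2) \<partial>beta_of hs i)"
  proof -
    have "(\<lambda>x. (x - p)\<^sup>2) \<in> borel_measurable borel"
      by (intro borel_measurable_continuous_onI continuous_intros)
    then have "(\<lambda>x. ennreal ((x - p)\<^sup>2)) \<in> borel_measurable borel"
      by (rule measurable_compose[OF _ measurable_ennreal])
    then have m: "(\<lambda>x. ennreal ((x - p)\<^sup>2)) \<in> borel_measurable (beta_of hs i)"
      by (simp add: measurable_cong_sets[OF sets_beta_distr refl])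
    have "(\<integral>\<^sup>+x. ennreal (A + B * (x - p)\<^sup>2) \<partial>beta_of hs i) = (\<integral>\<^sup>+x. ennreal A + ennreal B * ennreal ((x - p)\<^sup>2) \<partial>beta_of hs i)"
      using AB by (intro nn_integral_cong) (simp add: ennreal_mult)
    also have "\<dots> = (\<integral>\<^sup>+x. ennreal A \<partial>beta_of hs i) + (\<integral>\<^sup>+x. ennreal B * ennreal ((x - p)\<^sup>2) \<partial>beta_of hs i)"
      by (intro nn_integral_add borel_measurable_const borel_measurable_times_ennreal m)
    also have "(\<integral>\<^sup>+x. ennreal B * ennreal ((x - p)\<^sup>2) \<partial>beta_of hs i) = ennreal B * (\<integral>\<^sup>+x. ennreal ((x - p)\<^sup>2) \<partial>beta_of hs i)"
      by (rule nn_integral_cmult[OF m])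
    finally show ?thesis
      using prob_space.emeasure_space_1[OF prob_space_beta_of[where hs = hs and i = i]] by simp
  qed
  also have "\<dots> \<le> ennreal A + ennreal B * ennreal ?V"
    using beta_second_moment[where \<theta> = p and s = "successes i hs" and f = "failures i hs"] p
    by (intro add_left_mono mult_left_mono) (auto simp: transmissions_eq)
  also have "\<dots> = ennreal (A + B * ?V)"
    using AB V0 by (simp add: ennreal_mult[symmetric] ennreal_plus[symmetric] del: ennreal_plus)
  finally have "pmf (thompson_pmf R r hs) k \<le> A + B * ?V"
    using AB V0 by (subst (asm) ennreal_le_iff) auto
  then show ?thesis by (simp add: A_def B_def)
qed

end

lemma successes_le: "successes i hs \<le> transmissions i hs"
  by (simp add: transmissions_eq)

section \<open>Probability that a rarely used rate is chosen after the change\<close>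

locale delayed = two_phase R r \<theta> Q w F b h a m J e0 vs i0 a'
  for R :: nat and r :: "nat \<Rightarrow> real" and \<theta> :: "nat \<Rightarrow> nat \<Rightarrow> real" and Q w F :: nat and b :: real
    and h :: "nat \<Rightarrow> nat" and a m J :: nat and e0 vs :: real and i0 a' :: nat +
  fixes \<kappa> C z \<eta> :: real
  assumes r_below: "\<And>k. k \<in> {1..R} \<Longrightarrow> r k < vs \<Longrightarrow> r k \<le> vs - e0"
    and r_above: "\<And>k. k \<in> {1..R} \<Longrightarrow> vs < r k \<Longrightarrow> vs + e0 < r k"
    and \<kappa>: "1 \<le> \<kappa>" "\<And>k. k \<in> {1..R} \<Longrightarrow> vs < r k \<Longrightarrow> (1 - (vs - e0) / r k) / (1 - (vs + e0) / r k) \<le> \<kappa>"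
    and C: "\<And>k i. k \<in> {1..R} \<Longrightarrow> i \<in> {1..R} \<Longrightarrow> 1 / (1 - sqrt (\<theta> a k))\<^sup>2 / 2 + 36 * (real R)\<^sup>2 / (\<theta> a i)\<^sup>2 \<le> C"
    and wJ: "w < J" and J_m: "2 * R * J \<le> m" and K_m: "4 * real R * real (R * w) \<le> ep * real m" "(R * w)\<^sup>2 \<le> m"
    and w_m: "4 * (real w + 1)\<^sup>2 \<le> sqrt (real m)"
    and z: "0 < z" "z \<le> 1" and \<eta>: "0 < \<eta>" "\<eta> \<le> 1" "2 * real R * del \<le> \<eta>"
begin

definition rare_bound :: real where
  "rare_bound = real (w + 1) * \<eta> + exp (z * real (R * J)) * (exp (- (z * \<eta> / 4 * real (m - m div F))) + 2 * real m * real R * del)"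

text \<open>The counterpart of \<open>del\<close> at resolution \<open>ep / 2\<close>, since the
  outcomes after the change shift the empirical mean of a heavy arm.\<close>

definition del2 :: real where "del2 = real (m + R * w + 1) * exp (- (real J * ep\<^sup>2 / 4))"

lemma rare_bound_nonneg: "0 \<le> rare_bound"
  using \<eta> del_pos by (simp add: rare_bound_def)

context
  fixes k i t :: nat and hs :: history
  assumes t: "m \<le> t" "t < m + R * w" and hs: "hs \<in> hists t" and new: "newcomer k i hs"
begin

lemma newcomer_split: obtains e where "hs = e @ past hs" "length e < R * w"
  using hists_length[OF hs] t that[of "take (length hs - m) hs"] by simp

lemma newcomer_same:
  shows "successes k hs = successes k (past hs)" "failures k hs = failures k (past hs)"
proof -
  obtain e where e: "hs = e @ past hs" by (rule newcomer_split)
  have "transmissions k e = 0"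
    using new e transmissions_append[of k e "past hs"] by (simp add: newcomer_def)
  then have "successes k e = 0" "failures k e = 0"
    by (simp_all add: transmissions_eq)
  then show "successes k hs = successes k (past hs)" "failures k hs = failures k (past hs)"
    using successes_append[of k e "past hs"] failures_append[of k e "past hs"] e by simp_all
qed

lemma newcomer_arm_prob: "arm_prob k y hs = arm_prob k y (past hs)"
  by (simp add: arm_prob_def newcomer_same)

lemma newcomer_heavy:
  shows "i \<in> {1..R}" "r i * \<theta> a i = vs" "m \<le> 2 * R * transmissions i (past hs)" "J \<le> transmissions i (past hs)" "k \<noteq> i"
proof -
  show i: "i \<in> {1..R}" "r i * \<theta> a i = vs" "m \<le> 2 * R * transmissions i (past hs)"
    using new by (auto simp: newcomer_def heavy_def)
  have "2 * R * J \<le> 2 * R * transmissions i (past hs)"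
    using J_m i(3) by (rule order.trans)
  then show J: "J \<le> transmissions i (past hs)" using R by simp
  then show "k \<noteq> i" using new wJ by (auto simp: newcomer_def)
qed

lemma newcomer_deviation:
  shows "(real (successes i hs) - \<theta> a i * real (transmissions i hs))\<^sup>2 \<le>
    2 * (real (successes i (past hs)) - \<theta> a i * real (transmissions i (past hs)))\<^sup>2 + 2 * (real (R * w))\<^sup>2"
    and "real (transmissions i (past hs)) \<le> real (transmissions i hs)"
    and "real (transmissions i hs) \<le> real (transmissions i (past hs)) + real (R * w)"
    and "real (successes i (past hs)) \<le> real (successes i hs)"
proof -
  obtain e where e: "hs = e @ past hs" "length e < R * w" by (rule newcomer_split)
  have ti: "transmissions i hs = transmissions i e + transmissions i (past hs)"
    and si: "successes i hs = successes i e + successes i (past hs)"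
    by (subst e(1), rule transmissions_append, subst e(1), rule successes_append)
  have te: "transmissions i e \<le> R * w"
    using transmissions_le_length[of i e] e(2) by simp
  have se: "successes i e \<le> transmissions i e" by (rule successes_le)
  let ?d = "real (successes i e) - \<theta> a i * real (transmissions i e)"
  have "\<theta> a i * real (transmissions i e) \<le> 1 * real (transmissions i e)"
    using less_1[OF newcomer_heavy(1)] by (intro mult_right_mono) auto
  moreover have "0 \<le> \<theta> a i * real (transmissions i e)"
    using pos[OF newcomer_heavy(1)] by simp
  ultimately have "\<bar>?d\<bar> \<le> real (R * w)"
    using se te by linarith
  then have d2: "?d\<^sup>2 \<le> (real (R * w))\<^sup>2"
    by (subst abs_le_square_iff[symmetric]) simp
  have eq: "real (successes i hs) - \<theta> a i * real (transmissions i hs) =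
      (real (successes i (past hs)) - \<theta> a i * real (transmissions i (past hs))) + ?d"
    using ti si by (simp add: algebra_simps)
  show "(real (successes i hs) - \<theta> a i * real (transmissions i hs))\<^sup>2 \<le>
    2 * (real (successes i (past hs)) - \<theta> a i * real (transmissions i (past hs)))\<^sup>2 + 2 * (real (R * w))\<^sup>2"
    unfolding eq using d2 power2_sum_le[of "real (successes i (past hs)) - \<theta> a i * real (transmissions i (past hs))" ?d] by linarith
  show "real (transmissions i (past hs)) \<le> real (transmissions i hs)"
    and "real (transmissions i hs) \<le> real (transmissions i (past hs)) + real (R * w)"
    and "real (successes i (past hs)) \<le> real (successes i hs)"
    using ti si te by linarith+
qed

text \<open>The margin 2 \<open>ep\<close> is spent as follows: \<open>ep\<close> for the old
  empirical mean, \<open>ep / 2\<close> for the new outcomes, which by \<open>K_m\<close> are few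
  against the old ones, and \<open>ep / 2\<close> for the posterior spread.\<close>

lemma newcomer_arm_prob_heavy:
  assumes good: "\<not> emp_bad i (past hs)"
  shows "1 - arm_prob i ((vs - e0) / r i) hs \<le> del2"
proof -
  let ?g = "past hs" and ?y = "(vs - e0) / r i"
  let ?N = "real (transmissions i hs)" and ?Ng = "real (transmissions i ?g)"
  note i = newcomer_heavy
  have y: "0 < ?y" "?y \<le> \<theta> a i - 2 * ep"
    using level_below[OF i(1,2)] two_ep_le[OF i(1)] by auto
  have th: "0 \<le> \<theta> a i - 3 / 2 * ep" "\<theta> a i - 3 / 2 * ep \<le> 1"
    using y ep_pos less_1[OF i(1)] by auto
  have "real m \<le> real (2 * R * transmissions i ?g)"
    using i(3) by (simp only: of_nat_le_iff)
  then have "ep * real m \<le> ep * (2 * real R * ?Ng)"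
    using ep_pos by (intro mult_left_mono) auto
  then have "2 * real R * (2 * real (R * w)) \<le> 2 * real R * (ep * ?Ng)"
    using K_m(1) by (simp add: mult_ac)
  then have K2: "2 * real (R * w) \<le> ep * ?Ng"
    using R by (subst (asm) mult_le_cancel_left_pos) auto
  have "?N * (?y + ep / 2) \<le> ?N * (\<theta> a i - 3 / 2 * ep)"
    using y by (intro mult_left_mono) auto
  also have "\<dots> \<le> (?Ng + real (R * w)) * (\<theta> a i - 3 / 2 * ep)"
    using newcomer_deviation(3) th by (intro mult_right_mono) auto
  also have "\<dots> \<le> ?Ng * (\<theta> a i - 3 / 2 * ep) + real (R * w)"
    unfolding distrib_right using mult_left_mono[OF th(2), of "real (R * w)"] by simp
  also have "\<dots> \<le> ?Ng * (\<theta> a i - ep)"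
    using K2 by (simp add: algebra_simps)
  also have "\<dots> \<le> real (successes i ?g)"
    using good i(4) by (auto simp: emp_bad_def algebra_simps)
  also have "\<dots> \<le> real (successes i hs)"
    by (rule newcomer_deviation(4))
  finally have "1 - arm_prob i ?y hs \<le> real (transmissions i hs + 1) * exp (- (?N * (ep / 2)\<^sup>2))"
    using lower_prob_tail[of "ep / 2" ?y "successes i hs" "failures i hs"] y ep_pos less_1[OF i(1)]
    by (simp add: arm_prob_def transmissions_eq)
  also have "\<dots> \<le> real (m + R * w + 1) * exp (- (real J * ep\<^sup>2 / 4))"
  proof (intro mult_mono)
    show "real (transmissions i hs + 1) \<le> real (m + R * w + 1)"
      using transmissions_le_length[of i hs] hists_length[OF hs] t by linarith
    have "real J * (ep\<^sup>2 / 4) \<le> ?N * (ep\<^sup>2 / 4)"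
      using i(4) newcomer_deviation(2) by (intro mult_right_mono) auto
    then show "exp (- (?N * (ep / 2)\<^sup>2)) \<le> exp (- (real J * ep\<^sup>2 / 4))"
      by (simp add: power_divide)
  qed auto
  finally show ?thesis by (simp add: del2_def)
qed

end

lemma m_pos: "0 < m"
  using m_large F_ge by (cases m) auto

lemma EE_past:
  assumes "m \<le> t" shows "EE h t (\<lambda>hs. f (past hs)) = EE h m f"
proof -
  have "EE h t (\<lambda>hs. f (past hs)) = EE h (m + (t - m)) (\<lambda>hs. f (drop (t - m) hs))"
    using assms by (simp, intro EE_cong) (simp add: hists_length)
  also have "\<dots> = EE h m f"
    by (rule EE_prefix[OF h])
  finally show ?thesis .
qed

lemma del2_nonneg: "0 \<le> del2"
  by (simp add: del2_def)

text \<open>The posterior of k has not moved since slot m, and the heavy arm i stays above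
  \<open>vs - e0\<close> up to small probabilities. Everything is thus reduced to an expectation G
  over the old state.\<close>

lemma EE_newcomer_level:
  assumes k: "k \<in> {1..R}" and i: "i \<in> {1..R}" and t: "m \<le> t" "t < m + R * w"
    and G: "\<And>hs. hs \<in> hists t \<Longrightarrow> newcomer k i hs \<Longrightarrow> arm_prob k ((vs - e0) / r k) hs \<le> G (past hs)"
    and G0: "\<And>g. 0 \<le> G g"
  shows "EE h t (\<lambda>hs. of_bool (newcomer k i hs) * pmf (thompson_pmf R r hs) k) \<le> EE h m G + 2 * del + del2"
proof -
  have "EE h t (\<lambda>hs. of_bool (newcomer k i hs) * pmf (thompson_pmf R r hs) k) \<le>
     EE h t (\<lambda>hs. G (past hs) + of_bool (emp_bad i (past hs)) + del2)"
  proof (intro EE_mono of_bool_mult_le)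
    fix hs assume hs: "hs \<in> hists t"
    show "0 \<le> G (past hs) + of_bool (emp_bad i (past hs)) + del2"
      using G0[of "past hs"] del2_nonneg by simp
    assume new: "newcomer k i hs"
    have "pmf (thompson_pmf R r hs) k \<le> arm_prob k ((vs - e0) / r k) hs + (1 - arm_prob i ((vs - e0) / r i) hs)"
      by (rule pmf_thompson_le_above_below[OF k i])
    moreover have "1 - arm_prob i ((vs - e0) / r i) hs \<le> of_bool (emp_bad i (past hs)) + del2"
    proof (cases "emp_bad i (past hs)")
      case True
      then show ?thesis using arm_prob_nonneg[of i "(vs - e0) / r i" hs] del2_nonneg by simp
    next
      case False
      then show ?thesis using newcomer_arm_prob_heavy[OF t hs new] by simp
    qed
    ultimately show "pmf (thompson_pmf R r hs) k \<le> G (past hs) + of_bool (emp_bad i (past hs)) + del2"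
      using G[OF hs new] by linarith
  qed
  also have "\<dots> = EE h m G + EE h m (\<lambda>g. of_bool (emp_bad i g)) + del2"
    using EE_past[OF t(1), of G] EE_past[OF t(1), of "\<lambda>g. of_bool (emp_bad i g)"] by (simp add: EE_add)
  also have "\<dots> \<le> EE h m G + 2 * del + del2"
    using EE_emp_bad[OF _ i, of m] by simp
  finally show ?thesis .
qed

text \<open>If \<open>r k < vs\<close>, no sample of k reaches \<open>vs - e0\<close>. If
  \<open>vs < r k\<close>, the bound at \<open>vs + e0\<close> is carried down to
  \<open>vs - e0\<close> at the price \<kappa> ^ (w + 1). If they are equal, the pairwise comparison
  with the heavy arm gives order 1 / sqrt m.\<close>

lemma EE_newcomer:
  assumes k: "k \<in> {1..R}" and i: "i \<in> {1..R}" and t: "m \<le> t" "t < m + R * w"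
  shows "EE h t (\<lambda>hs. of_bool (newcomer k i hs) * pmf (thompson_pmf R r hs) k) \<le>
    real (w + 1) * \<kappa> ^ (w + 1) * rare_bound + 2 * del + del2 + C / sqrt (real m)"
proof -
  have sm: "0 < sqrt (real m)" using m_pos by simp
  have "0 \<le> 1 / (1 - sqrt (\<theta> a k))\<^sup>2 / 2 + 36 * (real R)\<^sup>2 / (\<theta> a i)\<^sup>2" by simp
  then have "0 \<le> C"
    using C[OF k i] by linarith
  then have C0: "0 \<le> C / sqrt (real m)" by simp
  have T1: "0 \<le> real (w + 1) * \<kappa> ^ (w + 1) * rare_bound"
    using \<kappa>(1) rare_bound_nonneg by (intro mult_nonneg_nonneg) auto
  consider "r k < vs" | "vs < r k" | "r k = vs" by linarith
  then show ?thesis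
  proof cases
    case 1
    have "EE h t (\<lambda>hs. of_bool (newcomer k i hs) * pmf (thompson_pmf R r hs) k) \<le> EE h m (\<lambda>_. 0) + 2 * del + del2"
    proof (rule EE_newcomer_level[OF k i t])
      fix hs
      have "1 \<le> (vs - e0) / r k"
        using r_below[OF k 1] r_pos[OF k] by simp
      then show "arm_prob k ((vs - e0) / r k) hs \<le> 0"
        by (simp add: arm_prob_def upper_prob_ge_1)
    qed simp
    then show ?thesis using C0 T1 by simp
  next
    case 2
    let ?y = "(vs - e0) / r k" and ?z = "(vs + e0) / r k"
    let ?c = "real (w + 1) * \<kappa> ^ (w + 1)"
    have yz: "0 \<le> ?y" "?y \<le> ?z" "?z < 1"
      using e0 r_above[OF k 2] r_pos[OF k] by (auto intro: divide_right_mono)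
    have "EE h t (\<lambda>hs. of_bool (newcomer k i hs) * pmf (thompson_pmf R r hs) k) \<le>
       EE h m (\<lambda>g. ?c * (of_bool (alive g \<and> transmissions k g \<le> w) * arm_prob k ?z g)) + 2 * del + del2"
    proof (rule EE_newcomer_level[OF k i t])
      fix hs assume hs: "hs \<in> hists t" and new: "newcomer k i hs"
      let ?g = "past hs"
      have al: "alive ?g" "transmissions k ?g \<le> w"
        using new alive_drop by (auto simp: newcomer_def)
      define q where "q = (1 - ?y) / (1 - ?z)"
      have q: "0 \<le> q" "q \<le> \<kappa>"
        using yz \<kappa>(2)[OF k 2] by (auto simp: q_def)
      have "arm_prob k ?y ?g \<le> real (Suc (failures k ?g)) * q ^ Suc (failures k ?g) * arm_prob k ?z ?g"
        unfolding arm_prob_def q_def by (rule upper_prob_ratio[OF yz])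
      also have "\<dots> \<le> ?c * arm_prob k ?z ?g"
      proof (intro mult_right_mono arm_prob_nonneg mult_mono)
        show "real (Suc (failures k ?g)) \<le> real (w + 1)"
          using al(2) by (simp add: transmissions_eq)
        have "q ^ Suc (failures k ?g) \<le> \<kappa> ^ Suc (failures k ?g)"
          by (intro power_mono q)
        also have "\<dots> \<le> \<kappa> ^ (w + 1)"
          using \<kappa>(1) al(2) by (intro power_increasing) (auto simp: transmissions_eq)
        finally show "q ^ Suc (failures k ?g) \<le> \<kappa> ^ (w + 1)" .
      qed (use q in auto)
      finally show "arm_prob k ?y hs \<le> ?c * (of_bool (alive ?g \<and> transmissions k ?g \<le> w) * arm_prob k ?z ?g)"
        using al newcomer_arm_prob[OF t hs new] by simp
    qed (use \<kappa>(1) arm_prob_nonneg in \<open>auto intro!: mult_nonneg_nonneg\<close>)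
    also have "\<dots> \<le> ?c * rare_bound + 2 * del + del2"
      unfolding EE_cmult rare_bound_def using \<kappa>(1) k r_above[OF k 2] wJ z \<eta>
      by (intro add_right_mono mult_left_mono EE_rare_arm_prob) auto
    finally show ?thesis using C0 by linarith
  next
    case 3
    show ?thesis
    proof (cases "r i * \<theta> a i = vs")
      case False
      then have "\<not> newcomer k i hs" for hs by (auto simp: newcomer_def heavy_def)
      then show ?thesis using C0 T1 del_pos del2_nonneg by simp
    next
      case True
      let ?p = "\<theta> a i" and ?s = "sqrt (real m)"
      define D where "D g = (real (successes i g) - ?p * real (transmissions i g))\<^sup>2" for g
      define B where "B g = of_bool (failures k g = 0) * (real (transmissions k g) + 1)\<^sup>2" for g
      have p: "0 < ?p" "?p \<le> 1" using pos[OF i] less_1[OF i] by auto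
      let ?c1 = "?s / ?p\<^sup>2 * (16 * (real R)\<^sup>2 / (real m)\<^sup>2)"
      let ?c2 = "?s / ?p\<^sup>2 * (16 * (real R)\<^sup>2 * (real (R * w))\<^sup>2 / (real m)\<^sup>2 + 4 * real R / real m)"
      have "EE h t (\<lambda>hs. of_bool (newcomer k i hs) * pmf (thompson_pmf R r hs) k) \<le>
        EE h t (\<lambda>hs. 1 / (2 * ?s) * B (past hs) + ?c1 * D (past hs) + ?c2)"
      proof (intro EE_mono of_bool_mult_le)
        fix hs assume hs: "hs \<in> hists t"
        show "0 \<le> 1 / (2 * ?s) * B (past hs) + ?c1 * D (past hs) + ?c2"
          by (simp add: B_def D_def)
        assume new: "newcomer k i hs"
        note facts = newcomer_heavy[OF t hs new] newcomer_same[OF t hs new] newcomer_deviation[OF t hs new]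
        let ?N = "real (transmissions i hs + 1)"
        have Nk: "transmissions k hs = transmissions k (past hs)" "transmissions k hs \<le> w"
          using new by (auto simp: newcomer_def)
        have "real m \<le> real (2 * R * transmissions i (past hs))"
          using facts(3) by (simp only: of_nat_le_iff)
        also have "\<dots> = 2 * real R * real (transmissions i (past hs))" by simp
        also have "\<dots> \<le> 2 * real R * ?N"
          using facts(9) by (intro mult_left_mono) auto
        finally have mN: "real m \<le> 2 * real R * ?N" .
        have inv: "1 / ?N \<le> 2 * real R / real m"
          using mN m_pos by (simp add: field_simps)
        then have inv2: "(1 / ?N)\<^sup>2 \<le> (2 * real R / real m)\<^sup>2"
          by (intro power_mono) auto
        have "pmf (thompson_pmf R r hs) k \<le> B hs / (2 * ?s) + (?s / 2 + 2 * (real (transmissions k hs) + 1)\<^sup>2) / ?p\<^sup>2 *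
           (2 * D hs / ?N\<^sup>2 + 2 / ?N)"
          unfolding B_def D_def
          using facts(5) 3 True p sm by (intro pmf_thompson_tied k i) auto
        also have "B hs = B (past hs)"
          using facts(7) Nk(1) by (simp add: B_def)
        also have "(?s / 2 + 2 * (real (transmissions k hs) + 1)\<^sup>2) / ?p\<^sup>2 * (2 * D hs / ?N\<^sup>2 + 2 / ?N) \<le>
           ?s / ?p\<^sup>2 * (2 * (2 * D (past hs) + 2 * (real (R * w))\<^sup>2) * (4 * (real R)\<^sup>2 / (real m)\<^sup>2) + 4 * real R / real m)"
        proof (intro mult_mono divide_right_mono add_mono)
          have "(real (transmissions k hs) + 1)\<^sup>2 \<le> (real w + 1)\<^sup>2"
            using Nk(2) by (intro power_mono) auto
          then show "?s / 2 + 2 * (real (transmissions k hs) + 1)\<^sup>2 \<le> ?s"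
            using w_m by linarith
          have "2 * D hs / ?N\<^sup>2 = 2 * D hs * (1 / ?N)\<^sup>2"
            by (simp add: power_divide)
          also have "\<dots> \<le> 2 * (2 * D (past hs) + 2 * (real (R * w))\<^sup>2) * (2 * real R / real m)\<^sup>2"
            using facts(8) inv2 by (intro mult_mono) (auto simp: D_def)
          finally show "2 * D hs / ?N\<^sup>2 \<le> 2 * (2 * D (past hs) + 2 * (real (R * w))\<^sup>2) * (4 * (real R)\<^sup>2 / (real m)\<^sup>2)"
            by (simp add: power_divide power_mult_distrib)
          show "2 / ?N \<le> 4 * real R / real m"
            using inv by simp
        qed (auto simp: D_def)
        also have "\<dots> = ?c1 * D (past hs) + ?c2"
          by (simp add: algebra_simps add_divide_distrib)
        finally show "pmf (thompson_pmf R r hs) k \<le> 1 / (2 * ?s) * B (past hs) + ?c1 * D (past hs) + ?c2"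
          by simp
      qed
      also have "\<dots> = 1 / (2 * ?s) * EE h m B + ?c1 * EE h m D + ?c2"
        using EE_past[OF t(1), of B] EE_past[OF t(1), of D] by (simp only: EE_add EE_cmult EE_const)
      also have "\<dots> \<le> 1 / (2 * ?s) * (1 / (1 - sqrt (\<theta> a k))\<^sup>2) + (?c1 * real m + ?c2)"
        unfolding B_def D_def add.assoc using sm
        by (intro add_mono mult_left_mono EE_no_failures EE_variance k i order_refl) auto
      also have "?c1 * real m + ?c2 \<le> ?s / ?p\<^sup>2 * (36 * (real R)\<^sup>2 / real m)"
      proof -
        have "(real (R * w))\<^sup>2 \<le> real m"
          using K_m(2) by (simp only: of_nat_power[symmetric] of_nat_le_iff)
        then have "16 * (real R)\<^sup>2 * (real (R * w))\<^sup>2 / (real m)\<^sup>2 \<le> 16 * (real R)\<^sup>2 * real m / (real m)\<^sup>2"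
          by (intro divide_right_mono mult_left_mono) auto
        also have "\<dots> = 16 * (real R)\<^sup>2 / real m"
          using m_pos by (simp add: power2_eq_square)
        finally have 1: "16 * (real R)\<^sup>2 * (real (R * w))\<^sup>2 / (real m)\<^sup>2 \<le> 16 * (real R)\<^sup>2 / real m" .
        have "1 * real R \<le> real R * real R"
          using R by (intro mult_right_mono) auto
        then have 2: "4 * real R / real m \<le> 4 * (real R)\<^sup>2 / real m"
          by (intro divide_right_mono) (auto simp: power2_eq_square)
        have "?c1 * real m + ?c2 = ?s / ?p\<^sup>2 * (16 * (real R)\<^sup>2 / real m + (16 * (real R)\<^sup>2 * (real (R * w))\<^sup>2 / (real m)\<^sup>2 + 4 * real R / real m))"
          using m_pos by (simp add: power2_eq_square distrib_left)
        also have "\<dots> \<le> ?s / ?p\<^sup>2 * (16 * (real R)\<^sup>2 / real m + (16 * (real R)\<^sup>2 / real m + 4 * (real R)\<^sup>2 / real m))"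
          using 1 2 sm by (intro mult_left_mono add_mono) auto
        also have "\<dots> = ?s / ?p\<^sup>2 * (36 * (real R)\<^sup>2 / real m)"
          by (simp add: add_divide_distrib[symmetric])
        finally show ?thesis .
      qed
      also have "?s / ?p\<^sup>2 * (36 * (real R)\<^sup>2 / real m) = 36 * (real R)\<^sup>2 / ?p\<^sup>2 / ?s"
      proof -
        have "?s / real m = 1 / ?s"
          using m_pos real_sqrt_mult_self[of "real m"] by (simp add: field_simps)
        then have "36 * (real R)\<^sup>2 / ?p\<^sup>2 * (?s / real m) = 36 * (real R)\<^sup>2 / ?p\<^sup>2 * (1 / ?s)"
          by (rule arg_cong)
        then show ?thesis by (simp add: mult_ac)
      qed
      also have "1 / (2 * ?s) * (1 / (1 - sqrt (\<theta> a k))\<^sup>2) + 36 * (real R)\<^sup>2 / ?p\<^sup>2 / ?s =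
         (1 / (1 - sqrt (\<theta> a k))\<^sup>2 / 2 + 36 * (real R)\<^sup>2 / ?p\<^sup>2) / ?s"
        by (simp add: add_divide_distrib)
      also have "\<dots> \<le> C / ?s"
        using C[OF k i] sm by (intro divide_right_mono) auto
      finally show ?thesis using T1 del_pos del2_nonneg by simp
    qed
  qed
qed

end

section \<open>Regret of a block\<close>

context cdts_run
begin

lemma best_rate_range: "best_rate R r \<theta> q \<in> {1..R}"
  unfolding best_rate_def using R by (intro arg_max_on_in) auto

lemma best_rate_ge: "i \<in> {1..R} \<Longrightarrow> r i * \<theta> q i \<le> r (best_rate R r \<theta> q) * \<theta> q (best_rate R r \<theta> q)"
  unfolding best_rate_def using arg_max_on_ge[of "{1..R}" i "\<lambda>i. r i * \<theta> q i"] by simp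

lemma r_R_pos: "0 < r R"
  using R by (intro r_pos) auto

lemma best_gap_le:
  assumes "q \<in> {1..Q}" "i \<in> {1..R}"
  shows "best_gap R r \<theta> q i \<le> r R"
proof -
  let ?b = "best_rate R r \<theta> q"
  have "r ?b * \<theta> q ?b \<le> r R * 1"
    using r_le[OF best_rate_range] r_pos[OF best_rate_range] \<theta>_nonneg[OF assms(1) best_rate_range]
      \<theta>_le[OF assms(1) best_rate_range] r_R_pos by (intro mult_mono) auto
  moreover have "0 \<le> r i * \<theta> q i"
    using r_pos[OF assms(2)] \<theta>_nonneg[OF assms] by simp
  ultimately show ?thesis by (simp add: best_gap_def)
qed

lemma gap_rate_le:
  assumes "q \<in> {1..Q}" shows "gap_rate q hs \<le> r R"
proof -
  have "gap_rate q hs \<le> (\<Sum>i\<in>{1..R}. pmf (pol hs) i * r R)"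
    unfolding gap_rate_def using best_gap_le[OF assms] by (intro sum_mono mult_left_mono) auto
  then show ?thesis
    using sum_pol[of hs] by (simp flip: sum_distrib_right)
qed

lemma EE_alive_gap_le:
  assumes "q \<in> {1..Q}"
  shows "EE h t (\<lambda>hs. of_bool (alive hs) * gap_rate q hs) \<le> r R * alive_prob h t"
proof -
  have "EE h t (\<lambda>hs. of_bool (alive hs) * gap_rate q hs) \<le> EE h t (\<lambda>hs. r R * of_bool (alive hs))"
    using gap_rate_le[OF assms] by (intro EE_mono) simp
  then show ?thesis by (simp add: EE_cmult alive_prob_def)
qed

lemma regret_le:
  assumes "chan h" shows "regret R r \<theta> h pol n \<le> r R * real n"
proof -
  have "regret R r \<theta> h pol n \<le> (\<Sum>t<n. r R)"
    unfolding regret_eq_sum[OF assms] by (intro sum_mono EE_le_const gap_rate_le chanD[OF assms])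
  then show ?thesis by (simp add: mult.commute)
qed

text \<open>\<open>alive_prob\<close> decreases in time, so its last value in a group of F slots is
  at most the mean over the group. The induction carries the unfinished group in the term with n mod
  F.\<close>

lemma sum_forced_le:
  assumes "chan h"
  shows "(\<Sum>t<n. of_bool (F dvd Suc t) * alive_prob h t) \<le> (\<Sum>t<n. alive_prob h t) / real F"
proof -
  have A: "alive_prob h (Suc n) \<le> alive_prob h n" for n
    by (rule alive_prob_antimono[OF assms]) simp
  have "real F * (\<Sum>t<n. of_bool (F dvd Suc t) * alive_prob h t) + real (n mod F) * alive_prob h n \<le> (\<Sum>t<n. alive_prob h t)"
  proof (induction n)
    case (Suc n)
    show ?case
    proof (cases "F dvd Suc n")
      case True
      then have "Suc n mod F = 0" "real F = real (n mod F) + 1"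
        using F_ge by (auto simp: mod_Suc dvd_eq_mod_eq_0 split: if_splits)
      then show ?thesis
        using Suc True by (simp add: algebra_simps)
    next
      case False
      then have "Suc n mod F = Suc (n mod F)"
        by (auto simp: mod_Suc dvd_eq_mod_eq_0)
      moreover have "real (Suc (n mod F)) * alive_prob h (Suc n) \<le> real (Suc (n mod F)) * alive_prob h n"
        using A by (intro mult_left_mono) auto
      ultimately show ?thesis
        using Suc False by (simp add: algebra_simps)
    qed
  qed simp
  moreover have "0 \<le> real (n mod F) * alive_prob h n"
    using alive_prob_nonneg by simp
  ultimately show ?thesis
    using F_ge by (simp add: pos_le_divide_eq mult.commute)
qed

text \<open>Every slot lies either in the first cycle or after its end.\<close>

lemma alive_plus_change:
  assumes "chan h"
  shows "(\<Sum>t<n. alive_prob h t) + (\<Sum>s\<in>{1..n}. change_prob h s * real (n - s)) = real n"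
proof (induction n)
  case (Suc n)
  have "(\<Sum>s\<in>{1..Suc n}. change_prob h s * real (Suc n - s)) = (\<Sum>s\<in>{1..n}. change_prob h s * real (n - s) + change_prob h s)"
    by (simp add: algebra_simps of_nat_diff)
  moreover have "(\<Sum>s\<in>{1..n}. change_prob h s) = 1 - alive_prob h n"
    using sum_change_prob[OF assms, of 0 n] by (simp add: atLeastSucAtMost_greaterThanAtMost)
  ultimately show ?case
    using Suc by (simp add: sum.distrib)
qed simp

text \<open>The forced cost is kept proportional to the remaining horizon. By
  \<open>alive_plus_change\<close> the shares of the first cycle and of the restarted run add up to
  r R n / F again, so no extra forced cost arises per cycle.\<close>

lemma renewal_bound:
  assumes h: "chan h"
    and cost: "\<And>t. t < n \<Longrightarrow> EE h t (\<lambda>hs. of_bool (alive hs) * gap_rate (h (Suc t)) hs) \<le>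
      r R * (of_bool (F dvd Suc t) * alive_prob h t) + c t"
    and cont: "\<And>s. 1 \<le> s \<Longrightarrow> s \<le> n \<Longrightarrow> regret R r \<theta> (\<lambda>t. h (s + t)) pol (n - s) \<le> U + r R * real (n - s) / real F + V s"
    and U: "0 \<le> U"
  shows "regret R r \<theta> h pol n \<le> U + r R * real n / real F + (\<Sum>t<n. c t) + (\<Sum>s\<in>{1..n}. change_prob h s * V s)"
proof -
  let ?A = "\<Sum>t<n. alive_prob h t"
  let ?D = "\<Sum>s\<in>{1..n}. change_prob h s * real (n - s)"
  have "regret R r \<theta> h pol n \<le> (\<Sum>t<n. r R * (of_bool (F dvd Suc t) * alive_prob h t) + c t) +
     (\<Sum>s\<in>{1..n}. change_prob h s * (U + r R * real (n - s) / real F + V s))"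
    unfolding regret_renewal[OF h] using cost cont change_prob_nonneg
    by (intro add_mono sum_mono mult_left_mono) auto
  also have "(\<Sum>s\<in>{1..n}. change_prob h s * (U + r R * real (n - s) / real F + V s)) =
     (\<Sum>s\<in>{1..n}. change_prob h s) * U + r R / real F * ?D + (\<Sum>s\<in>{1..n}. change_prob h s * V s)"
  proof -
    have "change_prob h s * (U + r R * real (n - s) / real F + V s) =
        change_prob h s * U + r R / real F * (change_prob h s * real (n - s)) + change_prob h s * V s" for s
      by (simp add: distrib_left)
    then show ?thesis by (simp only: sum.distrib sum_distrib_left sum_distrib_right)
  qed
  also have "(\<Sum>t<n. r R * (of_bool (F dvd Suc t) * alive_prob h t) + c t) =
     r R * (\<Sum>t<n. of_bool (F dvd Suc t) * alive_prob h t) + (\<Sum>t<n. c t)"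
    by (simp only: sum.distrib sum_distrib_left)
  finally have 1: "regret R r \<theta> h pol n \<le> r R * (\<Sum>t<n. of_bool (F dvd Suc t) * alive_prob h t) + (\<Sum>t<n. c t) +
     ((\<Sum>s\<in>{1..n}. change_prob h s) * U + r R / real F * ?D + (\<Sum>s\<in>{1..n}. change_prob h s * V s))" .
  have "(\<Sum>s\<in>{1..n}. change_prob h s) \<le> 1"
    using sum_change_prob[OF h, of 0 n] alive_prob_nonneg[of h n] by (simp add: atLeastSucAtMost_greaterThanAtMost)
  then have 2: "(\<Sum>s\<in>{1..n}. change_prob h s) * U \<le> U"
    using U change_prob_nonneg by (intro mult_left_le_one_le sum_nonneg) auto
  have "r R * (\<Sum>t<n. of_bool (F dvd Suc t) * alive_prob h t) \<le> r R * (?A / real F)"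
    using sum_forced_le[OF h] r_R_pos by (intro mult_left_mono) auto
  moreover have "r R * (?A / real F) + r R / real F * ?D = r R / real F * (?A + ?D)"
    by (simp add: distrib_left)
  moreover have "?A + ?D = real n" by (rule alive_plus_change[OF h])
  ultimately have "r R * (\<Sum>t<n. of_bool (F dvd Suc t) * alive_prob h t) + r R / real F * ?D \<le> r R * real n / real F"
    by simp
  then show ?thesis using 1 2 by linarith
qed

lemma alive_prob_cong: "(\<And>s. 1 \<le> s \<Longrightarrow> s \<le> t \<Longrightarrow> h s = h' s) \<Longrightarrow> alive_prob h t = alive_prob h' t"
  unfolding alive_prob_def by (rule EE_channel_cong)

end

text \<open>
  In the application \<open>n\<close> is \<open>M * T\<close>, \<open>l\<close> is \<open>ln n\<close> and \<open>y\<close> is \<open>n powr \<alpha>\<close>, while \<open>e0\<close>, \<open>\<kappa>\<close>, \<open>C\<close>, \<open>z\<close>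
  and \<open>c\<close> depend only on the rates, the success probabilities and \<open>\<alpha>\<close>.
\<close>

locale tuned = cdts_run R r \<theta> Q w F b
  for R :: nat and r :: "nat \<Rightarrow> real" and \<theta> :: "nat \<Rightarrow> nat \<Rightarrow> real" and Q w F :: nat and b :: real +
  fixes J :: nat and e0 \<kappa> C z c l y n ep' :: real
  assumes n: "1 \<le> n" and l: "1 \<le> l" "l \<le> n" and ep'_def: "ep' = e0 / (2 * r R)"
    and e0: "0 < e0" and c: "1 \<le> c" and y: "1 \<le> y"
    and w_le: "real w \<le> c * l" and l_w: "l \<le> real w" and J_le: "real J \<le> c * l" and wJ: "w < J"
    and F_y: "y \<le> real F" "real F \<le> 2 * y"
    and J_large: "exp (- (real J * ep'\<^sup>2 / 4)) \<le> 1 / n ^ 5"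
    and z: "0 < z" "z \<le> 1" "z * real R \<le> ep'\<^sup>2 / 2"
    and exp_l: "exp (- (4 * l)) \<le> 1 / n ^ 4"
    and b: "0 < b" and exp_w: "exp (- (real w * b\<^sup>2)) \<le> 1 / n ^ 3"
    and sep: "\<And>q q' i. q \<in> {1..Q} \<Longrightarrow> q' \<in> {1..Q} \<Longrightarrow> q \<noteq> q' \<Longrightarrow> i \<in> {1..R} \<Longrightarrow> 2 * b \<le> \<bar>\<theta> q' i - \<theta> q i\<bar>"
    and \<kappa>: "1 \<le> \<kappa>" "\<kappa> ^ (w + 1) \<le> c * y powr (1/4)"
    and y_large: "l ^ 4 \<le> y powr (1/4)" "4 * (real R)\<^sup>2 / ep' \<le> y" "(real R)\<^sup>2 * (c * l) \<le> y"
      "16 * (c * l + 1) ^ 4 \<le> y" "2 * real R * (c * l) \<le> y" "8 * (real R * (c * l) + 4 * l / z) \<le> y"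
    and states: "\<And>q. q \<in> {1..Q} \<Longrightarrow> e0 < r (best_rate R r \<theta> q) * \<theta> q (best_rate R r \<theta> q)"
      "\<And>q k. q \<in> {1..Q} \<Longrightarrow> k \<in> {1..R} \<Longrightarrow> r k * \<theta> q k < r (best_rate R r \<theta> q) * \<theta> q (best_rate R r \<theta> q) \<Longrightarrow>
        r k * \<theta> q k \<le> r (best_rate R r \<theta> q) * \<theta> q (best_rate R r \<theta> q) - 2 * e0"
      "\<And>q k. q \<in> {1..Q} \<Longrightarrow> k \<in> {1..R} \<Longrightarrow> r k < r (best_rate R r \<theta> q) * \<theta> q (best_rate R r \<theta> q) \<Longrightarrow>
        r k \<le> r (best_rate R r \<theta> q) * \<theta> q (best_rate R r \<theta> q) - e0"
      "\<And>q k. q \<in> {1..Q} \<Longrightarrow> k \<in> {1..R} \<Longrightarrow> r (best_rate R r \<theta> q) * \<theta> q (best_rate R r \<theta> q) < r k \<Longrightarrow>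
        r (best_rate R r \<theta> q) * \<theta> q (best_rate R r \<theta> q) + e0 < r k"
      "\<And>q k. q \<in> {1..Q} \<Longrightarrow> k \<in> {1..R} \<Longrightarrow> r (best_rate R r \<theta> q) * \<theta> q (best_rate R r \<theta> q) < r k \<Longrightarrow>
        (1 - (r (best_rate R r \<theta> q) * \<theta> q (best_rate R r \<theta> q) - e0) / r k) /
        (1 - (r (best_rate R r \<theta> q) * \<theta> q (best_rate R r \<theta> q) + e0) / r k) \<le> \<kappa>"
      "\<And>q k i. q \<in> {1..Q} \<Longrightarrow> k \<in> {1..R} \<Longrightarrow> i \<in> {1..R} \<Longrightarrow>
        1 / (1 - sqrt (\<theta> q k))\<^sup>2 / 2 + 36 * (real R)\<^sup>2 / (\<theta> q i)\<^sup>2 \<le> C"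
begin

definition best_val :: "nat \<Rightarrow> real" where
  "best_val q = r (best_rate R r \<theta> q) * \<theta> q (best_rate R r \<theta> q)"

text \<open>
  The admissible cost of one block: the coherence time forces \<open>M\<^sup>2 * l * y \<le> n\<close>, so \<open>M\<close> blocks
  cost at most \<open>l * sqrt n\<close>.
\<close>

definition G :: real where "G = l * sqrt (l * y)"

lemma clean_bandit_intro:
  assumes "chan h" "\<And>t. 1 \<le> t \<Longrightarrow> t \<le> m \<Longrightarrow> h t = q" "q \<in> {1..Q}"
  shows "clean_bandit R r \<theta> Q w F h q m J e0 (best_val q) (best_rate R r \<theta> q)"
proof unfold_locales
  show "1 \<le> J" using wJ by simp
  show "r i * \<theta> q i \<le> best_val q" if "i \<in> {1..R}" for i
    unfolding best_val_def by (rule best_rate_ge[OF that])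
  show "r i * \<theta> q i \<le> best_val q - 2 * e0" if "i \<in> {1..R}" "r i * \<theta> q i < best_val q" for i
    using states(2)[OF assms(3) that(1)] that(2) by (simp add: best_val_def)
qed (use assms e0 states(1) best_rate_range in \<open>auto simp: best_val_def\<close>)

lemma n_powers: "n ^ 5 = n * n ^ 4" "n ^ 5 = n * (n * n ^ 3)" "n ^ 3 = n * n\<^sup>2" "n ^ 4 = n * n ^ 3"
  by (simp_all add: eval_nat_numeral)

lemma l_le_y: "l \<le> y"
proof -
  have "l \<le> 1 * (c * l)" using c l by simp
  also have "\<dots> \<le> (real R)\<^sup>2 * (c * l)"
    using R c l by (intro mult_right_mono) auto
  finally show ?thesis using y_large(3) by linarith
qed

lemma l2_le_G: "l\<^sup>2 \<le> G"
proof -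
  have "l * l \<le> l * y" using l l_le_y by (intro mult_left_mono) auto
  then have "l \<le> sqrt (l * y)" by (intro real_le_rsqrt) (simp add: power2_eq_square)
  then have "l * l \<le> l * sqrt (l * y)" using l by (intro mult_left_mono) auto
  then show ?thesis by (simp add: G_def power2_eq_square)
qed

lemma G_ge: "1 \<le> G" "l \<le> G"
proof -
  have "l * 1 \<le> l * l" using l by (intro mult_left_mono) auto
  then have "l \<le> l\<^sup>2" by (simp add: power2_eq_square)
  then show "l \<le> G" using l2_le_G by linarith
  then show "1 \<le> G" using l by linarith
qed

definition K1 :: real where "K1 = c + 2 * c\<^sup>2 * (r R / e0) + 12"

lemma K1_nonneg: "0 \<le> K1"
  using c e0 r_R_pos by (simp add: K1_def)

lemma ep'_pos: "0 < ep'"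
  using e0 r_R_pos by (simp add: ep'_def)

lemma exp_J_half: "exp (- (real J * ep'\<^sup>2)) \<le> exp (- (real J * ep'\<^sup>2 / 4))"
  and exp_J_quarter: "exp (- (real J * ep'\<^sup>2 / 2)) \<le> exp (- (real J * ep'\<^sup>2 / 4))"
  by (simp_all add: field_simps)

lemma clean_costs:
  assumes "chan h" "\<And>t. 1 \<le> t \<Longrightarrow> t \<le> m \<Longrightarrow> h t = q" "q \<in> {1..Q}" and m: "real m \<le> n"
  shows "real m * (real (m + 1) * exp (- (real J * ep'\<^sup>2))) \<le> 2 / n ^ 3"
    and "real J + real (J + 1) * r (best_rate R r \<theta> q) / e0 * real J + 6 * real m * (real (m + 1) * exp (- (real J * ep'\<^sup>2))) \<le> K1 * l\<^sup>2"
proof -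
  have E: "exp (- (real J * ep'\<^sup>2)) \<le> 1 / n ^ 5"
    using exp_J_half J_large by linarith
  have "real m * (real (m + 1) * exp (- (real J * ep'\<^sup>2))) \<le> n * (2 * n * (1 / n ^ 5))"
    using m n E by (intro mult_mono) auto
  also have "\<dots> = 2 / n ^ 3"
    using n by (simp add: n_powers(2))
  finally show *: "real m * (real (m + 1) * exp (- (real J * ep'\<^sup>2))) \<le> 2 / n ^ 3" .
  have n3: "1 \<le> n ^ 3" using n by (rule one_le_power)
  then have "2 / n ^ 3 \<le> 2" using n by (simp add: divide_le_eq)
  with * have del: "6 * real m * (real (m + 1) * exp (- (real J * ep'\<^sup>2))) \<le> 12" by simp
  have l1: "1 \<le> l\<^sup>2" "l \<le> l\<^sup>2"
    using l mult_left_mono[OF l(1), of l] by (auto simp: power2_eq_square one_le_power intro: order_trans)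
  have cl: "1 \<le> c * l" using c l mult_mono[of 1 c 1 l] by simp
  let ?r = "r (best_rate R r \<theta> q) / e0"
  have r: "0 \<le> ?r" "?r \<le> r R / e0"
    using r_pos[OF best_rate_range[of q]] r_le[OF best_rate_range[of q]] e0 by (auto intro: divide_right_mono)
  have "real (J + 1) * ?r * real J \<le> (2 * (c * l)) * (r R / e0) * (c * l)"
    using J_le cl r c l e0 r_R_pos by (intro mult_mono mult_nonneg_nonneg r) auto
  also have "\<dots> = 2 * c\<^sup>2 * (r R / e0) * l\<^sup>2" by (simp add: power2_eq_square)
  finally have "real (J + 1) * r (best_rate R r \<theta> q) / e0 * real J \<le> 2 * c\<^sup>2 * (r R / e0) * l\<^sup>2" by simp
  moreover have "real J \<le> c * l\<^sup>2"
    using J_le mult_left_mono[OF l1(2), of c] c by linarith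
  moreover have "12 \<le> 12 * l\<^sup>2" using l1 by simp
  ultimately show "real J + real (J + 1) * r (best_rate R r \<theta> q) / e0 * real J + 6 * real m * (real (m + 1) * exp (- (real J * ep'\<^sup>2))) \<le> K1 * l\<^sup>2"
    using del unfolding K1_def distrib_right by linarith
qed

definition thompson_cost :: "(nat \<Rightarrow> nat) \<Rightarrow> nat \<Rightarrow> nat \<Rightarrow> real" where
  "thompson_cost h q t = r R * (\<Sum>k\<in>{k \<in> {1..R}. r k * \<theta> q k < best_val q}.
     EE h t (\<lambda>hs. of_bool (alive hs \<and> \<not> F dvd Suc t) * pmf (pol hs) k))"

lemma EE_gap_le_thompson_cost:
  assumes "q \<in> {1..Q}"
  shows "EE h t (\<lambda>hs. of_bool (alive hs) * gap_rate q hs) \<le>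
    r R * (of_bool (F dvd Suc t) * alive_prob h t) + thompson_cost h q t"
proof (cases "F dvd Suc t")
  case True
  then show ?thesis using EE_alive_gap_le[OF assms, of h t] by (simp add: thompson_cost_def)
next
  case False
  let ?S = "{k \<in> {1..R}. r k * \<theta> q k < best_val q}"
  have "EE h t (\<lambda>hs. of_bool (alive hs) * gap_rate q hs) \<le>
     EE h t (\<lambda>hs. r R * (\<Sum>k\<in>?S. of_bool (alive hs \<and> \<not> F dvd Suc t) * pmf (pol hs) k))"
  proof (intro EE_mono)
    fix hs
    have "gap_rate q hs \<le> (\<Sum>k\<in>{1..R}. if r k * \<theta> q k < best_val q then r R * pmf (pol hs) k else 0)"
      unfolding gap_rate_def
    proof (intro sum_mono)
      fix k assume k: "k \<in> {1..R}"
      show "pmf (pol hs) k * best_gap R r \<theta> q k \<le> (if r k * \<theta> q k < best_val q then r R * pmf (pol hs) k else 0)"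
      proof (cases "r k * \<theta> q k < best_val q")
        case True
        then show ?thesis
          using mult_left_mono[OF best_gap_le[OF assms k], of "pmf (pol hs) k"] by (simp add: mult.commute)
      next
        case False
        then have "best_gap R r \<theta> q k = 0"
          using best_rate_ge[OF k, of q] by (simp add: best_gap_def best_val_def)
        then show ?thesis using False by simp
      qed
    qed
    also have "\<dots> = r R * (\<Sum>k\<in>?S. pmf (pol hs) k)"
      unfolding sum_distrib_left by (subst sum.inter_filter) auto
    finally show "of_bool (alive hs) * gap_rate q hs \<le> r R * (\<Sum>k\<in>?S. of_bool (alive hs \<and> \<not> F dvd Suc t) * pmf (pol hs) k)"
      using False by (cases "alive hs") simp_all
  qed
  then show ?thesis
    using False by (simp only: EE_cmult EE_sum thompson_cost_def) simp
qed

lemma sum_thompson_cost: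
  assumes hc: "chan h" "\<And>t. 1 \<le> t \<Longrightarrow> t \<le> m \<Longrightarrow> h t = q" "q \<in> {1..Q}" and mn: "real m \<le> n"
  shows "(\<Sum>t<m. thompson_cost h q t) \<le> r R * (real R * (K1 * l\<^sup>2))"
proof -
  interpret clean_bandit R r \<theta> Q w F b h q m J e0 "best_val q" "best_rate R r \<theta> q"
    by (rule clean_bandit_intro[OF hc])
  let ?S = "{k \<in> {1..R}. r k * \<theta> q k < best_val q}"
  have K: "0 \<le> K1 * l\<^sup>2" using K1_nonneg by simp
  have "(\<Sum>t<m. thompson_cost h q t) = r R * (\<Sum>k\<in>?S. \<Sum>t<m. EE h t (\<lambda>hs. of_bool (alive hs \<and> \<not> F dvd Suc t) * pmf (pol hs) k))"
    unfolding thompson_cost_def sum_distrib_left[symmetric] by (subst sum.swap) simp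
  also have "\<dots> \<le> r R * (\<Sum>k\<in>?S. K1 * l\<^sup>2)"
  proof (intro mult_left_mono sum_mono)
    fix k assume "k \<in> ?S"
    then have "(\<Sum>t<m. EE h t (\<lambda>hs. of_bool (alive hs \<and> \<not> F dvd Suc t) * pmf (pol hs) k)) \<le>
       real J + real (J + 1) * r (best_rate R r \<theta> q) / e0 * real J + 6 * real m * del"
      by (intro sum_suboptimal_le) auto
    also have "\<dots> \<le> K1 * l\<^sup>2"
      using clean_costs(2)[OF hc mn] by (simp add: del_def ep_def ep'_def)
    finally show "(\<Sum>t<m. EE h t (\<lambda>hs. of_bool (alive hs \<and> \<not> F dvd Suc t) * pmf (pol hs) k)) \<le> K1 * l\<^sup>2" .
  qed (use r_R_pos in auto)
  also have "\<dots> \<le> r R * (\<Sum>k\<in>{1..R}. K1 * l\<^sup>2)"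
    using K r_R_pos by (intro mult_left_mono sum_mono2) auto
  finally show ?thesis by simp
qed

text \<open>The factor n stands for the crude cost of a false alarm, after which every remaining
  slot is charged in full.\<close>

lemma sum_false_alarm:
  assumes hc: "chan h" "\<And>t. 1 \<le> t \<Longrightarrow> t \<le> m \<Longrightarrow> h t = q" "q \<in> {1..Q}" and mn: "real m \<le> n" and s: "s \<le> m"
  shows "n * (\<Sum>u\<in>{1..s}. change_prob h u) \<le> 4 * real R"
proof -
  interpret clean_bandit R r \<theta> Q w F b h q m J e0 "best_val q" "best_rate R r \<theta> q"
    by (rule clean_bandit_intro[OF hc])
  have "change_prob h u \<le> 4 * real R / n\<^sup>2" if "u \<in> {1..s}" for u
  proof -
    have "change_prob h u \<le> real R * (real (m + 1) * (2 * exp (- (real w * b\<^sup>2))))"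
      using that s b by (intro false_alarm) auto
    also have "\<dots> \<le> real R * (2 * n * (2 * (1 / n ^ 3)))"
      using mn n exp_w by (intro mult_left_mono mult_mono) auto
    also have "\<dots> = 4 * real R / n\<^sup>2"
      using n by (simp add: n_powers(3))
    finally show ?thesis .
  qed
  then have "(\<Sum>u\<in>{1..s}. change_prob h u) \<le> real s * (4 * real R / n\<^sup>2)"
    using sum_bounded_above[of "{1..s}" "change_prob h" "4 * real R / n\<^sup>2"] by simp
  also have "\<dots> \<le> n * (4 * real R / n\<^sup>2)"
    using s mn by (intro mult_right_mono) auto
  finally have "n * (\<Sum>u\<in>{1..s}. change_prob h u) \<le> n * (n * (4 * real R / n\<^sup>2))"
    using n by (intro mult_left_mono) auto
  also have "\<dots> = 4 * real R"
    using n by (simp add: power2_eq_square)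
  finally show ?thesis .
qed

definition K2 :: real where
  "K2 = 2 * c * (8 * (real R * c + 4 / z)) + 5 * real R"

definition K3 :: real where
  "K3 = 2 * real R * K1 + 2 * c + 6 * c * (real R)\<^sup>2 +
     c * (real R)^3 * (2 * c * c * K2 + 7 + C * sqrt (2 * c))"

context
  fixes h :: "nat \<Rightarrow> nat" and q q' m :: nat
  assumes h: "chan h" "\<And>t. 1 \<le> t \<Longrightarrow> t \<le> m \<Longrightarrow> h t = q" and q: "q \<in> {1..Q}"
    and h': "\<And>t. m < t \<Longrightarrow> h t = q'" and q': "q' \<in> {1..Q}" "q \<noteq> q'"
    and m: "real m \<le> n" "2 * (w * F) \<le> m"
begin

text \<open>Chosen so that z * eta / 4 * (m / 2) = z R J + 4 l: the first summand cancels the factor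
  exp (z R J) in \<open>rare_bound\<close>, the second leaves exp (- 4 l) \<le> 1 / n ^ 4.\<close>

definition eta :: real where "eta = 8 * (real R * real J + 4 * l / z) / real m"

lemma m_ge: "y \<le> real m" "0 < real m" "real w * real F \<le> real m" "real w * y \<le> real m"
proof -
  show wF: "real w * real F \<le> real m"
    using m(2) by (simp flip: of_nat_mult)
  have "real w * y \<le> real w * real F" using F_y by (intro mult_left_mono) auto
  then show wy: "real w * y \<le> real m" using wF by linarith
  have "1 * y \<le> real w * y" using w_pos y by (intro mult_right_mono) auto
  then show "y \<le> real m" using wy by linarith
  then show "0 < real m" using y by linarith
qed

lemma eta_bounds: "0 < eta" "eta \<le> 1" "real m * eta \<le> 8 * (real R * c + 4 / z) * l" "8 * real R \<le> eta * real m"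
proof -
  have J1: "1 \<le> real J" using wJ by simp
  have R1: "1 \<le> real R" using R by simp
  have RJ: "1 \<le> real R * real J" using J1 R1 mult_mono[of 1 "real R" 1 "real J"] by simp
  have lz: "0 < 4 * l / z" using l z by simp
  show e: "0 < eta"
    unfolding eta_def using m_ge RJ lz by (intro divide_pos_pos) auto
  have RJc: "real R * real J \<le> real R * (c * l)" using J_le by (intro mult_left_mono) auto
  have "8 * (real R * real J + 4 * l / z) \<le> 8 * (real R * (c * l) + 4 * l / z)"
    using RJc by simp
  also have "\<dots> \<le> real m" using y_large(6) m_ge by linarith
  finally show "eta \<le> 1" using m_ge by (simp add: eta_def)
  show "real m * eta \<le> 8 * (real R * c + 4 / z) * l"
  proof -
    have "real m * eta = 8 * (real R * real J + 4 * l / z)" using m_ge by (simp add: eta_def)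
    also have "\<dots> \<le> 8 * (real R * (c * l) + 4 * l / z)" using RJc by simp
    also have "\<dots> = 8 * (real R * c + 4 / z) * l" by (simp add: algebra_simps)
    finally show ?thesis .
  qed
  have em: "eta * real m = 8 * (real R * real J + 4 * l / z)" using m_ge by (simp add: eta_def)
  have "real R * 1 \<le> real R * real J" using J1 by (intro mult_left_mono) auto
  then have "8 * real R * 1 \<le> 8 * (real R * real J)" by simp
  also have "\<dots> \<le> eta * real m" unfolding em using lz by simp
  finally show e8: "8 * real R \<le> eta * real m" by simp
qed

lemma del_le: "real (m + 1) * exp (- (real J * ep'\<^sup>2)) \<le> 2 / n ^ 4"
proof -
  have "real (m + 1) * exp (- (real J * ep'\<^sup>2)) \<le> 2 * n * (1 / n ^ 5)"
    using m n order.trans[OF exp_J_half J_large] by (intro mult_mono) auto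
  also have "\<dots> = 2 / n ^ 4" using n by (simp add: n_powers(1))
  finally show ?thesis .
qed

lemma delayed_intro:
  "delayed R r \<theta> Q w F b h q m J e0 (best_val q) (best_rate R r \<theta> q) q' \<kappa> C z eta"
proof -
  interpret clean_bandit R r \<theta> Q w F b h q m J e0 "best_val q" "best_rate R r \<theta> q"
    by (rule clean_bandit_intro[OF h(1,2) q])
  have ep: "ep = ep'" by (simp add: ep_def ep'_def)
  show ?thesis
  proof unfold_locales
    show "(w + 1) * F \<le> m"
    proof -
      have "1 * F \<le> w * F" using w_pos by (intro mult_right_mono) auto
      moreover have "(w + 1) * F = w * F + 1 * F" by simp
      ultimately show ?thesis using m(2) by linarith
    qed
    show "2 * b \<le> \<bar>\<theta> q' i - \<theta> q i\<bar>" if "i \<in> {1..R}" for i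
      by (rule sep[OF q q'(1) q'(2) that])
    have "2 * real R * real J \<le> 2 * real R * (c * l)" using J_le by (intro mult_left_mono) auto
    then have "2 * real R * real J \<le> real m" using y_large(5) m_ge by linarith
    then have "real (2 * R * J) \<le> real m" by simp
    then show "2 * R * J \<le> m" by (simp only: of_nat_le_iff)
    have "4 * (real R)\<^sup>2 / ep' * real w \<le> y * real w" using y_large(2) by (intro mult_right_mono) auto
    also have "\<dots> \<le> real m" using m_ge by (simp add: mult.commute)
    finally show "4 * real R * real (R * w) \<le> ep * real m"
      unfolding ep using ep'_pos by (simp add: field_simps power2_eq_square)
    have "real w * ((real R)\<^sup>2 * real w) \<le> real w * ((real R)\<^sup>2 * (c * l))"
      using w_le by (intro mult_left_mono) auto
    also have "\<dots> \<le> real w * y" using y_large(3) by (intro mult_left_mono) auto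
    also have "\<dots> \<le> real m" by (rule m_ge)
    finally have "real ((R * w)\<^sup>2) \<le> real m" by (simp add: power2_eq_square mult_ac)
    then show "(R * w)\<^sup>2 \<le> m" by (simp only: of_nat_le_iff)
    have "(4 * (real w + 1)\<^sup>2)\<^sup>2 = 16 * (real w + 1) ^ 4" by (simp add: power_mult_distrib power_mult[symmetric])
    also have "\<dots> \<le> 16 * (c * l + 1) ^ 4" using w_le by (intro mult_left_mono power_mono) auto
    also have "\<dots> \<le> real m" using y_large(4) m_ge by linarith
    finally show "4 * (real w + 1)\<^sup>2 \<le> sqrt (real m)" by (rule real_le_rsqrt)
    have n3: "1 \<le> n ^ 3" using n by (rule one_le_power)
    have "2 * real R * del \<le> 2 * real R * (2 / n ^ 4)"
      unfolding del_def ep using del_le by (intro mult_left_mono) auto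
    also have "\<dots> \<le> 8 * real R / n"
    proof -
      have "n * 1 \<le> n * n ^ 3" using n n3 by (intro mult_left_mono) auto
      then have "1 / n ^ 4 \<le> 1 / n" using n by (intro divide_left_mono) (auto simp: n_powers(4))
      then have "4 * real R * (1 / n ^ 4) \<le> 8 * real R * (1 / n)" using n by (intro mult_mono) auto
      then show ?thesis by simp
    qed
    also have "\<dots> \<le> 8 * real R / real m" using m m_ge by (intro divide_left_mono) auto
    also have "\<dots> \<le> eta" using eta_bounds(4) m_ge by (simp add: pos_divide_le_eq)
    finally show "2 * real R * del \<le> eta" .
    show "r k \<le> best_val q - e0" if "k \<in> {1..R}" "r k < best_val q" for k
      using states(3)[OF q that(1)] that(2) by (simp add: best_val_def)
    show "best_val q + e0 < r k" if "k \<in> {1..R}" "best_val q < r k" for k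
      using states(4)[OF q that(1)] that(2) by (simp add: best_val_def)
    show "(1 - (best_val q - e0) / r k) / (1 - (best_val q + e0) / r k) \<le> \<kappa>" if "k \<in> {1..R}" "best_val q < r k" for k
      using states(5)[OF q that(1)] that(2) by (simp add: best_val_def)
  qed (use h' q' b \<kappa> wJ z eta_bounds states(6)[OF q] in auto)
qed

end

end

section \<open>Cost of the detection delay\<close>

context tuned
begin

context
  fixes h :: "nat \<Rightarrow> nat" and q q' m :: nat
  assumes h: "chan h" "\<And>t. 1 \<le> t \<Longrightarrow> t \<le> m \<Longrightarrow> h t = q" and q: "q \<in> {1..Q}"
    and h': "\<And>t. m < t \<Longrightarrow> h t = q'" and q': "q' \<in> {1..Q}" "q \<noteq> q'"
    and m: "real m \<le> n" "2 * (w * F) \<le> m"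
begin

lemma late_alive_cost: "n * alive_prob h (m + w * F) \<le> 6 * real R"
proof -
  interpret D: delayed R r \<theta> Q w F b h q m J e0 "best_val q" "best_rate R r \<theta> q" q' \<kappa> C z "eta m"
    by (rule delayed_intro[OF h q h' q' m])
  have "real (m + w * F + 1) \<le> 3 * n"
  proof -
    define d where "d = w * F"
    have "2 * d \<le> m" using m(2) by (simp add: d_def)
    then have "real m + real d + 1 \<le> 3 * n" using m(1) n by linarith
    then show ?thesis by (simp add: d_def)
  qed
  moreover have "real (w * F) \<le> n" using m by linarith
  ultimately have "alive_prob h (m + w * F) \<le> n * (real R * (3 * n * (2 * (1 / n ^ 3))))"
    using D.alive_prob_late exp_w n
    by (elim order_trans) (intro mult_mono mult_nonneg_nonneg; simp)
  also have "\<dots> = 6 * real R / n"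
    using n by (simp add: n_powers(3) power2_eq_square)
  finally have "n * alive_prob h (m + w * F) \<le> n * (6 * real R / n)"
    using n by (intro mult_left_mono) auto
  then show ?thesis using n by simp
qed

lemma w_bounds: "real (w + 1) \<le> 2 * (c * l)"
  using w_le w_pos by simp

text \<open>A run still alive R w slots after the change is charged w F more slots, a number of
  order l y. The order G comes from the case of a tie: w F / sqrt m \<le> sqrt (w F), times the R w
  slots in which a newcomer can be chosen.\<close>

lemma delay_cost: "real (w * F) * alive_prob h (m + R * w) \<le> K3 * G"
proof -
  interpret D: delayed R r \<theta> Q w F b h q m J e0 "best_val q" "best_rate R r \<theta> q" q' \<kappa> C z "eta m"
    by (rule delayed_intro[OF h q h' q' m])
  have ep: "D.ep = ep'" by (simp add: D.ep_def ep'_def)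
  note mg = m_ge[OF h q h' q' m]
  note eb = eta_bounds[OF h q h' q' m]
  define D0 where "D0 = real (w * F)"
  define K where "K = real (R * w)"
  have D0: "0 \<le> D0" "D0 \<le> real m" "D0 \<le> n" "D0 \<le> 2 * c * (l * y)"
  proof -
    show "0 \<le> D0" by (simp add: D0_def)
    show "D0 \<le> real m" using mg(3) by (simp add: D0_def)
    then show "D0 \<le> n" using m(1) by linarith
    have "D0 \<le> (c * l) * (2 * y)"
      unfolding D0_def of_nat_mult using w_le F_y c l by (intro mult_mono) auto
    then show "D0 \<le> 2 * c * (l * y)" by (simp add: mult_ac)
  qed
  have Kle: "K \<le> real m" "0 \<le> K" "K \<le> c * real R * l"
  proof -
    have "1 \<le> R * w" using R w_pos by (cases R; cases w) auto
    then have "R * w \<le> (R * w)\<^sup>2" by (intro self_le_power) auto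
    then have "R * w \<le> m" using D.K_m(2) by (rule order.trans)
    then show "K \<le> real m" unfolding K_def by (simp only: of_nat_le_iff)
    show "0 \<le> K" by (simp add: K_def)
    have "real R * real w \<le> real R * (c * l)" using w_le by (intro mult_left_mono) auto
    then show "K \<le> c * real R * l" by (simp add: K_def mult_ac)
  qed
  have mK: "real (m + R * w + 1) \<le> 3 * n"
    using Kle(1) m(1) n unfolding K_def by simp
  have K1: "0 \<le> K1" by (rule K1_nonneg)
  have G1: "1 \<le> G" "l \<le> G" "l\<^sup>2 \<le> G" using G_ge l2_le_G by auto
  have C0: "0 \<le> C"
    using states(6)[OF q best_rate_range best_rate_range] by (rule order_trans[rotated]) simp
  have n3: "1 \<le> n ^ 3" using n by (rule one_le_power)
  have n4: "1 \<le> n ^ 4" using n by (rule one_le_power)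
  have del: "D.del \<le> 2 / n ^ 4"
    unfolding D.del_def ep by (rule del_le[OF h q h' q' m])
  have del2: "D.del2 \<le> 3 / n ^ 4"
  proof -
    have "D.del2 \<le> 3 * n * (1 / n ^ 5)"
      unfolding D.del2_def ep using mK J_large n by (intro mult_mono) auto
    then show ?thesis using n by (simp add: n_powers(1))
  qed
  have nh: "D0 * EE h m (\<lambda>g. of_bool (D.no_heavy g)) \<le> (2 * real R * K1 + 2 * c) * G"
  proof -
    let ?Dd = "real J + real (J + 1) * r (best_rate R r \<theta> q) / e0 * real J + 6 * real m * D.del"
    have Dd: "?Dd \<le> K1 * l\<^sup>2"
      using clean_costs(2)[OF h q m(1)] by (simp add: D.del_def ep)
    have "EE h m (\<lambda>g. of_bool (D.no_heavy g)) \<le> 2 / real m * (real R * ?Dd) + 2 / real F"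
      by (rule D.EE_no_heavy)
    also have "\<dots> \<le> 2 / real m * (real R * (K1 * l\<^sup>2)) + 2 / real F"
      using Dd by (intro add_right_mono mult_left_mono) auto
    finally have "D0 * EE h m (\<lambda>g. of_bool (D.no_heavy g)) \<le> D0 * (2 / real m * (real R * (K1 * l\<^sup>2)) + 2 / real F)"
      using D0 by (intro mult_left_mono) auto
    also have "\<dots> = D0 / real m * (2 * real R * K1 * l\<^sup>2) + 2 * real w"
      using F_ge by (simp add: D0_def distrib_left)
    also have "\<dots> \<le> 1 * (2 * real R * K1 * l\<^sup>2) + 2 * (c * l)"
      using D0 mg(2) K1 w_le by (intro add_mono mult_right_mono mult_left_mono) auto
    also have "\<dots> \<le> 2 * real R * K1 * G + 2 * c * G"
      using G1 K1 c by (simp add: mult_left_mono add_mono)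
    finally show ?thesis by (simp add: distrib_right)
  qed
  have sec: "D0 * (K * (real R * (real (m + R * w + 1) * (2 * exp (- (real w * b\<^sup>2)))))) \<le> 6 * c * (real R)\<^sup>2 * G"
  proof -
    have "D0 * (K * (real R * (real (m + R * w + 1) * (2 * exp (- (real w * b\<^sup>2)))))) \<le>
      n * ((c * real R * l) * (real R * (3 * n * (2 * (1 / n ^ 3)))))"
      using D0 Kle mK exp_w n c l by (intro mult_mono mult_nonneg_nonneg) auto
    also have "\<dots> = 6 * c * (real R)\<^sup>2 * (l / n)"
      using n by (simp add: n_powers(3) power2_eq_square)
    also have "\<dots> \<le> 6 * c * (real R)\<^sup>2 * G"
    proof (intro mult_left_mono)
      have "l / n \<le> 1" using l n by simp
      then show "l / n \<le> G" using G1 by linarith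
    qed (use c in auto)
    finally show ?thesis .
  qed
  have rare: "D0 * D.rare_bound \<le> K2 * l\<^sup>2"
  proof -
    have half: "real m / 2 \<le> real (m - m div F)"
    proof -
      have "real (m div F) \<le> real m / real F" by (rule of_nat_div_le_of_nat)
      also have "\<dots> \<le> real m / 2" using F_ge by (intro divide_left_mono) auto
      finally show ?thesis by (simp add: of_nat_diff)
    qed
    have em: "eta m * real m = 8 * (real R * real J + 4 * l / z)"
      using mg(2) by (simp add: eta_def[OF h q h' q' m])
    have "z * eta m / 4 * (real m / 2) = z / 8 * (eta m * real m)" by simp
    also have "\<dots> = z * (real R * real J) + 4 * l"
      unfolding em using z by (simp add: distrib_left)
    finally have "z * (real R * real J) + 4 * l \<le> z * eta m / 4 * real (m - m div F)"
      using half z eb by (metis (no_types, lifting) divide_nonneg_nonneg less_eq_real_def mult_left_mono mult_nonneg_nonneg zero_le_numeral)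
    then have "exp (z * real (R * J)) * exp (- (z * eta m / 4 * real (m - m div F))) \<le> exp (- (4 * l))"
      unfolding exp_add[symmetric] by simp
    also have "\<dots> \<le> 1 / n ^ 4" by (rule exp_l)
    finally have 1: "exp (z * real (R * J)) * exp (- (z * eta m / 4 * real (m - m div F))) \<le> 1 / n ^ 4" .
    have "z * real R * real J \<le> ep'\<^sup>2 / 2 * real J"
      using z by (intro mult_right_mono) auto
    then have "exp (z * real (R * J)) * exp (- (real J * ep'\<^sup>2)) \<le> exp (- (real J * ep'\<^sup>2 / 2))"
      unfolding exp_add[symmetric] by (simp add: mult_ac)
    also have "\<dots> \<le> 1 / n ^ 5" using exp_J_quarter J_large by linarith
    finally have e5: "exp (z * real (R * J)) * exp (- (real J * ep'\<^sup>2)) \<le> 1 / n ^ 5" .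
    have "exp (z * real (R * J)) * (2 * real m * real R * D.del) =
       2 * real m * real R * real (m + 1) * (exp (z * real (R * J)) * exp (- (real J * ep'\<^sup>2)))"
      by (simp add: D.del_def ep)
    also have "\<dots> \<le> 2 * n * real R * (2 * n) * (1 / n ^ 5)"
      using m n e5 mg mg(2) by (intro mult_mono mult_nonneg_nonneg) auto
    also have "\<dots> = 4 * real R / n ^ 3"
      using n by (simp add: n_powers(2))
    finally have 2: "exp (z * real (R * J)) * (2 * real m * real R * D.del) \<le> 4 * real R / n ^ 3" .
    have "D.rare_bound \<le> real (w + 1) * eta m + (1 / n ^ 4 + 4 * real R / n ^ 3)"
      unfolding D.rare_bound_def distrib_left[of "exp (z * real (R * J))"]
      using 1 2 by (intro add_mono) auto
    then have "D0 * D.rare_bound \<le> D0 * (real (w + 1) * eta m) + D0 * (1 / n ^ 4 + 4 * real R / n ^ 3)"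
      unfolding distrib_left[symmetric] using D0 by (intro mult_left_mono) auto
    also have "D0 * (real (w + 1) * eta m) \<le> real m * (2 * (c * l) * eta m)"
      using D0 w_bounds eb c l by (intro mult_mono mult_nonneg_nonneg) auto
    also have "\<dots> = 2 * (c * l) * (real m * eta m)" by simp
    also have "\<dots> \<le> 2 * (c * l) * (8 * (real R * c + 4 / z) * l)"
      using eb c l by (intro mult_left_mono) auto
    also have "\<dots> = 2 * c * (8 * (real R * c + 4 / z)) * l\<^sup>2"
      by (simp add: power2_eq_square)
    also have "D0 * (1 / n ^ 4 + 4 * real R / n ^ 3) \<le> n * (1 / n ^ 4 + 4 * real R / n ^ 3)"
      using D0 n by (intro mult_right_mono) auto
    also have "\<dots> \<le> 5 * real R * l\<^sup>2"
    proof -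
      have "1 \<le> n\<^sup>2" using n by (rule one_le_power)
      then have "1 / n\<^sup>2 \<le> 1 / 1" by (intro frac_le) auto
      moreover have "1 / n ^ 3 \<le> 1 / 1" using n3 by (intro frac_le) auto
      ultimately have "1 / n ^ 3 + 4 * real R * (1 / n\<^sup>2) \<le> 1 + 4 * real R * 1"
        by (intro add_mono mult_left_mono) auto
      also have "\<dots> \<le> 5 * real R * 1" using R by simp
      also have "\<dots> \<le> 5 * real R * l\<^sup>2" using l by (intro mult_left_mono) (auto intro: one_le_power)
      finally show ?thesis using n by (simp add: distrib_left n_powers(3,4))
    qed
    finally show ?thesis by (simp add: K2_def distrib_right)
  qed
  have K2: "0 \<le> K2" using c z by (simp add: K2_def)
  define \<zeta> where "\<zeta> = real (w + 1) * \<kappa> ^ (w + 1) * D.rare_bound + 2 * D.del + D.del2 + C / sqrt (real m)"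
  have lz: "D0 * \<zeta> * l \<le> (2 * c * c * K2 + 7 + C * sqrt (2 * c)) * G"
  proof -
    let ?y4 = "y powr (1/4)"
    have "D0 * \<zeta> = real (w + 1) * \<kappa> ^ (w + 1) * (D0 * D.rare_bound) + D0 * (2 * D.del + D.del2) + D0 * (C / sqrt (real m))"
      by (simp add: \<zeta>_def algebra_simps)
    then have split: "D0 * \<zeta> * l = real (w + 1) * \<kappa> ^ (w + 1) * (D0 * D.rare_bound) * l + D0 * (2 * D.del + D.del2) * l + D0 * (C / sqrt (real m)) * l"
      by (simp add: distrib_right)
    have "real (w + 1) * \<kappa> ^ (w + 1) * (D0 * D.rare_bound) * l \<le> (2 * (c * l)) * (c * ?y4) * (K2 * l\<^sup>2) * l"
      by (rule mult_right_mono[OF mult_mono[OF mult_mono[OF w_bounds \<kappa>(2)] rare]])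
         (use \<kappa> c l K2 D0 D.rare_bound_nonneg in \<open>auto intro!: mult_nonneg_nonneg\<close>)
    \<comment> \<open>Beyond the target order only logarithms and \<kappa> ^ (w + 1) remain; each
      takes at most y powr (1/4), together sqrt y.\<close>
    also have "\<dots> = 2 * c * c * K2 * (?y4 * l ^ 4)"
      by (simp add: eval_nat_numeral)
    also have "\<dots> \<le> 2 * c * c * K2 * (?y4 * ?y4)"
      using c K2 y_large(1) by (intro mult_left_mono) auto
    also have "?y4 * ?y4 = sqrt y"
      using y by (simp add: powr_add[symmetric] powr_half_sqrt)
    also have "2 * c * c * K2 * sqrt y \<le> 2 * c * c * K2 * G"
    proof (intro mult_left_mono)
      have "1 * y \<le> l * y" using l y by (intro mult_right_mono) auto
      then have "sqrt y \<le> sqrt (l * y)" by simp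
      also have "1 * sqrt (l * y) \<le> l * sqrt (l * y)" using l y by (intro mult_right_mono) auto
      finally show "sqrt y \<le> G" by (simp add: G_def)
    qed (use c K2 in auto)
    finally have t1: "real (w + 1) * \<kappa> ^ (w + 1) * (D0 * D.rare_bound) * l \<le> 2 * c * c * K2 * G" .
    have t2: "D0 * (2 * D.del + D.del2) * l \<le> 7 * G"
    proof -
      have "2 * D.del + D.del2 \<le> 7 / n ^ 4" using del del2 by simp
      then have "D0 * (2 * D.del + D.del2) * l \<le> n * (7 / n ^ 4) * n"
        using D0 l n D.del_pos D.del2_nonneg by (intro mult_mono mult_nonneg_nonneg) auto
      also have "\<dots> = 7 / n\<^sup>2" using n by (simp add: n_powers(3,4))
      also have "\<dots> \<le> 7" using n one_le_power[of n 2] by (simp add: divide_le_eq)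
      also have "\<dots> \<le> 7 * G" using G1 by simp
      finally show ?thesis .
    qed
    have t3: "D0 * (C / sqrt (real m)) * l \<le> C * sqrt (2 * c) * G"
    proof -
      have "D0 / sqrt (real m) \<le> sqrt D0"
      proof -
        have "D0 = sqrt D0 * sqrt D0" using D0 by simp
        also have "\<dots> \<le> sqrt D0 * sqrt (real m)" using D0 by (intro mult_left_mono) auto
        finally show ?thesis using mg(2) by (simp add: pos_divide_le_eq)
      qed
      also have "sqrt D0 \<le> sqrt (2 * c * (l * y))" using D0 by simp
      also have "\<dots> = sqrt (2 * c) * sqrt (l * y)" by (rule real_sqrt_mult)
      finally have "C * l * (D0 / sqrt (real m)) \<le> C * l * (sqrt (2 * c) * sqrt (l * y))"
        using C0 l by (intro mult_left_mono) auto
      then show ?thesis by (simp add: G_def mult_ac)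
    qed
    show ?thesis unfolding split using t1 t2 t3 by (simp add: distrib_right)
  qed
  have z0: "0 \<le> \<zeta>"
    unfolding \<zeta>_def using \<kappa>(1) D.rare_bound_nonneg D.del_pos D.del2_nonneg C0
    by (intro add_nonneg_nonneg mult_nonneg_nonneg) auto
  have third: "D0 * (K * (real R * (real R * \<zeta>))) \<le> c * (real R)^3 * ((2 * c * c * K2 + 7 + C * sqrt (2 * c)) * G)"
  proof -
    have "D0 * (K * (real R * (real R * \<zeta>))) = K * ((real R)\<^sup>2 * (D0 * \<zeta>))"
      by (simp add: power2_eq_square mult_ac)
    also have "\<dots> \<le> (c * real R * l) * ((real R)\<^sup>2 * (D0 * \<zeta>))"
      using Kle D0 z0 by (intro mult_right_mono mult_nonneg_nonneg) auto
    also have "\<dots> = c * (real R)^3 * (D0 * \<zeta> * l)"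
      by (simp add: eval_nat_numeral mult_ac)
    also have "\<dots> \<le> c * (real R)^3 * ((2 * c * c * K2 + 7 + C * sqrt (2 * c)) * G)"
      using lz c by (intro mult_left_mono) auto
    finally show ?thesis .
  qed
  have "alive_prob h (m + R * w) \<le> EE h m (\<lambda>g. of_bool (D.no_heavy g)) +
    real (R * w) * (real R * (real (m + R * w + 1) * (2 * exp (- (real w * b\<^sup>2))))) + real (R * w) * (real R * (real R * \<zeta>))"
    unfolding \<zeta>_def by (rule D.alive_prob_delay) (rule D.EE_newcomer)
  then have "D0 * alive_prob h (m + R * w) \<le> D0 * (EE h m (\<lambda>g. of_bool (D.no_heavy g)) +
    K * (real R * (real (m + R * w + 1) * (2 * exp (- (real w * b\<^sup>2))))) + K * (real R * (real R * \<zeta>)))"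
    unfolding K_def using D0 by (intro mult_left_mono) auto
  also have "\<dots> = D0 * EE h m (\<lambda>g. of_bool (D.no_heavy g)) +
    D0 * (K * (real R * (real (m + R * w + 1) * (2 * exp (- (real w * b\<^sup>2)))))) + D0 * (K * (real R * (real R * \<zeta>)))"
    by (simp only: distrib_left)
  also have "\<dots> \<le> (2 * real R * K1 + 2 * c) * G + 6 * c * (real R)\<^sup>2 * G + c * (real R)^3 * ((2 * c * c * K2 + 7 + C * sqrt (2 * c)) * G)"
    by (intro add_mono nh sec third)
  also have "\<dots> = K3 * G"
    by (simp add: K3_def distrib_right)
  finally show ?thesis by (simp add: D0_def)
qed

end

section \<open>Regret of single blocks and induction over the blocks\<close>

definition KB :: real where "KB = r R * (real R * K1 + real R * c + K3 + 16 * real R)"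

text \<open>Only false alarms can end the cycle here, and they are rare enough for the crude bound
  on everything after them.\<close>

lemma last_block:
  assumes h: "chan h" "\<And>t. 1 \<le> t \<Longrightarrow> t \<le> N \<Longrightarrow> h t = q" "q \<in> {1..Q}" and N: "real N \<le> n"
  shows "regret R r \<theta> h pol N \<le> r R * real N / real F + r R * (real R * (K1 * l\<^sup>2) + 4 * real R)"
proof -
  have "regret R r \<theta> h pol N \<le> 0 + r R * real N / real F + (\<Sum>t<N. thompson_cost h q t) + (\<Sum>s\<in>{1..N}. change_prob h s * (r R * n))"
  proof (rule renewal_bound[OF h(1)])
    fix t assume "t < N"
    then show "EE h t (\<lambda>hs. of_bool (alive hs) * gap_rate (h (Suc t)) hs) \<le> r R * (of_bool (F dvd Suc t) * alive_prob h t) + thompson_cost h q t"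
      using EE_gap_le_thompson_cost[OF h(3), of h t] h(2)[of "Suc t"] by simp
  next
    fix s assume s: "1 \<le> s" "s \<le> N"
    have "chan (\<lambda>t. h (s + t))" using h(1) by (simp add: chan_def)
    then have "regret R r \<theta> (\<lambda>t. h (s + t)) pol (N - s) \<le> r R * real (N - s)" by (rule regret_le)
    also have "\<dots> \<le> r R * n" using N r_R_pos by (intro mult_left_mono) auto
    also have "\<dots> \<le> 0 + r R * real (N - s) / real F + r R * n" using r_R_pos by simp
    finally show "regret R r \<theta> (\<lambda>t. h (s + t)) pol (N - s) \<le> 0 + r R * real (N - s) / real F + r R * n" .
  qed simp
  also have "(\<Sum>s\<in>{1..N}. change_prob h s * (r R * n)) = r R * (n * (\<Sum>s\<in>{1..N}. change_prob h s))"
    by (simp add: sum_distrib_left sum_distrib_right mult_ac)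
  also have "\<dots> \<le> r R * (4 * real R)"
    using sum_false_alarm[OF h N, of N] r_R_pos by (intro mult_left_mono) auto
  also have "(\<Sum>t<N. thompson_cost h q t) \<le> r R * (real R * (K1 * l\<^sup>2))"
    by (rule sum_thompson_cost[OF h N])
  finally show ?thesis by (simp add: distrib_left)
qed

text \<open>A restart up to slot m is a false alarm, one after m + w F a failure of detection by
  forced slots; both are unlikely enough for the crude bound. Only restarts in between use the bound
  \<open>cont\<close> for the remaining blocks.\<close>

lemma change_block:
  assumes h: "chan h" and q: "q \<in> {1..Q}" "q' \<in> {1..Q}" "q \<noteq> q'"
    and hq: "\<And>t. 1 \<le> t \<Longrightarrow> t \<le> m \<Longrightarrow> h t = q"
    and hq': "\<And>t. m < t \<Longrightarrow> t \<le> N \<Longrightarrow> t \<le> m + w * F \<Longrightarrow> h t = q'"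
    and m: "m < N" "2 * (w * F) \<le> m" and N: "real N \<le> n" and U: "0 \<le> U"
    and cont: "\<And>s. m < s \<Longrightarrow> s \<le> N \<Longrightarrow> s \<le> m + w * F \<Longrightarrow>
      regret R r \<theta> (\<lambda>t. h (s + t)) pol (N - s) \<le> U + r R * real (N - s) / real F"
  shows "regret R r \<theta> h pol N \<le> U + r R * real N / real F +
    r R * (real R * (K1 * l\<^sup>2) + real R * (c * l) + K3 * G + 16 * real R)"
proof -
  \<comment> \<open>The channel may change again later. h2 keeps the second state forever, as the
    two-phase bounds demand, and agrees with h on the slots that matter.\<close>
  define h2 where "h2 t = (if t \<le> m then q else q')" for t
  have h2: "chan h2" using q by (auto simp: chan_def h2_def)
  have h2q: "\<And>t. 1 \<le> t \<Longrightarrow> t \<le> m \<Longrightarrow> h2 t = q" and h2q': "\<And>t. m < t \<Longrightarrow> h2 t = q'"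
    by (auto simp: h2_def)
  have mn: "real m \<le> n" using m N by linarith
  have agree: "alive_prob h t = alive_prob h2 t" if "t \<le> N" "t \<le> m + w * F" for t
    using that hq hq' by (intro alive_prob_cong) (auto simp: h2_def)
  define PK where "PK = alive_prob h2 (m + R * w)"
  define PD where "PD = alive_prob h2 (m + w * F)"
  have PD: "n * PD \<le> 6 * real R"
    unfolding PD_def by (rule late_alive_cost[OF h2 h2q q(1) h2q' q(2,3) mn m(2)])
  have PK: "real (w * F) * PK \<le> K3 * G"
    unfolding PK_def by (rule delay_cost[OF h2 h2q q(1) h2q' q(2,3) mn m(2)])
  have P0: "0 \<le> PK" "0 \<le> PD" by (simp_all add: PK_def PD_def alive_prob_nonneg)
  let ?c = "\<lambda>t. if t < m then thompson_cost h q t else r R * alive_prob h t"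
  let ?V = "\<lambda>s. if s \<le> m \<or> m + w * F < s then r R * n else 0"
  have "regret R r \<theta> h pol N \<le> U + r R * real N / real F + (\<Sum>t<N. ?c t) + (\<Sum>s\<in>{1..N}. change_prob h s * ?V s)"
  proof (rule renewal_bound[OF h _ _ U])
    fix t assume "t < N"
    show "EE h t (\<lambda>hs. of_bool (alive hs) * gap_rate (h (Suc t)) hs) \<le> r R * (of_bool (F dvd Suc t) * alive_prob h t) + ?c t"
    proof (cases "t < m")
      case True
      then show ?thesis
        using EE_gap_le_thompson_cost[OF q(1), of h t] hq[of "Suc t"] by simp
    next
      case False
      have "0 \<le> r R * (of_bool (F dvd Suc t) * alive_prob h t)"
        using r_R_pos alive_prob_nonneg by (intro mult_nonneg_nonneg) auto
      then show ?thesis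
        using EE_alive_gap_le[OF chanD[OF h, of "Suc t"], of h t] False by simp
    qed
  next
    fix s assume s: "1 \<le> s" "s \<le> N"
    show "regret R r \<theta> (\<lambda>t. h (s + t)) pol (N - s) \<le> U + r R * real (N - s) / real F + ?V s"
    proof (cases "s \<le> m \<or> m + w * F < s")
      case True
      have "chan (\<lambda>t. h (s + t))" using h by (simp add: chan_def)
      then have "regret R r \<theta> (\<lambda>t. h (s + t)) pol (N - s) \<le> r R * real (N - s)" by (rule regret_le)
      also have "\<dots> \<le> r R * n" using N r_R_pos by (intro mult_left_mono) auto
      also have "\<dots> \<le> U + r R * real (N - s) / real F + r R * n" using r_R_pos U by simp
      finally show ?thesis using True by simp
    next
      case False
      then show ?thesis using cont[of s] s by simp
    qed
  qed
  moreover have "(\<Sum>t<N. ?c t) \<le> r R * (real R * (K1 * l\<^sup>2) + real R * (c * l) + K3 * G + 6 * real R)"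
  proof -
    have "(\<Sum>t<N. ?c t) = (\<Sum>t<m. ?c t) + (\<Sum>t\<in>{m..<N}. ?c t)"
      using m by (simp add: sum.atLeastLessThan_concat[of 0 m N, symmetric] flip: atLeast0LessThan)
    also have "(\<Sum>t<m. ?c t) = (\<Sum>t<m. thompson_cost h q t)" by (intro sum.cong) auto
    also have "\<dots> \<le> r R * (real R * (K1 * l\<^sup>2))"
      using hq by (intro sum_thompson_cost h q(1) mn) auto
    also have "(\<Sum>t\<in>{m..<N}. ?c t) = r R * (\<Sum>t\<in>{m..<N}. alive_prob h t)"
      unfolding sum_distrib_left by (intro sum.cong) auto
    \<comment> \<open>The first R w slots after the change are counted in full, those up to m + w F
      with the probability PK of a delayed detection, and all later ones with PD.\<close>
    also have "(\<Sum>t\<in>{m..<N}. alive_prob h t) \<le> (\<Sum>t\<in>{m..<N}. of_bool (t < m + R * w) + of_bool (t < m + w * F) * PK + PD)"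
    proof (intro sum_mono)
      fix t assume t: "t \<in> {m..<N}"
      show "alive_prob h t \<le> of_bool (t < m + R * w) + of_bool (t < m + w * F) * PK + PD"
      proof (cases "t < m + R * w")
        case True
        have "alive_prob h t \<le> alive_prob h 0" by (rule alive_prob_antimono[OF h]) simp
        moreover have "0 \<le> of_bool (t < m + w * F) * PK" using P0 by simp
        ultimately show ?thesis using True P0 by simp
      next
        case False
        show ?thesis
        proof (cases "t < m + w * F")
          case True
          have "alive_prob h t = alive_prob h2 t" using t True by (intro agree) auto
          also have "\<dots> \<le> PK" unfolding PK_def using False by (intro alive_prob_antimono h2) auto
          finally show ?thesis using True P0 by simp
        next
          case F2: False
          have "alive_prob h t \<le> alive_prob h (m + w * F)" using F2 by (intro alive_prob_antimono h) auto
          also have "\<dots> = PD" unfolding PD_def using F2 t by (intro agree) auto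
          finally show ?thesis using P0 F2 by simp
        qed
      qed
    qed
    also have "\<dots> = (\<Sum>t\<in>{m..<N}. of_bool (t < m + R * w)) + (\<Sum>t\<in>{m..<N}. of_bool (t < m + w * F)) * PK + real (N - m) * PD"
      by (simp only: sum.distrib sum_distrib_right sum_constant card_atLeastLessThan)
    also have "\<dots> \<le> real R * (c * l) + K3 * G + 6 * real R"
    proof -
      have cnt: "(\<Sum>t\<in>{m..<N}. of_bool (t < m + k)) \<le> real k" for k
      proof -
        have "(\<Sum>t\<in>{m..<N}. of_bool (t < m + k)) = real (card ({m..<N} \<inter> {t. t < m + k}))" by simp
        also have "\<dots> \<le> real (card {m..<m + k})"
          by (intro of_nat_mono card_mono) auto
        finally show ?thesis by simp
      qed
      have "(\<Sum>t\<in>{m..<N}. of_bool (t < m + R * w)) \<le> real (R * w)" by (rule cnt)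
      also have "\<dots> \<le> real R * (c * l)" unfolding of_nat_mult using w_le by (intro mult_left_mono) auto
      finally have 1: "(\<Sum>t\<in>{m..<N}. of_bool (t < m + R * w)) \<le> real R * (c * l)" .
      have "(\<Sum>t\<in>{m..<N}. of_bool (t < m + w * F)) * PK \<le> real (w * F) * PK"
        by (intro mult_right_mono cnt P0)
      then have 2: "(\<Sum>t\<in>{m..<N}. of_bool (t < m + w * F)) * PK \<le> K3 * G" using PK by linarith
      have "real (N - m) * PD \<le> n * PD" using N P0 by (intro mult_right_mono) auto
      then show ?thesis using 1 2 PD by linarith
    qed
    finally have "(\<Sum>t<N. ?c t) \<le> r R * (real R * (K1 * l\<^sup>2)) + r R * (real R * (c * l) + K3 * G + 6 * real R)"
      using r_R_pos by (simp add: mult_left_mono)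
    then show ?thesis by (simp add: distrib_left)
  qed
  moreover have "(\<Sum>s\<in>{1..N}. change_prob h s * ?V s) \<le> r R * (10 * real R)"
  proof -
    have "(\<Sum>s\<in>{1..N}. change_prob h s * ?V s) = (\<Sum>s\<in>{1..N}. if s \<le> m \<or> m + w * F < s then change_prob h s * (r R * n) else 0)"
      by (intro sum.cong) auto
    also have "\<dots> = (\<Sum>s\<in>{s \<in> {1..N}. s \<le> m \<or> m + w * F < s}. change_prob h s * (r R * n))"
      by (rule sum.inter_filter[symmetric]) simp
    also have "{s \<in> {1..N}. s \<le> m \<or> m + w * F < s} = {1..m} \<union> {m + w * F<..N}"
      using m by auto
    also have "(\<Sum>s\<in>{1..m} \<union> {m + w * F<..N}. change_prob h s * (r R * n)) =
       r R * (n * (\<Sum>s\<in>{1..m}. change_prob h s) + n * (\<Sum>s\<in>{m + w * F<..N}. change_prob h s))"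
      by (subst sum.union_disjoint) (auto simp: sum_distrib_left sum_distrib_right distrib_left mult_ac)
    also have "\<dots> \<le> r R * (4 * real R + 6 * real R)"
    proof (intro mult_left_mono add_mono)
      show "n * (\<Sum>s\<in>{1..m}. change_prob h s) \<le> 4 * real R"
        using hq by (intro sum_false_alarm[of h m q] h q(1) mn) auto
      show "n * (\<Sum>s\<in>{m + w * F<..N}. change_prob h s) \<le> 6 * real R"
      proof (cases "m + w * F \<le> N")
        case True
        have "(\<Sum>s\<in>{m + w * F<..N}. change_prob h s) \<le> alive_prob h (m + w * F)"
          using sum_change_prob[OF h True] alive_prob_nonneg[of h N] by simp
        also have "\<dots> = PD" unfolding PD_def using True by (intro agree) auto
        finally have "n * (\<Sum>s\<in>{m + w * F<..N}. change_prob h s) \<le> n * PD"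
          using n by (intro mult_left_mono) auto
        then show ?thesis using PD by linarith
      qed auto
    qed (use r_R_pos in auto)
    finally show ?thesis by simp
  qed
  ultimately have "regret R r \<theta> h pol N \<le> U + r R * real N / real F +
     (r R * (real R * (K1 * l\<^sup>2) + real R * (c * l) + K3 * G + 6 * real R) + r R * (10 * real R))"
    by linarith
  then show ?thesis by (simp add: algebra_simps)
qed

lemma KB_bounds:
  assumes "1 \<le> Q"
  shows "r R * (real R * (K1 * l\<^sup>2) + real R * (c * l) + K3 * G + 16 * real R) \<le> KB * G"
    and "r R * (real R * (K1 * l\<^sup>2) + 4 * real R) \<le> KB * G" and "0 \<le> KB"
proof -
  have "1 \<in> {1..Q}" using assms by simp
  then have "1 / (1 - sqrt (\<theta> 1 (best_rate R r \<theta> 1)))\<^sup>2 / 2 + 36 * (real R)\<^sup>2 / (\<theta> 1 (best_rate R r \<theta> 1))\<^sup>2 \<le> C"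
    by (intro states(6) best_rate_range)
  moreover have "0 \<le> 1 / (1 - sqrt (\<theta> 1 (best_rate R r \<theta> 1)))\<^sup>2 / 2 + 36 * (real R)\<^sup>2 / (\<theta> 1 (best_rate R r \<theta> 1))\<^sup>2"
    by simp
  ultimately have C0: "0 \<le> C" by linarith
  have "0 \<le> K2" using c z by (simp add: K2_def)
  then have K3: "0 \<le> K3" using K1_nonneg c C0 by (simp add: K3_def)
  have 1: "real R * (K1 * l\<^sup>2) \<le> real R * (K1 * G)"
    using l2_le_G K1_nonneg by (intro mult_left_mono) auto
  have 2: "real R * (c * l) \<le> real R * (c * G)"
    using G_ge c by (intro mult_left_mono) auto
  have 3: "16 * real R \<le> 16 * real R * G"
    using mult_left_mono[OF G_ge(1), of "16 * real R"] by simp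
  have "real R * (K1 * l\<^sup>2) + real R * (c * l) + K3 * G + 16 * real R \<le> (real R * K1 + real R * c + K3 + 16 * real R) * G"
    using 1 2 3 by (simp add: distrib_right)
  then show *: "r R * (real R * (K1 * l\<^sup>2) + real R * (c * l) + K3 * G + 16 * real R) \<le> KB * G"
    unfolding KB_def mult.assoc using r_R_pos by (intro mult_left_mono) auto
  have "0 \<le> real R * (c * l) + K3 * G + 12 * real R"
    using c l K3 G_ge by simp
  then have "r R * (real R * (K1 * l\<^sup>2) + 4 * real R) \<le> r R * (real R * (K1 * l\<^sup>2) + real R * (c * l) + K3 * G + 16 * real R)"
    using r_R_pos by (intro mult_left_mono) auto
  then show "r R * (real R * (K1 * l\<^sup>2) + 4 * real R) \<le> KB * G" using * by linarith
  show "0 \<le> KB"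
    using r_R_pos K1_nonneg K3 c by (simp add: KB_def)
qed

lemma tuned_regret:
  assumes h: "chan h" and bf: "block_fading Q T M L \<nu> h" and T: "real T \<le> n" and L: "3 * (w * F) \<le> L"
  shows "regret R r \<theta> h pol T \<le> real (M + 1) * (KB * G) + r R * real T / real F"
proof -
  have nu0: "\<nu> 0 = 1" and nuT: "\<nu> (M + 1) = T + 1"
    and nu_less: "\<And>m. m \<le> M \<Longrightarrow> \<nu> m < \<nu> (m + 1)"
    and h_block: "\<And>m t. m \<le> M \<Longrightarrow> \<nu> m \<le> t \<Longrightarrow> t < \<nu> (m + 1) \<Longrightarrow> h t = h (\<nu> m)"
    and h_change: "\<And>m. 1 \<le> m \<Longrightarrow> m \<le> M \<Longrightarrow> h (\<nu> m - 1) \<noteq> h (\<nu> m)"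
    and nu_L: "\<And>m. m < M \<Longrightarrow> L \<le> \<nu> (m + 1) - \<nu> m"
    using bf unfolding block_fading_def Ball_def atLeastLessThan_iff atLeastAtMost_iff by blast+
  have nu_mono: "\<nu> i \<le> \<nu> j" if "i \<le> j" "j \<le> M + 1" for i j
    using that
  proof (induction rule: dec_induct)
    case (step k)
    then show ?case using nu_less[of k] by simp
  qed simp
  have "1 \<le> Q" using chanD[OF h, of 0] by simp
  note KB = KB_bounds[OF this]
  have wF1: "1 \<le> w * F" using w_pos F_ge by (cases w; cases F) auto
  \<comment> \<open>Backward induction over the blocks. The restart slot c' lies at most w F slots
    into block M - j; as 3 w F \<le> L, at least 2 w F slots remain before the next change, as
    \<open>change_block\<close> demands.\<close>
  have "regret R r \<theta> (\<lambda>t. h (c' + t)) pol (T - c') \<le> real (j + 1) * (KB * G) + r R * real (T - c') / real F"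
    if "j \<le> M" "\<nu> (M - j) \<le> c' + 1" "c' + 1 \<le> \<nu> (M - j) + w * F" "c' + 1 \<le> \<nu> (M - j + 1)" for j c'
    using that
  proof (induction j arbitrary: c')
    case 0
    have nT: "real (T - c') \<le> n" using T by linarith
    have "regret R r \<theta> (\<lambda>t. h (c' + t)) pol (T - c') \<le> r R * real (T - c') / real F + r R * (real R * (K1 * l\<^sup>2) + 4 * real R)"
    proof (rule last_block[OF _ _ _ nT])
      show "chan (\<lambda>t. h (c' + t))" using h by (simp add: chan_def)
      show "h (c' + t) = h (\<nu> M)" if "1 \<le> t" "t \<le> T - c'" for t
        using h_block[of M "c' + t"] that 0 nuT by simp
      show "h (\<nu> M) \<in> {1..Q}" by (rule chanD[OF h])
    qed
    then show ?case using KB(2) by simp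
  next
    case (Suc j)
    define i where "i = M - Suc j"
    have i: "i < M" "M - j = i + 1" using Suc.prems by (auto simp: i_def)
    have c1: "\<nu> i \<le> c' + 1" "c' + 1 \<le> \<nu> i + w * F" "c' + 1 \<le> \<nu> (i + 1)"
      using Suc.prems by (auto simp: i_def)
    define m where "m = \<nu> (i + 1) - 1 - c'"
    have m: "c' + m + 1 = \<nu> (i + 1)" using c1 by (simp add: m_def)
    have Li: "\<nu> i + L \<le> \<nu> (i + 1)" using nu_L[OF i(1)] nu_less[of i] i by simp
    have nuT': "\<nu> (i + 1) < T + 1"
      using nu_less[of "i + 1"] nu_mono[of "i + 2" "M + 1"] nuT i by simp
    have mN: "m < T - c'" using m nuT' by linarith
    have nT: "real (T - c') \<le> n" using T by linarith
    have KG: "0 \<le> KB * G" using KB(3) G_ge by simp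
    have end_block: "c' + t < \<nu> (i + 2)" if "t \<le> T - c'" "t \<le> m + w * F" for t
    proof (cases "i + 1 = M")
      case True
      then show ?thesis using that nuT mN by simp
    next
      case False
      then have "\<nu> (i + 1) + L \<le> \<nu> (i + 2)"
        using nu_L[of "i + 1"] nu_less[of "i + 1"] i by simp
      then show ?thesis using that m L wF1 by linarith
    qed
    have "regret R r \<theta> (\<lambda>t. h (c' + t)) pol (T - c') \<le> real (j + 1) * (KB * G) + r R * real (T - c') / real F +
       r R * (real R * (K1 * l\<^sup>2) + real R * (c * l) + K3 * G + 16 * real R)"
    proof (rule change_block[where m = m and q = "h (\<nu> i)" and q' = "h (\<nu> (i + 1))"])
      show "chan (\<lambda>t. h (c' + t))" using h by (simp add: chan_def)
      show "h (\<nu> i) \<in> {1..Q}" "h (\<nu> (i + 1)) \<in> {1..Q}" by (rule chanD[OF h])+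
      have "h (\<nu> (i + 1) - 1) = h (\<nu> i)"
        using h_block[of i "\<nu> (i + 1) - 1"] nu_less[of i] i by simp
      then show "h (\<nu> i) \<noteq> h (\<nu> (i + 1))"
        using h_change[of "i + 1"] i by simp
      show "h (c' + t) = h (\<nu> i)" if "1 \<le> t" "t \<le> m" for t
        using h_block[of i "c' + t"] that m c1 i by simp
      show "h (c' + t) = h (\<nu> (i + 1))" if "m < t" "t \<le> T - c'" "t \<le> m + w * F" for t
        using h_block[of "i + 1" "c' + t"] that m i end_block[OF that(2,3)] by simp
      show "m < T - c'" by (rule mN)
      show "2 * (w * F) \<le> m" using m c1 Li L by linarith
      show "0 \<le> real (j + 1) * (KB * G)" using KG by simp
      fix s assume s: "m < s" "s \<le> T - c'" "s \<le> m + w * F"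
      have "regret R r \<theta> (\<lambda>t. h ((c' + s) + t)) pol (T - (c' + s)) \<le> real (j + 1) * (KB * G) + r R * real (T - (c' + s)) / real F"
      proof (rule Suc.IH)
        show "j \<le> M" using Suc.prems by simp
        show "\<nu> (M - j) \<le> c' + s + 1" using s m i by simp
        show "c' + s + 1 \<le> \<nu> (M - j) + w * F" using s m i by simp
        show "c' + s + 1 \<le> \<nu> (M - j + 1)"
          using end_block[OF s(2,3)] i(2) by simp
      qed
      then show "regret R r \<theta> (\<lambda>t. h (c' + (s + t))) pol (T - c' - s) \<le> real (j + 1) * (KB * G) + r R * real (T - c' - s) / real F"
        by (simp add: add.assoc)
    qed (rule nT)
    then show ?case using KB(1) by (simp add: distrib_right)
  qed
  from this[of M 0] show ?thesis
    using nu0 nu_less[of 0] wF1 by simp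
qed

end

section \<open>Tuning of the constants\<close>

lemma tuning_eventually:
  fixes \<alpha> c z e R :: real
  assumes "0 < \<alpha>" "0 < c" "0 < z" "0 < e" "0 < R"
  shows "\<forall>\<^sub>F n in at_top. 1 \<le> ln n \<and> ln n \<le> n \<and> ln n ^ 4 \<le> (n powr \<alpha>) powr (1/4) \<and>
    4 * R\<^sup>2 / e \<le> n powr \<alpha> \<and> R\<^sup>2 * (c * ln n) \<le> n powr \<alpha> \<and> 16 * (c * ln n + 1) ^ 4 \<le> n powr \<alpha> \<and>
    2 * R * (c * ln n) \<le> n powr \<alpha> \<and> 8 * (R * (c * ln n) + 4 * ln n / z) \<le> n powr \<alpha>"
proof (intro eventually_conj)
  show "\<forall>\<^sub>F n::real in at_top. 1 \<le> ln n" by real_asymp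
  show "\<forall>\<^sub>F n::real in at_top. ln n \<le> n" by real_asymp
  have "\<forall>\<^sub>F n in at_top. ln n ^ 4 \<le> n powr (\<alpha> / 4)" using assms by real_asymp
  then show "\<forall>\<^sub>F n in at_top. ln n ^ 4 \<le> (n powr \<alpha>) powr (1/4)" by (simp add: powr_powr)
  show "\<forall>\<^sub>F n in at_top. 4 * R\<^sup>2 / e \<le> n powr \<alpha>" using assms by real_asymp
  show "\<forall>\<^sub>F n in at_top. R\<^sup>2 * (c * ln n) \<le> n powr \<alpha>" using assms by real_asymp
  show "\<forall>\<^sub>F n in at_top. 16 * (c * ln n + 1) ^ 4 \<le> n powr \<alpha>" using assms by real_asymp
  show "\<forall>\<^sub>F n in at_top. 2 * R * (c * ln n) \<le> n powr \<alpha>" using assms by real_asymp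
  show "\<forall>\<^sub>F n in at_top. 8 * (R * (c * ln n) + 4 * ln n / z) \<le> n powr \<alpha>" using assms by real_asymp
qed

lemma exp_minus_ln_le:
  assumes "0 < n" "real k * ln n \<le> x"
  shows "exp (- x) \<le> 1 / n ^ k"
proof -
  have "exp (- x) \<le> exp (- (real k * ln n))" using assms by simp
  also have "\<dots> = 1 / n ^ k"
    using assms by (simp add: exp_minus exp_of_nat_mult inverse_eq_divide)
  finally show ?thesis .
qed

text \<open>With d = x - v the ratio is (d + e) / (d - e), which is at most K iff e (K + 1) \<le> d
  (K - 1).\<close>

lemma level_ratio_le:
  fixes x v e K :: real
  assumes "0 < x" "v < x" "0 < e" "1 < K" "e \<le> (x - v) * (K - 1) / (K + 1)"
  shows "v + e < x" "(1 - (v - e) / x) / (1 - (v + e) / x) \<le> K"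
proof -
  have e: "e * (K + 1) \<le> (x - v) * (K - 1)"
    using assms by (simp add: pos_le_divide_eq)
  also have "\<dots> < (x - v) * (K + 1)"
    using assms by (intro mult_strict_left_mono) auto
  finally have "e < x - v" using assms by (simp add: mult_less_cancel_right)
  then show 1: "v + e < x" by simp
  have "(1 - (v - e) / x) / (1 - (v + e) / x) = ((x - v + e) / x) / ((x - v - e) / x)"
  proof -
    have "1 - (v - e) / x = (x - v + e) / x" "1 - (v + e) / x = (x - v - e) / x"
      using assms(1) by (simp_all add: field_simps)
    then show ?thesis by (simp only:)
  qed
  also have "\<dots> = (x - v + e) / (x - v - e)" using assms by simp
  also have "\<dots> \<le> K"
    using 1 e by (subst pos_divide_le_eq) (auto simp: algebra_simps)
  finally show "(1 - (v - e) / x) / (1 - (v + e) / x) \<le> K" .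
qed

lemma finite_positive_lower_bound:
  assumes "finite A" "\<And>x. x \<in> A \<Longrightarrow> 0 < f x"
  obtains e :: real where "0 < e" "\<And>x. x \<in> A \<Longrightarrow> e \<le> f x"
proof (rule that)
  show "0 < Min (insert 1 (f ` A))"
    using assms by (subst Min_gr_iff) auto
  show "Min (insert 1 (f ` A)) \<le> f x" if "x \<in> A" for x
    using assms(1) that by (intro Min_le) auto
qed

lemma block_fading_facts:
  assumes "block_fading Q T M L \<nu> h"
  shows "1 \<le> M" "2 \<le> T" "M * L \<le> T" "2 \<le> Q"
proof -
  have M: "1 \<le> M" and nu0: "\<nu> 0 = 1" and nuT: "\<nu> (M + 1) = T + 1"
    and nu_less: "\<And>m. m \<le> M \<Longrightarrow> \<nu> m < \<nu> (m + 1)"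
    and hQ: "\<And>t. 1 \<le> t \<Longrightarrow> t \<le> T \<Longrightarrow> h t \<in> {1..Q}"
    and h_change: "\<And>m. 1 \<le> m \<Longrightarrow> m \<le> M \<Longrightarrow> h (\<nu> m - 1) \<noteq> h (\<nu> m)"
    and nu_L: "\<And>m. m < M \<Longrightarrow> L \<le> \<nu> (m + 1) - \<nu> m"
    using assms unfolding block_fading_def Ball_def atLeastLessThan_iff atLeastAtMost_iff by blast+
  show "1 \<le> M" by fact
  have grow: "1 + k * L \<le> \<nu> k" if "k \<le> M" for k
    using that
  proof (induction k)
    case (Suc k)
    then show ?case using nu_L[of k] nu_less[of k] by simp
  qed (simp add: nu0)
  have lt: "\<nu> M < T + 1" using nu_less[of M] nuT by simp
  then show "M * L \<le> T" using grow[of M] by simp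
  have grow1: "1 + k \<le> \<nu> k" if "k \<le> M" for k
    using that
  proof (induction k)
    case (Suc k)
    then show ?case using nu_less[of k] by simp
  qed (simp add: nu0)
  show "2 \<le> T" using grow1[of M] lt M by simp
  have "h (\<nu> M - 1) \<in> {1..Q}"
    by (rule hQ) (use grow1[of M] lt M in auto)
  moreover have "h (\<nu> M) \<in> {1..Q}"
    by (rule hQ) (use grow1[of M] lt M in auto)
  ultimately show "2 \<le> Q" using h_change[of M] M by auto
qed

lemma regret_channel_cong:
  assumes "\<And>t. 1 \<le> t \<Longrightarrow> t \<le> T \<Longrightarrow> h t = h' t"
  shows "regret R r \<theta> h \<pi> T = regret R r \<theta> h' \<pi> T"
proof -
  have "history_pmf \<theta> h \<pi> t = history_pmf \<theta> h' \<pi> t" if "t \<le> T" for t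
    using that assms by (induction t) auto
  moreover have "(\<Sum>t = 1..T. r (best_rate R r \<theta> (h t)) * \<theta> (h t) (best_rate R r \<theta> (h t)) - r (rate_at hs t) * \<theta> (h t) (rate_at hs t)) =
     (\<Sum>t = 1..T. r (best_rate R r \<theta> (h' t)) * \<theta> (h' t) (best_rate R r \<theta> (h' t)) - r (rate_at hs t) * \<theta> (h' t) (rate_at hs t))" for hs
    using assms by (intro sum.cong) auto
  ultimately show ?thesis by (simp add: regret_def)
qed

lemma delta_min_le:
  assumes "q \<in> {1..Q}" "q' \<in> {1..Q}" "q \<noteq> q'" "i \<in> {1..R}"
  shows "delta_min Q R \<theta> \<le> \<bar>\<theta> q' i - \<theta> q i\<bar>"
  unfolding delta_min_def
proof (rule Min_le)
  have "{\<bar>\<theta> q' i - \<theta> q i\<bar> | q q' i. q \<in> {1..Q} \<and> q' \<in> {1..Q} \<and> q \<noteq> q' \<and> i \<in> {1..R}} \<subseteq>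
     (\<lambda>(q, q', i). \<bar>\<theta> q' i - \<theta> q i\<bar>) ` ({1..Q} \<times> {1..Q} \<times> {1..R})"
  proof
    fix x assume "x \<in> {\<bar>\<theta> q' i - \<theta> q i\<bar> | q q' i. q \<in> {1..Q} \<and> q' \<in> {1..Q} \<and> q \<noteq> q' \<and> i \<in> {1..R}}"
    then obtain q q' i where "x = \<bar>\<theta> q' i - \<theta> q i\<bar>" "q \<in> {1..Q}" "q' \<in> {1..Q}" "i \<in> {1..R}"
      by blast
    then show "x \<in> (\<lambda>(q, q', i). \<bar>\<theta> q' i - \<theta> q i\<bar>) ` ({1..Q} \<times> {1..Q} \<times> {1..R})"
      by (intro image_eqI[of _ _ "(q, q', i)"]) auto
  qed
  then show "finite {\<bar>\<theta> q' i - \<theta> q i\<bar> | q q' i. q \<in> {1..Q} \<and> q' \<in> {1..Q} \<and> q \<noteq> q' \<and> i \<in> {1..R}}"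
    by (rule finite_subset) simp
qed (use assms in blast)

theorem theorem1:
  fixes Q R :: nat and r :: "nat \<Rightarrow> real" and \<theta> :: "nat \<Rightarrow> nat \<Rightarrow> real" and \<alpha> :: real
  assumes "1 \<le> R"
    and "0 < r 1" and "strict_mono_on {1..R} r"
    and "\<forall>q\<in>{1..Q}. \<theta> q 1 < 1 \<and> strict_antimono_on {1..R} (\<theta> q) \<and> 0 < \<theta> q R"
    and "0 < delta_min Q R \<theta>"
    and "0 < \<alpha>"
  shows "\<exists>C. \<forall>(T::nat) (M::nat) (L::nat) \<nu> h.
    block_fading Q T M L \<nu> h \<longrightarrow>
    48 / (delta_min Q R \<theta>)\<^sup>2 * real (M * T) powr \<alpha> * ln (real (M * T)) \<le> real L \<longrightarrow>
    regret R r \<theta> h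
      (cdts R r (nat \<lceil>12 / (delta_min Q R \<theta>)\<^sup>2 * ln (real (M * T))\<rceil>)
                (delta_min Q R \<theta> / 2)
                (nat \<lceil>real (M * T) powr \<alpha>\<rceil>)) T
    \<le> C * (real (M * T) powr max \<alpha> (1 - \<alpha>) * ln (real (M * T)))"
proof (cases "2 \<le> Q")
  \<comment> \<open>A change point needs two different states, so with fewer than two no channel
    satisfies \<open>block_fading\<close>.\<close>
  case False
  then show ?thesis using block_fading_facts(4) by blast
next
  case Q2: True
  define D where "D = delta_min Q R \<theta>"
  have r_mono: "r i \<le> r j" if "i \<in> {1..R}" "j \<in> {1..R}" "i \<le> j" for i j
    using assms(3) that strict_mono_onD[of "{1..R}" r i j] by (cases "i = j") auto
  have r_pos: "0 < r i" if "i \<in> {1..R}" for i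
    using r_mono[of 1 i] that assms(1,2) by simp
  have r_le: "r i \<le> r R" if "i \<in> {1..R}" for i
    using r_mono[of i R] that assms(1) by simp
  have \<theta>_bounds: "0 < \<theta> q i \<and> \<theta> q i < 1" if q: "q \<in> {1..Q}" and i: "i \<in> {1..R}" for q i
  proof -
    have anti: "\<theta> q j \<le> \<theta> q i" if "i \<in> {1..R}" "j \<in> {1..R}" "i \<le> j" for i j
      using assms(4) q that monotone_onD[of "{1..R}" "(<)" "(>)" "\<theta> q" i j] by (cases "i = j") auto
    have "\<theta> q R \<le> \<theta> q i" "\<theta> q i \<le> \<theta> q 1" using i assms(1) by (auto intro: anti)
    then show ?thesis using assms(4) q by fastforce
  qed
  have rR: "0 < r R" using r_pos assms(1) by simp
  have run: "cdts_run R r \<theta> Q w F" if "1 \<le> w" "2 \<le> F" for w F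
    by unfold_locales (use that assms(1) r_pos r_le \<theta>_bounds in auto)
  have D0: "0 < D" using assms(5) by (simp add: D_def)
  have D_sep: "D \<le> \<bar>\<theta> q' i - \<theta> q i\<bar>" if "q \<in> {1..Q}" "q' \<in> {1..Q}" "q \<noteq> q'" "i \<in> {1..R}" for q q' i
    unfolding D_def by (rule delta_min_le[OF that])
  have D1: "D \<le> 1"
    using D_sep[of 1 2 1] \<theta>_bounds[of 1 1] \<theta>_bounds[of 2 1] Q2 assms(1) by auto
  have D2: "0 < D\<^sup>2" "D\<^sup>2 \<le> 1" using D0 D1 by (auto simp: power_le_one)
  \<comment> \<open>With w close to 12 l / D^2 this makes \<kappa> ^ w about exp (\<alpha> l / 4) =
    y powr (1/4).\<close>
  define \<xi> where "\<xi> = \<alpha> * D\<^sup>2 / 48"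
  have \<xi>: "0 < \<xi>" using assms(6) D2 by (simp add: \<xi>_def)
  define \<kappa> where "\<kappa> = exp \<xi>"
  have \<kappa>1: "1 < \<kappa>" using \<xi> by (simp add: \<kappa>_def)
  define V where "V q = r (best_rate R r \<theta> q) * \<theta> q (best_rate R r \<theta> q)" for q
  have best: "best_rate R r \<theta> q \<in> {1..R}" for q
    unfolding best_rate_def using assms(1) by (intro arg_max_on_in) auto
  have V_pos: "0 < V q" if "q \<in> {1..Q}" for q
    using r_pos[OF best] \<theta>_bounds[OF that best] by (simp add: V_def)
  \<comment> \<open>The finitely many upper bounds that e0 has to respect, with 1 in place of a
    condition that is void for the pair; the last one is that of
    \<open>level_ratio_le\<close>.\<close>
  define lim where "lim = (\<lambda>(q, k). min (V q / 2) (min (if r k * \<theta> q k < V q then (V q - r k * \<theta> q k) / 2 else 1)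
     (min (if r k < V q then V q - r k else 1) (if V q < r k then (r k - V q) * (\<kappa> - 1) / (\<kappa> + 1) else 1))))"
  have lim_pos: "0 < lim x" if "x \<in> {1..Q} \<times> {1..R}" for x
    using that V_pos \<kappa>1 by (auto simp: lim_def)
  obtain e0 where e0: "0 < e0" and e0_lim: "\<And>x. x \<in> {1..Q} \<times> {1..R} \<Longrightarrow> e0 \<le> lim x"
    using finite_positive_lower_bound[of "{1..Q} \<times> {1..R}" lim] lim_pos by blast
  have e0_le: "e0 < V q"
    "r k * \<theta> q k < V q \<Longrightarrow> r k * \<theta> q k \<le> V q - 2 * e0"
    "r k < V q \<Longrightarrow> r k \<le> V q - e0"
    "V q < r k \<Longrightarrow> e0 \<le> (r k - V q) * (\<kappa> - 1) / (\<kappa> + 1)" if "q \<in> {1..Q}" "k \<in> {1..R}" for q k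
    using e0_lim[of "(q, k)"] that V_pos[OF that(1)] by (auto simp: lim_def split: if_splits)
  define ep where "ep = e0 / (2 * r R)"
  have ep: "0 < ep" using e0 rR by (simp add: ep_def)
  \<comment> \<open>Small enough that the factor exp (z R J) uses up at most half of the exponent J
    ep^2 of \<open>del\<close>.\<close>
  define z where "z = min 1 (ep\<^sup>2 / (2 * real R))"
  have R0: "0 < real R" using assms(1) by simp
  have z: "0 < z" "z \<le> 1" "z * real R \<le> ep\<^sup>2 / 2"
  proof -
    show "0 < z" "z \<le> 1" using ep R0 by (auto simp: z_def)
    have "z * real R \<le> ep\<^sup>2 / (2 * real R) * real R"
      using R0 by (intro mult_right_mono) (auto simp: z_def)
    then show "z * real R \<le> ep\<^sup>2 / 2" using R0 by simp
  qed
  define B where "B = (\<lambda>(q, k, i). 1 / (1 - sqrt (\<theta> q k))\<^sup>2 / 2 + 36 * (real R)\<^sup>2 / (\<theta> q i)\<^sup>2)"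
  define Cs where "Cs = (\<Sum>x\<in>{1..Q} \<times> {1..R} \<times> {1..R}. B x)"
  have Cs: "1 / (1 - sqrt (\<theta> q k))\<^sup>2 / 2 + 36 * (real R)\<^sup>2 / (\<theta> q i)\<^sup>2 \<le> Cs"
    if "q \<in> {1..Q}" "k \<in> {1..R}" "i \<in> {1..R}" for q k i
  proof -
    have "B (q, k, i) \<le> Cs"
      unfolding Cs_def using that by (intro member_le_sum) (auto simp: B_def)
    then show ?thesis by (simp add: B_def)
  qed
  \<comment> \<open>The summands account for w, for J, for rounding (using l \<ge> 1) and for the
    constant factor of \<kappa> ^ (w + 1).\<close>
  define c where "c = 12 / D\<^sup>2 + 20 / ep\<^sup>2 + 3 + exp (2 * \<xi>)"
  have c1: "1 \<le> c" "0 < c"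
    unfolding c_def using D2 ep by (auto intro!: add_nonneg_nonneg add_pos_nonneg simp: add_increasing)
  \<comment> \<open>\<open>tuned.KB\<close> is a function of quantities fixed before T, M and L, so
    it may enter the final constant.\<close>
  define KB where "KB = tuned.KB R r e0 Cs z c"
  from tuning_eventually[OF assms(6) c1(2) z(1) ep R0] obtain n0 where
    n0: "\<And>n. n0 \<le> n \<Longrightarrow> 1 \<le> ln n \<and> ln n \<le> n \<and> ln n ^ 4 \<le> (n powr \<alpha>) powr (1/4) \<and>
    4 * (real R)\<^sup>2 / ep \<le> n powr \<alpha> \<and> (real R)\<^sup>2 * (c * ln n) \<le> n powr \<alpha> \<and> 16 * (c * ln n + 1) ^ 4 \<le> n powr \<alpha> \<and>
    2 * real R * (c * ln n) \<le> n powr \<alpha> \<and> 8 * (real R * (c * ln n) + 4 * ln n / z) \<le> n powr \<alpha>"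
    unfolding eventually_at_top_linorder by blast
  \<comment> \<open>The first entry serves n < n0, where the regret is at most r R n and l is at
    least ln 2.\<close>
  let ?C = "max (r R * \<bar>n0\<bar> / ln 2) (2 * \<bar>KB\<bar> + r R)"
  show ?thesis
  proof (intro exI[of _ ?C] allI impI)
    fix T M L :: nat and \<nu> h
    assume bf: "block_fading Q T M L \<nu> h"
      and L: "48 / (delta_min Q R \<theta>)\<^sup>2 * real (M * T) powr \<alpha> * ln (real (M * T)) \<le> real L"
    note bff = block_fading_facts[OF bf]
    define n where "n = real (M * T)"
    define l where "l = ln n"
    define y where "y = n powr \<alpha>"
    define w where "w = nat \<lceil>12 / D\<^sup>2 * l\<rceil>"
    define F where "F = nat \<lceil>y\<rceil>"
    \<comment> \<open>\<open>block_fading\<close> leaves the state outside the horizon open; h2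
      continues it by a valid state.\<close>
    define h2 where "h2 t = (if 1 \<le> t \<and> t \<le> T then h t else h 1)" for t
    have "1 * T \<le> M * T" using bff by (intro mult_right_mono) auto
    then have Tn: "real T \<le> n" by (simp add: n_def flip: of_nat_mult)
    then have n2: "2 \<le> n" using bff(2) by linarith
    have l2: "ln 2 \<le> l" "0 < l" using n2 by (auto simp: l_def)
    have y1: "1 < y" using n2 assms(6) by (simp add: y_def)
    have x0: "0 < 12 / D\<^sup>2 * l" using D2 l2 by simp
    have w1: "1 \<le> w" "12 / D\<^sup>2 * l \<le> real w" "real w \<le> 12 / D\<^sup>2 * l + 1"
      using x0 unfolding w_def by linarith+
    have F2: "2 \<le> F" "y \<le> real F" "real F \<le> y + 1"
      using y1 unfolding F_def by linarith+
    have hQ: "h t \<in> {1..Q}" if "1 \<le> t" "t \<le> T" for t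
      using bf that by (auto simp: block_fading_def)
    interpret run: cdts_run R r \<theta> Q w F "D / 2" by (rule run[OF w1(1) F2(1)])
    have h2: "run.chan h2"
      using hQ bff(2) by (auto simp: run.chan_def h2_def)
    have reg: "regret R r \<theta> h (cdts R r w (D / 2) F) T = regret R r \<theta> h2 (cdts R r w (D / 2) F) T"
      by (rule regret_channel_cong) (simp add: h2_def)
    let ?N = "n powr max \<alpha> (1 - \<alpha>)"
    have N1: "1 \<le> ?N" using n2 assms(6) by (intro ge_one_powr_ge_zero) auto
    have "regret R r \<theta> h (cdts R r w (D / 2) F) T \<le> ?C * (?N * l)"
    proof (cases "n0 \<le> n")
      case False
      have "regret R r \<theta> h2 (cdts R r w (D / 2) F) T \<le> r R * real T" by (rule run.regret_le[OF h2])
      also have "\<dots> \<le> r R * \<bar>n0\<bar>" using Tn False rR by (intro mult_left_mono) auto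
      also have "\<dots> = r R * \<bar>n0\<bar> / ln 2 * (1 * ln 2)" by simp
      also have "\<dots> \<le> ?C * (?N * l)"
        using N1 l2 rR by (intro mult_mono) auto
      finally show ?thesis by (simp add: reg)
    next
      case True
      note big = n0[OF True, folded l_def y_def]
      have l1: "1 \<le> l" using big by blast
      \<comment> \<open>The first part ensures w < J, the second makes J ep^2 / 4 at least 5
        l.\<close>
      define J where "J = w + 1 + nat \<lceil>20 / ep\<^sup>2 * l\<rceil>"
      have x20: "0 \<le> 20 / ep\<^sup>2 * l" using l1 by simp
      have J: "real w + 1 + 20 / ep\<^sup>2 * l \<le> real J" "real J \<le> real w + 2 + 20 / ep\<^sup>2 * l"
        using x20 unfolding J_def by linarith+
      have x12: "12 * l \<le> 12 / D\<^sup>2 * l"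
        using D2 l1 by (intro mult_right_mono) (auto simp: pos_le_divide_eq)
      have cl: "c * l = 12 / D\<^sup>2 * l + 20 / ep\<^sup>2 * l + 3 * l + exp (2 * \<xi>) * l"
        by (simp add: c_def distrib_right)
      have el: "0 \<le> exp (2 * \<xi>) * l" using l1 by simp
      have y16: "16 \<le> y"
      proof -
        have "1 \<le> (c * l + 1) ^ 4" using c1 l1 by (intro one_le_power) simp
        then show ?thesis using big by linarith
      qed
      interpret t: tuned R r \<theta> Q w F "D / 2" J e0 \<kappa> Cs z c l y n ep
      proof unfold_locales
        show "real w \<le> c * l" "real J \<le> c * l"
          unfolding cl using w1 J l1 x20 el by linarith+
        show "l \<le> real w" using w1 x12 l1 by linarith
        have "20 / ep\<^sup>2 * l * (ep\<^sup>2 / 4) \<le> real J * (ep\<^sup>2 / 4)"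
          using J by (intro mult_right_mono) auto
        then have "real 5 * l \<le> real J * ep\<^sup>2 / 4" using ep by simp
        then show "exp (- (real J * ep\<^sup>2 / 4)) \<le> 1 / n ^ 5"
          unfolding l_def using n2 by (intro exp_minus_ln_le) auto
        show "exp (- (4 * l)) \<le> 1 / n ^ 4"
          unfolding l_def using n2 by (intro exp_minus_ln_le) auto
        have "12 / D\<^sup>2 * l * (D / 2)\<^sup>2 \<le> real w * (D / 2)\<^sup>2"
          using w1 by (intro mult_right_mono) auto
        then have "real 3 * l \<le> real w * (D / 2)\<^sup>2" using D0 by (simp add: power_divide)
        then show "exp (- (real w * (D / 2)\<^sup>2)) \<le> 1 / n ^ 3"
          unfolding l_def using n2 by (intro exp_minus_ln_le) auto
        show "2 * (D / 2) \<le> \<bar>\<theta> q' i - \<theta> q i\<bar>" if "q \<in> {1..Q}" "q' \<in> {1..Q}" "q \<noteq> q'" "i \<in> {1..R}" for q q' i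
          using D_sep[OF that] by simp
        show "\<kappa> ^ (w + 1) \<le> c * y powr (1 / 4)"
        proof -
          have "\<kappa> ^ (w + 1) = exp (real (w + 1) * \<xi>)"
            by (simp only: \<kappa>_def exp_of_nat_mult)
          also have "\<dots> \<le> exp ((12 / D\<^sup>2 * l + 2) * \<xi>)"
            using w1 \<xi> by (subst exp_le_cancel_iff, intro mult_right_mono) auto
          also have "(12 / D\<^sup>2 * l + 2) * \<xi> = 2 * \<xi> + \<alpha> * l / 4"
            using D0 by (simp add: \<xi>_def field_simps)
          also have "exp (2 * \<xi> + \<alpha> * l / 4) = exp (2 * \<xi>) * exp (\<alpha> * l / 4)" by (rule exp_add)
          also have "exp (\<alpha> * l / 4) = y powr (1 / 4)"
            using n2 by (simp add: y_def l_def powr_powr powr_def)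
          also have "exp (2 * \<xi>) * y powr (1 / 4) \<le> c * y powr (1 / 4)"
            using D2 ep by (intro mult_right_mono) (auto simp: c_def add_increasing)
          finally show ?thesis .
        qed
        show "e0 < r (best_rate R r \<theta> q) * \<theta> q (best_rate R r \<theta> q)" if "q \<in> {1..Q}" for q
          using e0_le(1)[OF that best[of q]] by (simp add: V_def)
        show "r k * \<theta> q k \<le> r (best_rate R r \<theta> q) * \<theta> q (best_rate R r \<theta> q) - 2 * e0"
          if "q \<in> {1..Q}" "k \<in> {1..R}" "r k * \<theta> q k < r (best_rate R r \<theta> q) * \<theta> q (best_rate R r \<theta> q)" for q k
          using e0_le(2)[OF that(1,2)] that(3) by (simp add: V_def)
        show "r k \<le> r (best_rate R r \<theta> q) * \<theta> q (best_rate R r \<theta> q) - e0"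
          if "q \<in> {1..Q}" "k \<in> {1..R}" "r k < r (best_rate R r \<theta> q) * \<theta> q (best_rate R r \<theta> q)" for q k
          using e0_le(3)[OF that(1,2)] that(3) by (simp add: V_def)
        show "r (best_rate R r \<theta> q) * \<theta> q (best_rate R r \<theta> q) + e0 < r k"
          "(1 - (r (best_rate R r \<theta> q) * \<theta> q (best_rate R r \<theta> q) - e0) / r k) /
            (1 - (r (best_rate R r \<theta> q) * \<theta> q (best_rate R r \<theta> q) + e0) / r k) \<le> \<kappa>"
          if "q \<in> {1..Q}" "k \<in> {1..R}" "r (best_rate R r \<theta> q) * \<theta> q (best_rate R r \<theta> q) < r k" for q k
          using level_ratio_le[OF r_pos[OF that(2)] that(3) e0 \<kappa>1] e0_le(4)[OF that(1,2)] that(3) by (simp_all add: V_def)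
      qed (use big c1 e0 z n2 l1 y16 F2 w1 D0 \<kappa>1 ep_def Cs in \<open>auto simp: J_def\<close>)
      have bf2: "block_fading Q T M L \<nu> h2"
      proof -
        have nu0: "\<nu> 0 = 1" and nuT: "\<nu> (M + 1) = T + 1"
          and nu_less: "\<And>m. m \<le> M \<Longrightarrow> \<nu> m < \<nu> (m + 1)"
          and h_block: "\<And>m t. m \<le> M \<Longrightarrow> \<nu> m \<le> t \<Longrightarrow> t < \<nu> (m + 1) \<Longrightarrow> h t = h (\<nu> m)"
          and h_change: "\<And>m. 1 \<le> m \<Longrightarrow> m \<le> M \<Longrightarrow> h (\<nu> m - 1) \<noteq> h (\<nu> m)"
          and nu_L: "\<And>m. m < M \<Longrightarrow> L \<le> \<nu> (m + 1) - \<nu> m"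
          using bf unfolding block_fading_def Ball_def atLeastLessThan_iff atLeastAtMost_iff by blast+
        have nu_ge: "1 + k \<le> \<nu> k" if "k \<le> M" for k
          using that
        proof (induction k)
          case (Suc k)
          then show ?case using nu_less[of k] by simp
        qed (simp add: nu0)
        have nu_le: "\<nu> k \<le> T + 1" if "k \<le> M + 1" for k
        proof -
          have "\<nu> k \<le> \<nu> (M + 1)"
            using that
          proof (induction rule: inc_induct)
            case (step i)
            then show ?case using nu_less[of i] by simp
          qed simp
          then show ?thesis using nuT by linarith
        qed
        have h2_block: "h2 t = h t" if "m \<le> M" "\<nu> m \<le> t" "t < \<nu> (m + 1)" for m t
          using nu_ge[of m] nu_le[of "m + 1"] that by (simp add: h2_def)
        have h2_nu: "h2 (\<nu> m) = h (\<nu> m)" if "m \<le> M" for m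
          using h2_block[of m "\<nu> m"] nu_less[OF that] that by simp
        have blk: "h2 t = h2 (\<nu> m)" if "m \<le> M" "\<nu> m \<le> t" "t < \<nu> (m + 1)" for m t
          using h2_block[OF that] h2_nu[OF that(1)] h_block[OF that] by simp
        have chg: "h2 (\<nu> m - 1) \<noteq> h2 (\<nu> m)" if "1 \<le> m" "m \<le> M" for m
        proof -
          have "h2 (\<nu> m - 1) = h (\<nu> m - 1)"
          proof -
            have "1 \<le> \<nu> m - 1" "\<nu> m - 1 \<le> T"
              using nu_ge[of m] nu_le[of m] that by linarith+
            then show ?thesis by (simp only: h2_def if_True simp_thms)
          qed
          then show ?thesis using h_change[OF that] h2_nu[OF that(2)] by simp
        qed
        show ?thesis
          unfolding block_fading_def
        proof (intro conjI allI impI ballI)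
          show "h2 t \<in> {1..Q}" for t by (rule run.chanD[OF h2])
          show "h2 t = h2 (\<nu> m)" if "m \<le> M" "t \<in> {\<nu> m..<\<nu> (m + 1)}" for m t
            using that by (intro blk) auto
          show "h2 (\<nu> m - 1) \<noteq> h2 (\<nu> m)" if "m \<in> {1..M}" for m
            using that by (intro chg) auto
        qed (fact bff(1) nu0 nuT nu_less nu_L)+
      qed
      define x where "x = 12 / D\<^sup>2 * l"
      have x12': "12 \<le> x" using x12 l1 unfolding x_def by linarith
      \<comment> \<open>Rounding w and F up costs at most 13/12 and 17/16, together less than 4/3.
        Since 48 = 4 * 12, this leaves 3 w F \<le> L.\<close>
      have "(x + 1) * (y + 1) \<le> (13 / 12 * x) * (17 / 16 * y)"
        using x12' y16 by (intro mult_mono) auto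
      also have "\<dots> \<le> 4 / 3 * (x * y)"
        using x12' y16 by simp
      finally have xy: "3 * ((x + 1) * (y + 1)) \<le> 4 * (x * y)" by simp
      have "3 * (real w * real F) \<le> 3 * ((x + 1) * (y + 1))"
        using w1 F2 x12' y16 by (intro mult_left_mono mult_mono) (auto simp: x_def)
      also have "\<dots> \<le> 4 * (x * y)" by (rule xy)
      also have "\<dots> = 48 / D\<^sup>2 * y * l" by (simp add: x_def)
      also have "\<dots> \<le> real L" using L by (simp add: D_def n_def l_def y_def)
      finally have "real (3 * (w * F)) \<le> real L" by simp
      then have wFL: "3 * (w * F) \<le> L" by (simp only: of_nat_le_iff)
      have "regret R r \<theta> h2 (cdts R r w (D / 2) F) T \<le> real (M + 1) * (KB * t.G) + r R * real T / real F"
        unfolding KB_def by (rule t.tuned_regret) (use h2 bf2 Tn wFL in auto)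
      also have "\<dots> \<le> 2 * \<bar>KB\<bar> * (?N * l) + r R * (?N * l)"
      proof (rule add_mono)
        have G0: "0 \<le> t.G" using t.G_ge by simp
        have M1: "real (M + 1) \<le> 2 * real M" using bff(1) by simp
        have "1 * (y * l) \<le> 48 / D\<^sup>2 * (y * l)"
          using D2 y1 l1 by (intro mult_right_mono) (auto simp: pos_le_divide_eq)
        then have "y * l \<le> real L" using L by (simp add: D_def n_def l_def y_def mult_ac)
        \<comment> \<open>M blocks of length L fit into the horizon, hence M^2 l y \<le> M T =
          n.\<close>
        then have "real M * (real M * (y * l)) \<le> real M * (real M * real L)"
          by (intro mult_left_mono) auto
        also have "\<dots> \<le> real M * real T"
          using bff(3) by (intro mult_left_mono) (auto simp flip: of_nat_mult)
        also have "\<dots> = n" by (simp add: n_def)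
        finally have "(real M * sqrt (l * y))\<^sup>2 \<le> n"
          using l1 y1 by (simp add: power_mult_distrib power2_eq_square mult_ac)
        then have "real M * sqrt (l * y) \<le> sqrt n" by (rule real_le_rsqrt)
        also have "sqrt n = n powr (1 / 2)" using n2 by (simp add: powr_half_sqrt)
        \<comment> \<open>One of \<alpha> and 1 - \<alpha> is at least 1/2.\<close>
        also have "\<dots> \<le> ?N"
          using n2 by (intro powr_mono) (auto simp: max_def)
        finally have MG: "real M * t.G \<le> ?N * l"
          unfolding t.G_def using l1 by (simp add: mult_ac mult_left_mono)
        have "real (M + 1) * (KB * t.G) \<le> real (M + 1) * (\<bar>KB\<bar> * t.G)"
          using G0 by (intro mult_left_mono mult_right_mono) auto
        also have "\<dots> \<le> 2 * real M * (\<bar>KB\<bar> * t.G)"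
          using M1 G0 by (intro mult_right_mono) auto
        also have "\<dots> = 2 * \<bar>KB\<bar> * (real M * t.G)" by simp
        also have "\<dots> \<le> 2 * \<bar>KB\<bar> * (?N * l)"
          using MG by (intro mult_left_mono) auto
        finally show "real (M + 1) * (KB * t.G) \<le> 2 * \<bar>KB\<bar> * (?N * l)" .
        have "real T / real F \<le> n / y"
          using Tn F2 y1 n2 by (intro frac_le) auto
        also have "\<dots> = n powr (1 - \<alpha>)"
          using n2 by (simp add: y_def powr_diff)
        also have "\<dots> \<le> ?N * 1" using n2 by (simp add: powr_mono)
        also have "\<dots> \<le> ?N * l" using l1 by (intro mult_left_mono) auto
        finally have "r R * (real T / real F) \<le> r R * (?N * l)"
          using rR by (intro mult_left_mono) auto
        then show "r R * real T / real F \<le> r R * (?N * l)" by simp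
      qed
      also have "\<dots> = (2 * \<bar>KB\<bar> + r R) * (?N * l)" by (simp add: distrib_right)
      also have "\<dots> \<le> ?C * (?N * l)"
        using N1 l1 by (intro mult_right_mono) auto
      finally show ?thesis by (simp add: reg)
    qed
    then show "regret R r \<theta> h
      (cdts R r (nat \<lceil>12 / (delta_min Q R \<theta>)\<^sup>2 * ln (real (M * T))\<rceil>)
                (delta_min Q R \<theta> / 2)
                (nat \<lceil>real (M * T) powr \<alpha>\<rceil>)) T
    \<le> ?C * (real (M * T) powr max \<alpha> (1 - \<alpha>) * ln (real (M * T)))"
      by (simp only: w_def F_def D_def l_def y_def n_def)
  qed
qed

end
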